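(* Assume the Ultrapower Axiom. Then the seed order is wellfounded: there is no sequence \(\langle U_i:i<\omega\rangle\) of uniform ultrafilters with \(U_{i+1}<_S U_i\) for all \(i\), where \(U<_S U'\) means \(U\leq_S U'\) and \(U\neq U'\).
   Context: For a countably complete ultrafilter \(U\), \(\mathrm{Ult}(V,U)\) is the transitive collapse of the ultrapower of \(V\) by \(U\), \(j_U\) its embedding and \([\mathrm{id}]_U\) the class of the identity. A uniform ultrafilter is a countably complete ultrafilter \(U\) on \([\kappa]^n\) (the \(n\)-element subsets of an ordinal \(\kappa\)) with \(\kappa\) least such that \([\kappa]^n\in U\). Finite sets of ordinals are ordered by \(a<b\) iff the largest element of their symmetric difference lies in \(b\). A comparison of \(\langle U_0,U_1\rangle\) by internal ultrafilters is a pair \(\langle W_0,W_1\rangle\) with \(W_i\in\mathrm{Ult}(V,U_i)\) a countably complete ultrafilter there, \(\mathrm{Ult}(\mathrm{Ult}(V,U_0),W_0)=\mathrm{Ult}(\mathrm{Ult}(V,U_1),W_1)\) and \(j_{W_0}\circ j_{U_0}=j_{W_1}\circ j_{U_1}\). The Ultrapower Axiom: every pair of countably complete ultrafilters admits such a comparison. Seed order: \(U_0\leq_S U_1\) iff some comparison \(\langle W_0,W_1\rangle\) of \(\langle U_0,U_1\rangle\) has \(j_{W_0}([\mathrm{id}]_{U_0})\leq j_{W_1}([\mathrm{id}]_{U_1})\). *)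

theory Defs
  imports Main
begin

text \<open>
  The universe of sets is an arbitrary first-order model of ZFC: a type \<open>'v\<close> with a relation
  \<open>\<epsilon>\<close>, neither of which need be well-founded or \<open>\<omega>\<close>-standard from the outside. A statement
  proved for all such structures is a theorem of ZFC. All notions below are the ones of the
  model: "function", "natural number", "sequence" refer to elements of \<open>'v\<close>.
  Classes are HOL sets of type \<open>'v set\<close>.
\<close>

datatype fm = Mem nat nat | Equal nat nat | Neg fm | Conj fm fm | Ex nat fm

context
  fixes E :: "'v \<Rightarrow> 'v \<Rightarrow> bool"  (infix "\<epsilon>" 50)
begin

definition ext :: "'v \<Rightarrow> 'v set" where
  "ext x = {z. z \<epsilon> x}"

primrec sat :: "(nat \<Rightarrow> 'v) \<Rightarrow> fm \<Rightarrow> bool" where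
  "sat e (Mem i j) = (e i \<epsilon> e j)"
| "sat e (Equal i j) = (e i = e j)"
| "sat e (Neg p) = (\<not> sat e p)"
| "sat e (Conj p q) = (sat e p \<and> sat e q)"
| "sat e (Ex i p) = (\<exists>x. sat (e(i := x)) p)"

text \<open>In the two schemes the values of \<open>e\<close> at the remaining indices are the parameters.\<close>

definition ZFC :: bool where
  "ZFC \<longleftrightarrow>
    \<comment> \<open>Extensionality\<close>
    (\<forall>x y. ext x = ext y \<longrightarrow> x = y) \<and>
    \<comment> \<open>Foundation\<close>
    (\<forall>x. ext x \<noteq> {} \<longrightarrow> (\<exists>y\<in>ext x. ext y \<inter> ext x = {})) \<and>
    \<comment> \<open>Pairing\<close>
    (\<forall>x y. \<exists>z. ext z = {x, y}) \<and>
    \<comment> \<open>Union\<close>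
    (\<forall>x. \<exists>u. ext u = (\<Union>y\<in>ext x. ext y)) \<and>
    \<comment> \<open>Power set\<close>
    (\<forall>x. \<exists>p. ext p = {y. ext y \<subseteq> ext x}) \<and>
    \<comment> \<open>Infinity\<close>
    (\<exists>w. (\<exists>z\<in>ext w. ext z = {}) \<and>
         (\<forall>x\<in>ext w. \<exists>y\<in>ext w. ext y = insert x (ext x))) \<and>
    \<comment> \<open>Separation scheme\<close>
    (\<forall>p e x. \<exists>y. ext y = {z \<in> ext x. sat (e(0 := z)) p}) \<and>
    \<comment> \<open>Replacement scheme\<close>
    (\<forall>p e x. (\<forall>z\<in>ext x. \<exists>!w. sat (e(0 := z, 1 := w)) p) \<longrightarrow>
       (\<exists>y. ext y = {w. \<exists>z\<in>ext x. sat (e(0 := z, 1 := w)) p})) \<and>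
    \<comment> \<open>Choice\<close>
    (\<forall>x. (\<forall>y\<in>ext x. ext y \<noteq> {}) \<and>
         (\<forall>y\<in>ext x. \<forall>z\<in>ext x. y \<noteq> z \<longrightarrow> ext y \<inter> ext z = {}) \<longrightarrow>
       (\<exists>c. \<forall>y\<in>ext x. \<exists>!z. z \<in> ext c \<inter> ext y))"

text \<open>Definability over the universe, with parameters.\<close>

definition definable :: "('v \<Rightarrow> 'v \<Rightarrow> bool) \<Rightarrow> bool" where
  "definable R \<longleftrightarrow> (\<exists>p e. \<forall>x y. R x y \<longleftrightarrow> sat (e(0 := x, 1 := y)) p)"


text \<open>By Foundation, an ordinal is a transitive set of transitive sets.\<close>

definition transitive :: "'v \<Rightarrow> bool" where
  "transitive x \<longleftrightarrow> (\<forall>y\<in>ext x. ext y \<subseteq> ext x)"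

definition ordinal :: "'v \<Rightarrow> bool" where
  "ordinal x \<longleftrightarrow> transitive x \<and> (\<forall>y\<in>ext x. transitive y)"

definition is_succ :: "'v \<Rightarrow> 'v \<Rightarrow> bool" where
  "is_succ m n \<longleftrightarrow> ext m = insert n (ext n)"

text \<open>The finite ordinals of the model.\<close>

definition natural :: "'v \<Rightarrow> bool" where
  "natural n \<longleftrightarrow> ordinal n \<and>
     (\<forall>m. m = n \<or> m \<epsilon> n \<longrightarrow> ext m = {} \<or> (\<exists>k. is_succ m k))"

text \<open>Kuratowski pairs; functions are sets of pairs, here with domain (coding) the HOL set \<open>D\<close>.\<close>

definition is_pair :: "'v \<Rightarrow> 'v \<Rightarrow> 'v \<Rightarrow> bool" where
  "is_pair p x y \<longleftrightarrow> (\<exists>a b. ext a = {x} \<and> ext b = {x, y} \<and> ext p = {a, b})"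

definition func :: "'v \<Rightarrow> 'v set \<Rightarrow> bool" where
  "func f D \<longleftrightarrow> (\<forall>p\<in>ext f. \<exists>x\<in>D. \<exists>y. is_pair p x y) \<and>
     (\<forall>x\<in>D. \<exists>!y. \<exists>p\<in>ext f. is_pair p x y)"

definition app :: "'v \<Rightarrow> 'v \<Rightarrow> 'v" where
  "app f x = (THE y. \<exists>p\<in>ext f. is_pair p x y)"

definition lam :: "'v \<Rightarrow> ('v \<Rightarrow> 'v) \<Rightarrow> 'v" where
  "lam X F = (THE f. func f (ext X) \<and> (\<forall>x\<in>ext X. app f x = F x))"


text \<open>
  \<open>cc_ultrafilter A X U\<close>: in the class \<open>A\<close>, \<open>U\<close> is a countably complete ultrafilter on \<open>X\<close>.
  This is the relativization to \<open>A\<close>. It is used for \<open>A\<close> the universe or an ultrapower, that is,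
  for transitive inner models, so elements of members of \<open>A\<close> are in \<open>A\<close>, and pairs, functions
  and natural numbers are absolute. Principal ultrafilters are included.
\<close>

definition cc_ultrafilter :: "'v set \<Rightarrow> 'v \<Rightarrow> 'v \<Rightarrow> bool" where
  "cc_ultrafilter A X U \<longleftrightarrow>
     X \<in> A \<and> U \<in> A \<and>
     (\<forall>S\<in>ext U. ext S \<subseteq> ext X \<and> ext S \<noteq> {}) \<and>
     X \<epsilon> U \<and>
     (\<forall>S\<in>ext U. \<forall>T\<in>A. ext S \<subseteq> ext T \<and> ext T \<subseteq> ext X \<longrightarrow> T \<epsilon> U) \<and>
     (\<forall>S\<in>A. ext S \<subseteq> ext X \<longrightarrow> S \<epsilon> U \<or> (\<exists>T\<in>ext U. ext T = ext X - ext S)) \<and>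
     (\<forall>f\<in>A. func f {n. natural n} \<and> (\<forall>n. natural n \<longrightarrow> app f n \<epsilon> U) \<longrightarrow>
        (\<exists>T\<in>ext U. ext T = {x \<in> ext X. \<forall>n. natural n \<longrightarrow> x \<epsilon> app f n}))"

definition functions_on :: "'v set \<Rightarrow> 'v \<Rightarrow> 'v set" where
  "functions_on A X = {f \<in> A. func f (ext X)}"

definition eq_mod :: "'v \<Rightarrow> 'v \<Rightarrow> 'v \<Rightarrow> 'v \<Rightarrow> bool" where
  "eq_mod X U f g \<longleftrightarrow> (\<exists>S\<in>ext U. ext S = {x \<in> ext X. app f x = app g x})"

definition mem_mod :: "'v \<Rightarrow> 'v \<Rightarrow> 'v \<Rightarrow> 'v \<Rightarrow> bool" where
  "mem_mod X U f g \<longleftrightarrow> (\<exists>S\<in>ext U. ext S = {x \<in> ext X. app f x \<epsilon> app g x})"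

text \<open>
  \<open>collapse_map A X U c\<close>: \<open>c\<close> sends a function \<open>f \<in> A\<close> on \<open>X\<close> to the image of its class modulo \<open>U\<close>
  under the Mostowski collapse of the ultrapower of \<open>A\<close> by \<open>U\<close>. Class functions of the model are
  the definable ones; definability makes \<open>c\<close> unique (on functions) even if \<open>\<epsilon>\<close> is ill-founded
  from the outside.
\<close>

definition collapse_map :: "'v set \<Rightarrow> 'v \<Rightarrow> 'v \<Rightarrow> ('v \<Rightarrow> 'v) \<Rightarrow> bool" where
  "collapse_map A X U c \<longleftrightarrow>
     (\<forall>f\<in>functions_on A X. \<forall>g\<in>functions_on A X. c f = c g \<longleftrightarrow> eq_mod X U f g) \<and>
     (\<forall>f\<in>functions_on A X. ext (c f) = c ` {g \<in> functions_on A X. mem_mod X U g f}) \<and>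
     definable (\<lambda>f y. f \<in> functions_on A X \<and> y = c f)"

text \<open>
  \<open>ultrapower A U M j s\<close>: in \<open>A\<close>, \<open>U\<close> is a countably complete ultrafilter (on some set),
  \<open>M = Ult(A,U)\<close>, \<open>j : A \<rightarrow> M\<close> is the ultrapower embedding and \<open>s\<close> is the class of the identity.
\<close>

definition ultrapower :: "'v set \<Rightarrow> 'v \<Rightarrow> 'v set \<Rightarrow> ('v \<Rightarrow> 'v) \<Rightarrow> 'v \<Rightarrow> bool" where
  "ultrapower A U M j s \<longleftrightarrow>
     (\<exists>X c. cc_ultrafilter A X U \<and> collapse_map A X U c \<and>
        M = c ` functions_on A X \<and>
        (\<forall>a\<in>A. j a = c (lam X (\<lambda>_. a))) \<and>
        s = c (lam X (\<lambda>x. x)))"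

text \<open>
  \<open>comparison U0 U1 W0 W1 t0 t1\<close>: \<open>\<langle>W0,W1\<rangle>\<close> is a comparison of \<open>\<langle>U0,U1\<rangle>\<close> by internal ultrafilters
  and \<open>t0\<close>, \<open>t1\<close> are the images under \<open>W0\<close>, \<open>W1\<close> of the classes of the identity modulo \<open>U0\<close>, \<open>U1\<close>.
\<close>

definition comparison :: "'v \<Rightarrow> 'v \<Rightarrow> 'v \<Rightarrow> 'v \<Rightarrow> 'v \<Rightarrow> 'v \<Rightarrow> bool" where
  "comparison U0 U1 W0 W1 t0 t1 \<longleftrightarrow>
     (\<exists>M0 j0 s0 M1 j1 s1 N0 k0 r0 N1 k1 r1.
        ultrapower UNIV U0 M0 j0 s0 \<and> ultrapower UNIV U1 M1 j1 s1 \<and>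
        ultrapower M0 W0 N0 k0 r0 \<and> ultrapower M1 W1 N1 k1 r1 \<and>
        N0 = N1 \<and> k0 \<circ> j0 = k1 \<circ> j1 \<and>
        t0 = k0 s0 \<and> t1 = k1 s1)"

definition Ultrapower_Axiom :: bool where
  "Ultrapower_Axiom \<longleftrightarrow>
     (\<forall>U0 X0 U1 X1. cc_ultrafilter UNIV X0 U0 \<and> cc_ultrafilter UNIV X1 U1 \<longrightarrow>
        (\<exists>W0 W1 t0 t1. comparison U0 U1 W0 W1 t0 t1))"


text \<open>The order on finite sets of ordinals: the largest element of the symmetric difference of
  \<open>a\<close> and \<open>b\<close> lies in \<open>b\<close>.\<close>

definition finset_less :: "'v \<Rightarrow> 'v \<Rightarrow> bool" where
  "finset_less a b \<longleftrightarrow>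
     (\<exists>m \<in> (ext a - ext b) \<union> (ext b - ext a).
        (\<forall>z \<in> (ext a - ext b) \<union> (ext b - ext a). z = m \<or> z \<epsilon> m) \<and> m \<epsilon> b)"

definition seed_le :: "'v \<Rightarrow> 'v \<Rightarrow> bool" where
  "seed_le U0 U1 \<longleftrightarrow>
     (\<exists>W0 W1 t0 t1. comparison U0 U1 W0 W1 t0 t1 \<and> (finset_less t0 t1 \<or> t0 = t1))"

definition seed_less :: "'v \<Rightarrow> 'v \<Rightarrow> bool" where
  "seed_less U U' \<longleftrightarrow> seed_le U U' \<and> U \<noteq> U'"

text \<open>\<open>is_subsets \<kappa> n X\<close>: \<open>X\<close> is the set of \<open>n\<close>-element subsets of \<open>\<kappa>\<close>.\<close>

definition is_subsets :: "'v \<Rightarrow> 'v \<Rightarrow> 'v \<Rightarrow> bool" where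
  "is_subsets \<kappa> n X \<longleftrightarrow>
     ext X = {a. ext a \<subseteq> ext \<kappa> \<and> (\<exists>f. func f (ext n) \<and> bij_betw (app f) (ext n) (ext a))}"

definition uniform :: "'v \<Rightarrow> bool" where
  "uniform U \<longleftrightarrow>
     (\<exists>\<kappa> n X. ordinal \<kappa> \<and> natural n \<and> is_subsets \<kappa> n X \<and> cc_ultrafilter UNIV X U \<and>
        (\<forall>\<delta>\<in>ext \<kappa>. \<forall>Y. is_subsets \<delta> n Y \<longrightarrow> \<not> Y \<epsilon> U))"

end

end

theory Submission
  imports Defs
begin

text \<open>
  Suppose \<open>U' <\<^sub>S U\<close>, witnessed by a comparison \<open>W', W\<close> and the images \<open>t' < t\<close> of the seeds. Represent
  \<open>t'\<close> by a function \<open>g\<close> modulo \<open>W\<close> and push \<open>W\<close> forward along \<open>g\<close>: this gives in \<open>Ult(V,U)\<close> an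
  ultrafilter concentrating on sets below \<open>[id]\<close>, hence by the theorem of Los a function \<open>F\<close> such
  that for \<open>U\<close>-almost all \<open>x\<close> the ultrafilter \<open>F x\<close> concentrates on sets \<open>a < x\<close>, and \<open>U'\<close> is the
  \<open>U\<close>-limit of the \<open>F x\<close> (this is the Ketonen order). If \<open>t' = t\<close>, then \<open>U' = U\<close> by uniformity.

  Given a descending sequence with such functions \<open>F\<^sub>n\<close>, choose \<open>x\<close> at random by \<open>U\<^sub>0\<close>, then
  \<open>y < x\<close> by \<open>F\<^sub>0 x\<close>, then \<open>z < y\<close> by \<open>F\<^sub>1 y\<close>, and so on. For each \<open>m\<close>, almost every \<open>x\<close> survives
  \<open>m\<close> steps, so by countable completeness almost every \<open>x\<close> survives all finite numbers of steps.
  A minimal such \<open>x\<close> contradicts the wellfoundedness of the order on finite sets of ordinals.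

  As the universe is an arbitrary model of ZFC, the separations and replacements require that
  every predicate is shown to be definable; and the theorem of Los is available for predicates
  that are definable by one formula uniformly in all transitive classes.
\<close>

section \<open>Uniform definability over transitive classes\<close>

text \<open>\<open>W\<close> is an ultrafilter only in the sense of \<open>Ult(V,U)\<close>, so
  facts about ultrafilters whose proofs use separation and choice in \<open>V\<close> do not apply
  to it directly. No second theorem of Los is proved for \<open>W\<close>: every fact about it that
  needs such a proof is stated as a predicate of a class \<open>A\<close>, proved for
  \<open>A = UNIV\<close> and all arguments, and carried to the ultrapower by the one theorem of
  Los. Hence definability is tracked in two ways: with parameters over \<open>V\<close>, for
  separation, replacement, choice and induction, and with no parameter but \<open>zero\<close>, by
  one formula for all classes.

  The natural numbers of the model may be nonstandard, so following the random choices for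
  \<open>m\<close> steps cannot be a HOL recursion. Failing within \<open>m\<close> steps is defined
  by intersecting all sets closed under the recursion clause. The order on finite sets of ordinals
  has to be wellfounded for definable classes, not only for sets; there, finiteness enters only
  through the existence of a largest element in every nonempty subset.\<close>

primrec satR :: "('v \<Rightarrow> 'v \<Rightarrow> bool) \<Rightarrow> 'v set \<Rightarrow> (nat \<Rightarrow> 'v) \<Rightarrow> fm \<Rightarrow> bool" where
  "satR E A e (Mem i j) = E (e i) (e j)"
| "satR E A e (Equal i j) = (e i = e j)"
| "satR E A e (Neg p) = (\<not> satR E A e p)"
| "satR E A e (Conj p q) = (satR E A e p \<and> satR E A e q)"
| "satR E A e (Ex i p) = (\<exists>x\<in>A. satR E A (e(i := x)) p)"

lemma satR_UNIV: "satR E UNIV e p = sat E e p"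
  by (induction p arbitrary: e) auto

primrec var_bound :: "fm \<Rightarrow> nat" where
  "var_bound (Mem i j) = Suc (max i j)"
| "var_bound (Equal i j) = Suc (max i j)"
| "var_bound (Neg p) = var_bound p"
| "var_bound (Conj p q) = max (var_bound p) (var_bound q)"
| "var_bound (Ex i p) = max (Suc i) (var_bound p)"

lemma satR_cong: "(\<And>i. i < var_bound p \<Longrightarrow> e i = e' i) \<Longrightarrow> satR E A e p = satR E A e' p"
proof (induction p arbitrary: e e')
  case (Conj p q)
  have "satR E A e p = satR E A e' p" by (rule Conj.IH) (use Conj.prems in auto)
  moreover have "satR E A e q = satR E A e' q" by (rule Conj.IH) (use Conj.prems in auto)
  ultimately show ?case by simp
next
  case (Ex i p)
  have "satR E A (e(i := x)) p = satR E A (e'(i := x)) p" for x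
    by (rule Ex.IH) (use Ex.prems in auto)
  then show ?case by simp
next
  case (Neg p)
  have "satR E A e p = satR E A e' p" by (rule Neg.IH) (use Neg.prems in auto)
  then show ?case by simp
qed auto

lemma finite_bound: "\<exists>k::nat. \<forall>j<n::nat. \<sigma> j < k"
proof (induction n)
  case (Suc n)
  then obtain k where "\<forall>j<n. \<sigma> j < k" by auto
  then have "\<forall>j<Suc n. \<sigma> j < max k (Suc (\<sigma> n))" by (auto simp: less_Suc_eq)
  then show ?case by blast
qed auto

text \<open>Since \<open>\<sigma>\<close> need not be injective, a bound variable could be captured;
  it is renamed to an index \<open>k\<close> above all images of the variables of \<open>p\<close>.
  That \<open>q\<close> is independent of \<open>A\<close> and \<open>e\<close> is what keeps
  definability uniform over classes.\<close>

lemma satR_rename: "\<exists>q. \<forall>A e. satR E A e q = satR E A (\<lambda>i. e (\<sigma> i)) p"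
proof (induction p arbitrary: \<sigma>)
  case (Mem i j)
  show ?case by (rule exI[of _ "Mem (\<sigma> i) (\<sigma> j)"]) auto
next
  case (Equal i j)
  show ?case by (rule exI[of _ "Equal (\<sigma> i) (\<sigma> j)"]) auto
next
  case (Neg p)
  from Neg[of \<sigma>] obtain q where "\<forall>A e. satR E A e q = satR E A (\<lambda>i. e (\<sigma> i)) p" by blast
  then show ?case by (intro exI[of _ "Neg q"]) auto
next
  case (Conj p p')
  from Conj(1)[of \<sigma>] obtain q where "\<forall>A e. satR E A e q = satR E A (\<lambda>i. e (\<sigma> i)) p" by blast
  moreover from Conj(2)[of \<sigma>] obtain q' where "\<forall>A e. satR E A e q' = satR E A (\<lambda>i. e (\<sigma> i)) p'"
    by blast
  ultimately show ?case by (intro exI[of _ "Conj q q'"]) auto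
next
  case (Ex i p)
  obtain k where k: "\<forall>j<var_bound p. \<sigma> j < k" using finite_bound by blast
  from Ex[of "\<sigma>(i := k)"] obtain q
    where q: "\<And>A e. satR E A e q = satR E A (\<lambda>j. e ((\<sigma>(i := k)) j)) p" by blast
  have "satR E A (e(k := x)) q = satR E A ((\<lambda>j. e (\<sigma> j))(i := x)) p" for A e x
    unfolding q by (rule satR_cong) (use k in auto)
  then show ?case by (intro exI[of _ "Ex k q"]) auto
qed

definition merge :: "(nat \<Rightarrow> 'v) \<Rightarrow> (nat \<Rightarrow> 'v) \<Rightarrow> nat \<Rightarrow> 'v" where
  "merge e e' n = (if even n then e (n div 2) else e' (n div 2))"

lemma merge_simps [simp]: "merge e e' (2 * n) = e n" "merge e e' (Suc (2 * n)) = e' n"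
  by (auto simp: merge_def)

section \<open>Axioms of the model and sets given by HOL classes\<close>

locale zfc =
  fixes E :: "'v \<Rightarrow> 'v \<Rightarrow> bool" (infix "\<epsilon>" 50)
  assumes ZFC: "ZFC E"
begin

abbreviation ext :: "'v \<Rightarrow> 'v set" where "ext \<equiv> Defs.ext E"
abbreviation transitive :: "'v \<Rightarrow> bool" where "transitive \<equiv> Defs.transitive E"
abbreviation ordinal :: "'v \<Rightarrow> bool" where "ordinal \<equiv> Defs.ordinal E"
abbreviation is_succ :: "'v \<Rightarrow> 'v \<Rightarrow> bool" where "is_succ \<equiv> Defs.is_succ E"
abbreviation natural :: "'v \<Rightarrow> bool" where "natural \<equiv> Defs.natural E"
abbreviation is_pair :: "'v \<Rightarrow> 'v \<Rightarrow> 'v \<Rightarrow> bool" where "is_pair \<equiv> Defs.is_pair E"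
abbreviation func :: "'v \<Rightarrow> 'v set \<Rightarrow> bool" where "func \<equiv> Defs.func E"
abbreviation app :: "'v \<Rightarrow> 'v \<Rightarrow> 'v" where "app \<equiv> Defs.app E"
abbreviation lam :: "'v \<Rightarrow> ('v \<Rightarrow> 'v) \<Rightarrow> 'v" where "lam \<equiv> Defs.lam E"
abbreviation cc_ultrafilter :: "'v set \<Rightarrow> 'v \<Rightarrow> 'v \<Rightarrow> bool" where "cc_ultrafilter \<equiv> Defs.cc_ultrafilter E"
abbreviation functions_on :: "'v set \<Rightarrow> 'v \<Rightarrow> 'v set" where "functions_on \<equiv> Defs.functions_on E"
abbreviation eq_mod :: "'v \<Rightarrow> 'v \<Rightarrow> 'v \<Rightarrow> 'v \<Rightarrow> bool" where "eq_mod \<equiv> Defs.eq_mod E"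
abbreviation mem_mod :: "'v \<Rightarrow> 'v \<Rightarrow> 'v \<Rightarrow> 'v \<Rightarrow> bool" where "mem_mod \<equiv> Defs.mem_mod E"
abbreviation finset_less :: "'v \<Rightarrow> 'v \<Rightarrow> bool" where "finset_less \<equiv> Defs.finset_less E"
abbreviation is_subsets :: "'v \<Rightarrow> 'v \<Rightarrow> 'v \<Rightarrow> bool" where "is_subsets \<equiv> Defs.is_subsets E"

lemmas ax_extensionality = ZFC[unfolded ZFC_def, THEN conjunct1]
lemmas ax_foundation = ZFC[unfolded ZFC_def, THEN conjunct2, THEN conjunct1]
lemmas ax_pairing = ZFC[unfolded ZFC_def, THEN conjunct2, THEN conjunct2, THEN conjunct1]
lemmas ax_union = ZFC[unfolded ZFC_def, THEN conjunct2, THEN conjunct2, THEN conjunct2, THEN conjunct1]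
lemmas ax_power = ZFC[unfolded ZFC_def, THEN conjunct2, THEN conjunct2, THEN conjunct2, THEN conjunct2, THEN conjunct1]
lemmas ax_infinity = ZFC[unfolded ZFC_def, THEN conjunct2, THEN conjunct2, THEN conjunct2, THEN conjunct2, THEN conjunct2, THEN conjunct1]
lemmas ax_separation = ZFC[unfolded ZFC_def, THEN conjunct2, THEN conjunct2, THEN conjunct2, THEN conjunct2, THEN conjunct2, THEN conjunct2, THEN conjunct1]
lemmas ax_replacement = ZFC[unfolded ZFC_def, THEN conjunct2, THEN conjunct2, THEN conjunct2, THEN conjunct2, THEN conjunct2, THEN conjunct2, THEN conjunct2, THEN conjunct1]
lemmas ax_choice = ZFC[unfolded ZFC_def, THEN conjunct2, THEN conjunct2, THEN conjunct2, THEN conjunct2, THEN conjunct2, THEN conjunct2, THEN conjunct2, THEN conjunct2]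

lemma mem_ext [simp]: "x \<in> ext y \<longleftrightarrow> x \<epsilon> y"
  by (simp add: ext_def)

lemma ext_eqI: "(\<And>z. z \<epsilon> x \<longleftrightarrow> z \<epsilon> y) \<Longrightarrow> x = y"
  using ax_extensionality unfolding ext_def by simp

lemma ext_inject [simp]: "ext x = ext y \<longleftrightarrow> x = y"
  using ax_extensionality by blast

text \<open>\<open>setof\<close> is a definite description and says nothing about proper classes, so
  set existence is carried by \<open>isset\<close>, in a form that the simplifier can
  discharge.\<close>

definition isset :: "'v set \<Rightarrow> bool" where
  "isset S \<longleftrightarrow> (\<exists>x. ext x = S)"

definition setof :: "'v set \<Rightarrow> 'v" where
  "setof S = (THE x. ext x = S)"

lemma ext_setof [simp]: "isset S \<Longrightarrow> ext (setof S) = S"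
  unfolding isset_def setof_def by (rule theI') (metis ext_inject)

lemma mem_setof [simp]: "isset S \<Longrightarrow> x \<epsilon> setof S \<longleftrightarrow> x \<in> S"
  using ext_setof[of S] mem_ext by blast

lemma isset_ext [simp]: "isset (ext x)" by (auto simp: isset_def)

lemma setof_ext [simp]: "setof (ext x) = x"
  using ext_setof[OF isset_ext, of x] by (simp del: ext_setof)

lemma isset_pair [simp]: "isset {x, y}"
  using ax_pairing unfolding isset_def by blast

lemma isset_single [simp]: "isset {x}" using isset_pair[of x x] by simp

lemma isset_Union [simp]: "isset (\<Union>y\<in>ext x. ext y)"
  using ax_union unfolding isset_def by blast

lemma isset_Pow [simp]: "isset {y. ext y \<subseteq> ext x}"
  using ax_power unfolding isset_def by blast

lemma isset_empty [simp]: "isset {}"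
  using ax_infinity unfolding isset_def by blast

definition "zero = setof {}"

lemma ext_zero [simp]: "ext zero = {}" by (simp add: zero_def)
lemma mem_zero [simp]: "\<not> x \<epsilon> zero" using ext_zero mem_ext by blast

lemma isset_Un [simp]: "isset S \<Longrightarrow> isset T \<Longrightarrow> isset (S \<union> T)"
proof -
  assume a: "isset S" "isset T"
  have "S \<union> T = (\<Union>y\<in>ext (setof {setof S, setof T}). ext y)"
    using a by simp
  then show ?thesis using isset_Union by metis
qed

lemma isset_insert [simp]: "isset S \<Longrightarrow> isset (insert x S)"
  using isset_Un[of "{x}" S] by simp

lemma raw_foundation: "ext x \<noteq> {} \<Longrightarrow> \<exists>y\<in>ext x. ext y \<inter> ext x = {}"
  using ax_foundation by blast

lemma raw_separation: "\<exists>y. ext y = {z \<in> ext x. sat E (e(0 := z)) p}"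
  using ax_separation by blast

lemma raw_replacement:
  "\<forall>z\<in>ext x. \<exists>!w. sat E (e(0 := z, 1 := w)) p \<Longrightarrow>
    \<exists>y. ext y = {w. \<exists>z\<in>ext x. sat E (e(0 := z, 1 := w)) p}"
  using ax_replacement by blast

lemma raw_choice:
  assumes "\<And>y. y \<epsilon> x \<Longrightarrow> ext y \<noteq> {}"
    and "\<And>y z. y \<epsilon> x \<Longrightarrow> z \<epsilon> x \<Longrightarrow> y \<noteq> z \<Longrightarrow> ext y \<inter> ext z = {}"
  shows "\<exists>c. \<forall>y\<in>ext x. \<exists>!z. z \<in> ext c \<inter> ext y"
proof -
  have "\<forall>x. (\<forall>y\<in>ext x. ext y \<noteq> {}) \<and>
         (\<forall>y\<in>ext x. \<forall>z\<in>ext x. y \<noteq> z \<longrightarrow> ext y \<inter> ext z = {}) \<longrightarrow>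
       (\<exists>c. \<forall>y\<in>ext x. \<exists>!z. z \<in> ext c \<inter> ext y)"
    using ax_choice .
  moreover have "(\<forall>y\<in>ext x. ext y \<noteq> {}) \<and>
         (\<forall>y\<in>ext x. \<forall>z\<in>ext x. y \<noteq> z \<longrightarrow> ext y \<inter> ext z = {})"
    using assms by simp
  ultimately show ?thesis by blast
qed

section \<open>Good classes and the calculus of definable predicates and operations\<close>

lemma natural_zero [simp]: "natural zero"
  by (simp add: Defs.natural_def Defs.ordinal_def Defs.transitive_def)

text \<open>Transitivity makes bounded quantifiers absolute. The natural numbers are demanded so
  that quantifying over them is absolute as well, and so that the parameter \<open>zero\<close> is
  available.\<close>

definition good :: "'v set \<Rightarrow> bool" where
  "good A \<longleftrightarrow> (\<forall>x\<in>A. ext x \<subseteq> A) \<and> {n. natural n} \<subseteq> A"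

lemma good_UNIV [simp]: "good UNIV" by (simp add: good_def)

lemma good_mem: "good A \<Longrightarrow> x \<in> A \<Longrightarrow> y \<epsilon> x \<Longrightarrow> y \<in> A"
  unfolding good_def by fastforce

lemma good_natural: "good A \<Longrightarrow> natural n \<Longrightarrow> n \<in> A"
  unfolding good_def by fastforce

text \<open>\<open>df G P\<close>: one formula, relativized to \<open>A\<close>, defines \<open>P A\<close> for all good \<open>A \<in> G\<close>; the environment
  occupies the even variables and the parameters the odd ones. Parameters other than \<open>zero\<close> are
  allowed only for \<open>G = {UNIV}\<close> (definability over the universe), so that \<open>df UNIV\<close> transfers to
  ultrapowers. \<open>tm\<close> is the analogue for definable operations. Quantifiers bind \<open>e 0\<close> and shift the
  rest, which makes the closure properties usable as introduction rules.\<close>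

definition df :: "'v set set \<Rightarrow> ('v set \<Rightarrow> (nat \<Rightarrow> 'v) \<Rightarrow> bool) \<Rightarrow> bool" where
  "df G P \<longleftrightarrow> (\<exists>p e0. (G = {UNIV} \<or> range e0 \<subseteq> {zero}) \<and>
     (\<forall>A\<in>G. good A \<longrightarrow> (\<forall>e. range e \<subseteq> A \<longrightarrow> P A e = satR E A (merge e e0) p)))"

definition tm :: "'v set set \<Rightarrow> ('v set \<Rightarrow> (nat \<Rightarrow> 'v) \<Rightarrow> 'v) \<Rightarrow> bool" where
  "tm G t \<longleftrightarrow> (\<forall>A\<in>G. good A \<longrightarrow> (\<forall>e. range e \<subseteq> A \<longrightarrow> t A e \<in> A)) \<and>
     df G (\<lambda>A e. e 0 = t A (\<lambda>n. e (Suc n)))"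

lemma dfI:
  assumes "\<And>A e. A \<in> G \<Longrightarrow> good A \<Longrightarrow> range e \<subseteq> A \<Longrightarrow> P A e = satR E A (\<lambda>i. merge e c (\<sigma> i)) p"
    and "G = {UNIV} \<or> range c \<subseteq> {zero}"
  shows "df G P"
proof -
  obtain q where "\<forall>A e. satR E A e q = satR E A (\<lambda>i. e (\<sigma> i)) p" using satR_rename by blast
  then show ?thesis unfolding df_def using assms by (intro exI[of _ q] exI[of _ c]) auto
qed

lemma dfE:
  assumes "df G P"
  obtains p e0 where "\<And>A e. A \<in> G \<Longrightarrow> good A \<Longrightarrow> range e \<subseteq> A \<Longrightarrow> P A e = satR E A (merge e e0) p"
    and "G = {UNIV} \<or> range e0 \<subseteq> {zero}"
proof -
  from assms obtain p e0 where 1: "G = {UNIV} \<or> range e0 \<subseteq> {zero}"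
    and 2: "\<forall>A\<in>G. good A \<longrightarrow> (\<forall>e. range e \<subseteq> A \<longrightarrow> P A e = satR E A (merge e e0) p)"
    unfolding df_def by (elim exE conjE) (rule that)
  show ?thesis by (rule that[OF _ 1]) (rule 2[rule_format])
qed

lemma df_cong:
  assumes "df G P" and "\<And>A e. A \<in> G \<Longrightarrow> good A \<Longrightarrow> range e \<subseteq> A \<Longrightarrow> Q A e = P A e"
  shows "df G Q"
proof (rule dfE[OF assms(1)])
  fix p e0
  assume 1: "\<And>A e. A \<in> G \<Longrightarrow> good A \<Longrightarrow> range e \<subseteq> A \<Longrightarrow> P A e = satR E A (merge e e0) p"
    "G = {UNIV} \<or> range e0 \<subseteq> {zero}"
  show ?thesis by (rule dfI[OF _ 1(2), where p = p and \<sigma> = "\<lambda>i. i"]) (simp add: 1(1) assms(2))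
qed

lemma df_atom:
  shows df_mem0: "df G (\<lambda>A e. e i \<epsilon> e j)"
    and df_eq0: "df G (\<lambda>A e. e i = e j)"
  by (rule dfI[where p = "Mem (2 * i) (2 * j)" and \<sigma> = "\<lambda>i. i" and c = "\<lambda>_. zero"]; auto intro: good_natural)
     (rule dfI[where p = "Equal (2 * i) (2 * j)" and \<sigma> = "\<lambda>i. i" and c = "\<lambda>_. zero"]; auto intro: good_natural)

lemma df_not:
  assumes "df G P" shows "df G (\<lambda>A e. \<not> P A e)"
proof (rule dfE[OF assms])
  fix p e0
  assume 1: "\<And>A e. A \<in> G \<Longrightarrow> good A \<Longrightarrow> range e \<subseteq> A \<Longrightarrow> P A e = satR E A (merge e e0) p"
    "G = {UNIV} \<or> range e0 \<subseteq> {zero}"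
  show ?thesis by (rule dfI[OF _ 1(2), where p = "Neg p" and \<sigma> = "\<lambda>i. i"]) (simp_all add: 1(1))
qed

lemma df_and:
  assumes "df G P" "df G Q" shows "df G (\<lambda>A e. P A e \<and> Q A e)"
proof -
  obtain p e0 where 1: "\<And>A e. A \<in> G \<Longrightarrow> good A \<Longrightarrow> range e \<subseteq> A \<Longrightarrow> P A e = satR E A (merge e e0) p"
    "G = {UNIV} \<or> range e0 \<subseteq> {zero}" by (rule dfE[OF assms(1)]) (rule that)
  obtain q e1 where 2: "\<And>A e. A \<in> G \<Longrightarrow> good A \<Longrightarrow> range e \<subseteq> A \<Longrightarrow> Q A e = satR E A (merge e e1) q"
    "G = {UNIV} \<or> range e1 \<subseteq> {zero}" by (rule dfE[OF assms(2)]) (rule that)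
  \<comment> \<open>The two parameter lists are interleaved as \<open>merge e0 e1\<close>. The odd
    variable \<open>2k + 1\<close> held parameter number \<open>k\<close>, which now sits at
    position \<open>2k + d\<close> of the merged list, with \<open>d = 0\<close> for
    \<open>e0\<close> and \<open>d = 1\<close> for \<open>e1\<close>.\<close>
  define \<sigma> where "\<sigma> d n = (if even n then n else Suc (2 * (2 * (n div 2) + d)))" for d n :: nat
  have "merge e e0 i = merge e (merge e0 e1) (\<sigma> 0 i) \<and> merge e e1 i = merge e (merge e0 e1) (\<sigma> 1 i)"
    for e i
    by (cases "even i") (auto simp: \<sigma>_def elim!: evenE oddE)
  then have m: "merge e e0 = (\<lambda>i. merge e (merge e0 e1) (\<sigma> 0 i))"
    "merge e e1 = (\<lambda>i. merge e (merge e0 e1) (\<sigma> 1 i))" for e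
    by (auto simp: fun_eq_iff)
  obtain p' where p': "\<And>A e. satR E A e p' = satR E A (\<lambda>i. e (\<sigma> 0 i)) p"
    using satR_rename[where E = E and \<sigma> = "\<sigma> 0" and p = p] by blast
  obtain q' where q': "\<And>A e. satR E A e q' = satR E A (\<lambda>i. e (\<sigma> 1 i)) q"
    using satR_rename[where E = E and \<sigma> = "\<sigma> 1" and p = q] by blast
  show ?thesis
  proof (rule dfI[where p = "Conj p' q'" and c = "merge e0 e1" and \<sigma> = "\<lambda>i. i"])
    show "G = {UNIV} \<or> range (merge e0 e1) \<subseteq> {zero}"
      using 1(2) 2(2) by (auto simp: merge_def)
  next
    fix A and e :: "nat \<Rightarrow> 'v" assume a: "A \<in> G" "good A" "range e \<subseteq> A"
    have "P A e = satR E A (merge e (merge e0 e1)) p'"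
      unfolding p' m(1)[symmetric] by (rule 1(1)[OF a])
    moreover have "Q A e = satR E A (merge e (merge e0 e1)) q'"
      unfolding q' m(2)[symmetric] by (rule 2(1)[OF a])
    ultimately show "(P A e \<and> Q A e) = satR E A (\<lambda>i. merge e (merge e0 e1) i) (Conj p' q')"
      by simp
  qed
qed

lemma df_ren: "df G P \<Longrightarrow> df G (\<lambda>A e. P A (\<lambda>i. e (\<sigma> i)))"
proof (erule dfE)
  fix p e0
  assume 1: "\<And>A e. A \<in> G \<Longrightarrow> good A \<Longrightarrow> range e \<subseteq> A \<Longrightarrow> P A e = satR E A (merge e e0) p"
    "G = {UNIV} \<or> range e0 \<subseteq> {zero}"
  have m: "merge (\<lambda>i. e (\<sigma> i)) e0 = (\<lambda>n. merge e e0 (if even n then 2 * \<sigma> (n div 2) else n))" for e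
    by (auto simp: merge_def)
  show ?thesis
  proof (rule dfI[OF _ 1(2)])
    fix A and e :: "nat \<Rightarrow> 'v" assume a: "A \<in> G" "good A" "range e \<subseteq> A"
    then have "range (\<lambda>i. e (\<sigma> i)) \<subseteq> A" by auto
    with a show "P A (\<lambda>i. e (\<sigma> i)) = satR E A (\<lambda>n. merge e e0 (if even n then 2 * \<sigma> (n div 2) else n)) p"
      by (simp add: 1 m)
  qed
qed

definition scons :: "'v \<Rightarrow> (nat \<Rightarrow> 'v) \<Rightarrow> nat \<Rightarrow> 'v" where
  "scons x e n = (case n of 0 \<Rightarrow> x | Suc m \<Rightarrow> e m)"

lemma scons_simps [simp]: "scons x e 0 = x" "scons x e (Suc n) = e n"
  "(\<lambda>n. scons x e (Suc n)) = e"
  by (auto simp: scons_def)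

lemma range_scons: "x \<in> A \<Longrightarrow> range e \<subseteq> A \<Longrightarrow> range (scons x e) \<subseteq> A"
  unfolding scons_def by (fastforce split: nat.splits)

lemma df_Bex_class:
  assumes "df G (\<lambda>A e. P A (e 0) (\<lambda>n. e (Suc n)))"
  shows "df G (\<lambda>A e. \<exists>x\<in>A. P A x e)"
proof (rule dfE[OF assms])
  fix p e0
  assume 1: "\<And>A e. A \<in> G \<Longrightarrow> good A \<Longrightarrow> range e \<subseteq> A \<Longrightarrow>
      P A (e 0) (\<lambda>n. e (Suc n)) = satR E A (merge e e0) p"
    "G = {UNIV} \<or> range e0 \<subseteq> {zero}"
  \<comment> \<open>This position is even and beyond all variables of \<open>p\<close>. Variable 0
    of \<open>p\<close> is read from it, the other even variables move down by 2 to undo the shift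
    by \<open>scons\<close>, and the odd ones, which hold the parameters, stay.\<close>
  define k where "k = 2 * var_bound p"
  define \<sigma> where "\<sigma> n = (if n = 0 then k else if even n then n - 2 else n)" for n
  obtain q where q: "\<And>A e. satR E A e q = satR E A (\<lambda>i. e (\<sigma> i)) p"
    using satR_rename[where E = E and \<sigma> = \<sigma> and p = p] by blast
  have m: "satR E A (merge (scons x e) e0) p = satR E A ((merge e e0)(k := x)) q" for A e x
    unfolding q
    by (rule satR_cong) (auto simp: \<sigma>_def k_def merge_def scons_def split: nat.splits)
  show ?thesis
  proof (rule dfI[OF _ 1(2), where p = "Ex k q" and \<sigma> = "\<lambda>i. i"])
    fix A and e :: "nat \<Rightarrow> 'v" assume a: "A \<in> G" "good A" "range e \<subseteq> A"
    have "P A x e = satR E A ((merge e e0)(k := x)) q" if "x \<in> A" for x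
    proof -
      have "range (scons x e) \<subseteq> A" using a that by (simp add: range_scons)
      from 1(1)[OF a(1,2) this] show ?thesis by (simp add: m)
    qed
    then show "(\<exists>x\<in>A. P A x e) = satR E A (\<lambda>i. merge e e0 i) (Ex k q)" by simp
  qed
qed

lemma df_ex:
  assumes "df G (\<lambda>A e. P A (e 0) (\<lambda>n. e (Suc n)))"
    and "\<And>A e x. A \<in> G \<Longrightarrow> good A \<Longrightarrow> range e \<subseteq> A \<Longrightarrow> P A x e \<Longrightarrow> x \<in> A"
  shows "df G (\<lambda>A e. \<exists>x. P A x e)"
  by (rule df_cong[OF df_Bex_class[OF assms(1)]]) (use assms(2) in blast)

text \<open>Substitution is a quantifier: a value in \<open>A\<close> is pinned down by the graph of
  \<open>t\<close>. The closure condition in \<open>tm\<close> supplies the witness.\<close>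

lemma df_sub:
  assumes "df G (\<lambda>A e. R A (e 0) (\<lambda>n. e (Suc n)))" "tm G t"
  shows "df G (\<lambda>A e. R A (t A e) e)"
proof -
  have "df G (\<lambda>A e. \<exists>x\<in>A. x = t A e \<and> R A x e)"
    using assms by (intro df_Bex_class df_and) (auto simp: tm_def)
  then show ?thesis
    by (rule df_cong) (use assms(2) in \<open>auto simp: tm_def\<close>)
qed

lemma tm_ren: "tm G t \<Longrightarrow> tm G (\<lambda>A e. t A (\<lambda>i. e (\<sigma> i)))"
proof -
  assume a: "tm G t"
  then have "df G (\<lambda>A e. e 0 = t A (\<lambda>n. e (Suc n)))" by (simp add: tm_def)
  from df_ren[OF this, of "\<lambda>n. case n of 0 \<Rightarrow> 0 | Suc m \<Rightarrow> Suc (\<sigma> m)"]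
  have "df G (\<lambda>A e. e 0 = t A (\<lambda>n. e (Suc (\<sigma> n))))" by simp
  moreover have "t A (\<lambda>i. e (\<sigma> i)) \<in> A" if "A \<in> G" "good A" "range e \<subseteq> A" for A e
  proof -
    have "range (\<lambda>i. e (\<sigma> i)) \<subseteq> A" using that by auto
    then show ?thesis using a that unfolding tm_def by blast
  qed
  ultimately show ?thesis by (auto simp: tm_def)
qed

lemma tm_var: "tm G (\<lambda>A e. e i)"
  unfolding tm_def using df_eq0[of G 0 "Suc i"] by auto

lemma tm_const:
  assumes "G = {UNIV} \<or> a = zero" shows "tm G (\<lambda>A e. a)"
proof -
  have "df G (\<lambda>A e. e 0 = a)"
    by (rule dfI[where p = "Equal 0 1" and c = "\<lambda>_. a" and \<sigma> = "\<lambda>i. i"])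
       (use assms in \<open>auto simp: merge_def\<close>)
  moreover have "a \<in> A" if "A \<in> G" "good A" for A
    using assms that good_natural[OF that(2) natural_zero] by auto
  ultimately show ?thesis by (auto simp: tm_def)
qed

lemma df1: "df G (\<lambda>A e. R A (e 0)) \<Longrightarrow> tm G t \<Longrightarrow> df G (\<lambda>A e. R A (t A e))"
  by (rule df_sub[where R = "\<lambda>A x e. R A x"])

lemma df2:
  assumes "df G (\<lambda>A e. R A (e 0) (e 1))" "tm G t" "tm G u"
  shows "df G (\<lambda>A e. R A (t A e) (u A e))"
proof (rule df_sub[where R = "\<lambda>A x e. R A x (u A e)", OF _ assms(2)])
  have "df G (\<lambda>A e. R A (e 1) (e 0))"
    using df_ren[OF assms(1), of "\<lambda>i. 1 - i"] by simp
  then show "df G (\<lambda>A e. R A (e 0) (u A (\<lambda>n. e (Suc n))))"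
    by (intro df_sub[where R = "\<lambda>A x e. R A (e 0) x"] tm_ren[OF assms(3)]) simp
qed

lemma df3:
  assumes "df G (\<lambda>A e. R A (e 0) (e 1) (e 2))" "tm G t" "tm G u" "tm G v"
  shows "df G (\<lambda>A e. R A (t A e) (u A e) (v A e))"
proof (rule df_sub[where R = "\<lambda>A x e. R A x (u A e) (v A e)", OF _ assms(2)])
  have 1: "df G (\<lambda>A e. R A (e 2) (e 1) (e 0))"
    using df_ren[OF assms(1), of "\<lambda>i. 2 - i"] by (simp add: numeral_2_eq_2)
  have 2: "df G (\<lambda>A e. R A (e 1) (e 0) (v A (\<lambda>n. e (Suc (Suc n)))))"
    by (rule df_sub[where R = "\<lambda>A x e. R A (e 1) (e 0) x"])
       (use 1 tm_ren[OF assms(4), of "\<lambda>i. Suc (Suc i)"] in \<open>auto simp: numeral_2_eq_2\<close>)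
  show "df G (\<lambda>A e. R A (e 0) (u A (\<lambda>n. e (Suc n))) (v A (\<lambda>n. e (Suc n))))"
    by (rule df_sub[where R = "\<lambda>A x e. R A (e 0) x (v A (\<lambda>n. e (Suc n)))"])
       (use 2 tm_ren[OF assms(3)] in auto)
qed

lemma df_mem: "tm G t \<Longrightarrow> tm G u \<Longrightarrow> df G (\<lambda>A e. t A e \<epsilon> u A e)"
  by (rule df2[where R = "\<lambda>A. (\<epsilon>)"]) (rule df_mem0)

lemma df_ext: "df G (\<lambda>A e. t A e \<epsilon> u A e) \<Longrightarrow> df G (\<lambda>A e. t A e \<in> ext (u A e))"
  by simp

lemma df_eq: "tm G t \<Longrightarrow> tm G u \<Longrightarrow> df G (\<lambda>A e. t A e = u A e)"
  by (rule df2[where R = "\<lambda>A. (=)"]) (rule df_eq0)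

lemma df_or: "df G P \<Longrightarrow> df G Q \<Longrightarrow> df G (\<lambda>A e. P A e \<or> Q A e)"
  by (rule df_cong[OF df_not[OF df_and[OF df_not df_not]]]) auto

lemma df_imp: "df G P \<Longrightarrow> df G Q \<Longrightarrow> df G (\<lambda>A e. P A e \<longrightarrow> Q A e)"
  by (rule df_cong[OF df_or[OF df_not]]) auto

lemma df_iff:
  assumes "df G P" "df G Q" shows "df G (\<lambda>A e. P A e \<longleftrightarrow> Q A e)"
  by (rule df_cong[OF df_and[OF df_imp[OF assms] df_imp[OF assms(2,1)]]]) auto

lemma df_Ball_class:
  assumes "df G (\<lambda>A e. P A (e 0) (\<lambda>n. e (Suc n)))"
  shows "df G (\<lambda>A e. \<forall>x\<in>A. P A x e)"
  using df_not[OF df_Bex_class[where P = "\<lambda>A x e. \<not> P A x e", OF df_not[OF assms]]] by simp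

lemma df_Bex:
  assumes "tm G t" "df G (\<lambda>A e. P A (e 0) (\<lambda>n. e (Suc n)))"
  shows "df G (\<lambda>A e. \<exists>x\<in>ext (t A e). P A x e)"
proof -
  have "df G (\<lambda>A e. \<exists>x\<in>A. x \<epsilon> t A e \<and> P A x e)"
    by (intro df_Bex_class df_and df_mem tm_var tm_ren[OF assms(1)] assms(2))
  then show ?thesis
  proof (rule df_cong)
    fix A and e :: "nat \<Rightarrow> 'v" assume "A \<in> G" "good A" "range e \<subseteq> A"
    then have "t A e \<in> A" using assms(1) by (simp add: tm_def)
    then have "x \<epsilon> t A e \<Longrightarrow> x \<in> A" for x using good_mem[OF \<open>good A\<close>] by blast
    then show "(\<exists>x\<in>ext (t A e). P A x e) = (\<exists>x\<in>A. x \<epsilon> t A e \<and> P A x e)"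
      unfolding Bex_def mem_ext by blast
  qed
qed

lemma df_Ball:
  assumes "tm G t" "df G (\<lambda>A e. P A (e 0) (\<lambda>n. e (Suc n)))"
  shows "df G (\<lambda>A e. \<forall>x\<in>ext (t A e). P A x e)"
  using df_not[OF df_Bex[where P = "\<lambda>A x e. \<not> P A x e", OF assms(1) df_not[OF assms(2)]]] by simp

lemma df_exU:
  assumes "df {UNIV} (\<lambda>A e. P A (e 0) (\<lambda>n. e (Suc n)))"
  shows "df {UNIV} (\<lambda>A e. \<exists>x. P A x e)"
  by (rule df_ex[OF assms]) auto

lemma df_allU:
  assumes "df {UNIV} (\<lambda>A e. P A (e 0) (\<lambda>n. e (Suc n)))"
  shows "df {UNIV} (\<lambda>A e. \<forall>x. P A x e)"
  using df_not[OF df_exU[where P = "\<lambda>A x e. \<not> P A x e", OF df_not[OF assms]]] by simp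

lemma tm_constU: "tm {UNIV} (\<lambda>A e. a)" by (rule tm_const) auto

lemma tm_zero: "tm G (\<lambda>A e. zero)" by (rule tm_const) simp

lemma df_const: "df G (\<lambda>A e. b)"
proof -
  have "df G (\<lambda>A e. e 0 = e 0)" by (rule df_eq0)
  then have "df G (\<lambda>A e. True)" by simp
  with df_not[OF this] show ?thesis by (cases b) auto
qed

lemma df_subset: 
  assumes "tm G t" "tm G u" shows "df G (\<lambda>A e. ext (t A e) \<subseteq> ext (u A e))"
proof -
  have "df G (\<lambda>A e. \<forall>z\<in>ext (t A e). z \<epsilon> u A e)"
    by (intro df_Ball df_mem tm_var tm_ren[OF assms(2)] assms(1))
  then show ?thesis by (simp add: subset_iff Ball_def)
qed

lemma df_definable:
  assumes "definable E R" shows "df {UNIV} (\<lambda>A e. R (e 0) (e 1))"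
proof -
  obtain p e0 where p: "\<And>x y. R x y \<longleftrightarrow> sat E (e0(0 := x, 1 := y)) p"
    using assms unfolding definable_def by blast
  define \<sigma> :: "nat \<Rightarrow> nat" where "\<sigma> n = (if n = 0 then 0 else if n = 1 then 2 else Suc (2 * n))" for n
  have m: "e0(0 := e 0, 1 := e 1) = (\<lambda>i. merge e e0 (\<sigma> i))" for e
    by (auto simp: \<sigma>_def merge_def fun_eq_iff)
  show ?thesis
    by (rule dfI[where \<sigma> = \<sigma> and c = e0 and p = p]) (auto simp: p m[symmetric] satR_UNIV)
qed

lemma isset_sep:
  assumes "df {UNIV} (\<lambda>A e. P (e 0))" shows "isset {z \<in> ext x. P z}"
proof (rule dfE[OF assms])
  fix p e0
  assume "\<And>A e. A \<in> {UNIV} \<Longrightarrow> good A \<Longrightarrow> range e \<subseteq> A \<Longrightarrow> P (e 0) = satR E A (merge e e0) p"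
  then have 1: "P (e 0) = satR E UNIV (merge e e0) p" for e by simp
  \<comment> \<open>The axiom reserves only variable 0 for \<open>z\<close>; the others hold
    parameters. As \<open>P\<close> looks at \<open>e 0\<close> alone, the environment may be taken
    constant with value \<open>z\<close>, so all even variables collapse to 0.\<close>
  obtain q where q: "\<And>A e. satR E A e q = satR E A (\<lambda>i. e (if even i then 0 else Suc (i div 2))) p"
    using satR_rename[where E = E and \<sigma> = "\<lambda>i. if even i then 0 else Suc (i div 2)" and p = p] by blast
  have m: "(scons undefined e0)(0 := z) = scons z e0" for z
    by (auto simp: scons_def fun_eq_iff split: nat.splits)
  have "P z = sat E ((scons undefined e0)(0 := z)) q" for z
  proof -
    have "merge (\<lambda>_. z) e0 = (\<lambda>i. scons z e0 (if even i then 0 else Suc (i div 2)))"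
      by (auto simp: merge_def fun_eq_iff)
    then show ?thesis unfolding satR_UNIV[symmetric] q m using 1[of "\<lambda>_. z"] by simp
  qed
  then show ?thesis using raw_separation[of x "scons undefined e0" q] unfolding isset_def by simp
qed

lemma isset_rep:
  assumes "df {UNIV} (\<lambda>A e. R (e 0) (e 1))" "\<And>z. z \<epsilon> x \<Longrightarrow> \<exists>!w. R z w"
  shows "isset {w. \<exists>z\<in>ext x. R z w}"
proof (rule dfE[OF assms(1)])
  fix p e0
  assume "\<And>A e. A \<in> {UNIV} \<Longrightarrow> good A \<Longrightarrow> range e \<subseteq> A \<Longrightarrow> R (e 0) (e 1) = satR E A (merge e e0) p"
  then have 1: "R (e 0) (e 1) = satR E UNIV (merge e e0) p" for e by simp
  \<comment> \<open>The environment that is \<open>z\<close> at 0 and \<open>w\<close> everywhere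
    else is used, so every even variable other than 0 collapses to variable 1.\<close>
  define \<sigma> where "\<sigma> i = (if i = 0 then 0 else if even i then 1 else Suc (Suc (i div 2)))" for i :: nat
  obtain q where q: "\<And>A e. satR E A e q = satR E A (\<lambda>i. e (\<sigma> i)) p"
    using satR_rename[where E = E and \<sigma> = \<sigma> and p = p] by blast
  define e1 where "e1 = scons undefined (scons undefined e0)"
  have "(\<lambda>i. (e1(0 := z, 1 := w)) (\<sigma> i)) = merge (\<lambda>i. if i = 0 then z else w) e0" for z w
    by (auto simp: \<sigma>_def merge_def e1_def fun_eq_iff)
  then have 2: "R z w = sat E (e1(0 := z, 1 := w)) q" for z w
    unfolding satR_UNIV[symmetric] q using 1[of "\<lambda>i. if i = 0 then z else w"] by simp
  show ?thesis using raw_replacement[of x e1 q] assms(2) unfolding isset_def 2 by simp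
qed

lemma isset_image:
  assumes "tm {UNIV} (\<lambda>A e. F (e 0))" shows "isset (F ` ext x)"
proof -
  have "df {UNIV} (\<lambda>A e. e 1 = F (e 0))"
    by (rule df_eq[OF tm_var assms])
  then have "isset {w. \<exists>z\<in>ext x. w = F z}" by (rule isset_rep) auto
  then show ?thesis by (simp add: image_def)
qed

lemma tm_setof:
  assumes "\<And>e. isset (S e)" "df {UNIV} (\<lambda>A e. e 0 \<in> S (\<lambda>n. e (Suc n)))"
  shows "tm {UNIV} (\<lambda>A e. setof (S e))"
proof -
  have "df {UNIV} (\<lambda>A e. \<forall>z. z \<epsilon> e 0 \<longleftrightarrow> z \<in> S (\<lambda>n. e (Suc n)))"
  proof (rule df_allU, rule df_iff)
    show "df {UNIV} (\<lambda>A e. e 0 \<in> S (\<lambda>n. e (Suc (Suc n))))"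
      using df_ren[OF assms(2), of "\<lambda>i. if i = 0 then 0 else Suc i"] by simp
  qed (rule df_mem0)
  moreover have "e 0 = setof (S (\<lambda>n. e (Suc n))) \<longleftrightarrow> (\<forall>z. z \<epsilon> e 0 \<longleftrightarrow> z \<in> S (\<lambda>n. e (Suc n)))" for e
    using assms(1) by (auto intro: ext_eqI)
  ultimately show ?thesis by (simp add: tm_def)
qed

lemmas df_intros = df_not df_and df_or df_imp df_iff df_mem df_eq df_ext df_const
  df_Bex_class df_Ball_class df_Bex df_Ball df_subset tm_var tm_zero tm_constU

section \<open>Elementary set theory in the model\<close>

lemmas dfU_intros = df_intros df_exU df_allU

lemma minimal_elem:
  assumes "df {UNIV} (\<lambda>A e. P (e 0))" "z \<epsilon> x" "P z"
  obtains y where "y \<epsilon> x" "P y" "\<And>w. w \<epsilon> y \<Longrightarrow> w \<epsilon> x \<Longrightarrow> \<not> P w"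
proof -
  have s: "isset {z \<in> ext x. P z}" by (rule isset_sep[OF assms(1)])
  then have "ext (setof {z \<in> ext x. P z}) \<noteq> {}" using assms(2,3) by auto
  from raw_foundation[OF this] show ?thesis using s that by (auto simp: disjoint_iff)
qed

lemma no_cycle2: "x \<epsilon> y \<Longrightarrow> \<not> y \<epsilon> x"
proof
  assume a: "x \<epsilon> y" "y \<epsilon> x"
  have "ext (setof {x, y}) \<noteq> {}" by simp
  from raw_foundation[OF this] show False using a by (auto simp del: ext_setof) auto
qed

lemma no_self [simp]: "\<not> x \<epsilon> x" using no_cycle2 by blast

definition "suc n = setof (insert n (ext n))"

lemma ext_suc [simp]: "ext (suc n) = insert n (ext n)" by (simp add: suc_def)

lemma mem_suc [simp]: "x \<epsilon> suc n \<longleftrightarrow> x = n \<or> x \<epsilon> n"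
  using ext_suc[of n] mem_ext[of x "suc n"] by simp

lemma is_succ_iff [simp]: "is_succ m n \<longleftrightarrow> m = suc n"
  unfolding Defs.is_succ_def by (metis ext_inject ext_suc)

lemma suc_inject [simp]: "suc m = suc n \<longleftrightarrow> m = n"
  using no_cycle2 mem_suc by metis

lemma suc_neq_zero [simp]: "suc n \<noteq> zero" "zero \<noteq> suc n"
  using mem_suc[of n n] mem_zero[of n] by metis+

lemma df_transitive0: "df G (\<lambda>A e. transitive (e 0))"
  unfolding Defs.transitive_def by (intro df_intros)

lemmas df_transitive = df1[where R = "\<lambda>A. transitive", OF df_transitive0]

lemma df_ordinal0: "df G (\<lambda>A e. ordinal (e 0))"
  unfolding Defs.ordinal_def by (intro df_intros df_transitive)

lemmas df_ordinal = df1[where R = "\<lambda>A. ordinal", OF df_ordinal0]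

lemma df_is_succ0: "df G (\<lambda>A e. is_succ (e 0) (e 1))"
proof -
  have eq: "is_succ m n \<longleftrightarrow> n \<epsilon> m \<and> (\<forall>x\<in>ext m. x = n \<or> x \<epsilon> n) \<and> (\<forall>x\<in>ext n. x \<epsilon> m)" for m n
    unfolding Defs.is_succ_def by auto
  show ?thesis unfolding eq by (intro df_intros)
qed

lemmas df_is_succ = df2[where R = "\<lambda>A. is_succ", OF df_is_succ0]

lemma df_natural0: "df G (\<lambda>A e. natural (e 0))"
proof -
  \<comment> \<open>A predecessor of \<open>m\<close> is an element of \<open>m\<close>. Bounding
    the quantifier over \<open>k\<close> in this way makes the formula mean the same in every good
    class.\<close>
  have eq: "natural n \<longleftrightarrow> ordinal n \<and> (n = zero \<or> (\<exists>k\<in>ext n. is_succ n k)) \<and>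
      (\<forall>m\<in>ext n. m = zero \<or> (\<exists>k\<in>ext m. is_succ m k))" for n
  proof -
    have *: "ext m = {} \<or> (\<exists>k. is_succ m k) \<longleftrightarrow> m = zero \<or> (\<exists>k\<in>ext m. is_succ m k)" for m
    proof -
      have "ext m = {} \<longleftrightarrow> m = zero" using ext_inject[of m zero] by (simp del: ext_inject)
      then show ?thesis by (auto simp del: ext_inject)
    qed
    show ?thesis unfolding Defs.natural_def * Ball_def mem_ext by blast
  qed
  show ?thesis unfolding eq by (intro df_intros df_ordinal df_is_succ)
qed

lemmas df_natural = df1[where R = "\<lambda>A. natural", OF df_natural0]

lemma transitiveD: "transitive x \<Longrightarrow> y \<epsilon> x \<Longrightarrow> z \<epsilon> y \<Longrightarrow> z \<epsilon> x"
  unfolding Defs.transitive_def by (auto simp: subset_iff)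

lemma ordinal_trans: "ordinal x \<Longrightarrow> y \<epsilon> x \<Longrightarrow> z \<epsilon> y \<Longrightarrow> z \<epsilon> x"
  unfolding Defs.ordinal_def using transitiveD by blast

lemma ordinal_mem: "ordinal x \<Longrightarrow> y \<epsilon> x \<Longrightarrow> ordinal y"
  unfolding Defs.ordinal_def by (meson mem_ext transitiveD)

lemma ordinal_least:
  assumes "df {UNIV} (\<lambda>A e. P (e 0))" "ordinal a" "P a"
  obtains b where "ordinal b" "P b" "\<And>c. c \<epsilon> b \<Longrightarrow> \<not> P c"
proof (cases "\<exists>c. c \<epsilon> a \<and> P c")
  case True
  then obtain c where "c \<epsilon> a" "P c" by blast
  from minimal_elem[of P, OF assms(1) this] obtain y
    where "y \<epsilon> a" "P y" "\<And>w. w \<epsilon> y \<Longrightarrow> w \<epsilon> a \<Longrightarrow> \<not> P w" by metis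
  then show ?thesis using that ordinal_mem ordinal_trans assms(2) by metis
next
  case False
  then show ?thesis using that assms by blast
qed

text \<open>A least \<open>a\<close> incomparable with some ordinal, and then a least
  \<open>b\<close> incomparable with that \<open>a\<close>, would have the same elements.\<close>

lemma ordinal_linear:
  assumes "ordinal a" "ordinal b" shows "a \<epsilon> b \<or> a = b \<or> b \<epsilon> a"
proof (rule ccontr)
  define Q where "Q a b \<longleftrightarrow> ordinal b \<and> \<not> (a \<epsilon> b \<or> a = b \<or> b \<epsilon> a)" for a b
  define P where "P a \<longleftrightarrow> (\<exists>b. Q a b)" for a
  assume "\<not> ?thesis"
  then have pa: "P a" using assms unfolding P_def Q_def by blast
  have "df {UNIV} (\<lambda>A e. P (e 0))" unfolding P_def Q_def by (intro dfU_intros df_ordinal)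
  from ordinal_least[of P, OF this assms(1) pa] obtain a
    where a: "ordinal a" "P a" "\<And>c. c \<epsilon> a \<Longrightarrow> \<not> P c" by metis
  from a(2) obtain b where b: "ordinal b" "Q a b" unfolding P_def Q_def by blast
  have "df {UNIV} (\<lambda>A e. Q a (e 0))" unfolding Q_def by (intro dfU_intros df_ordinal)
  from ordinal_least[of "Q a", OF this b] obtain b
    where b: "ordinal b" "Q a b" "\<And>c. c \<epsilon> b \<Longrightarrow> \<not> Q a c" by metis
  have "x \<epsilon> b" if "x \<epsilon> a" for x
    using a(3)[OF that] b(1,2) that ordinal_trans[OF a(1) that] unfolding P_def Q_def by blast
  moreover have "x \<epsilon> a" if "x \<epsilon> b" for x
    using b(3)[OF that] b(1,2) that ordinal_trans[OF b(1) that] ordinal_mem[OF b(1) that]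
    unfolding Q_def by blast
  ultimately have "a = b" by (auto intro: ext_eqI)
  then show False using b(2) unfolding Q_def by blast
qed

section \<open>Natural numbers of the model\<close>

lemma ordinal_suc [simp]: "ordinal n \<Longrightarrow> ordinal (suc n)"
  unfolding Defs.ordinal_def Defs.transitive_def ext_suc by blast

lemma natural_iff:
  "natural n \<longleftrightarrow> ordinal n \<and> (\<forall>m. m = n \<or> m \<epsilon> n \<longrightarrow> m = zero \<or> (\<exists>k. m = suc k))"
proof -
  have eq: "ext m = {} \<longleftrightarrow> m = zero" for m using ext_inject[of m zero] by (simp del: ext_inject)
  show ?thesis unfolding Defs.natural_def eq is_succ_iff ..
qed

lemma natural_ordinal: "natural n \<Longrightarrow> ordinal n" by (simp add: natural_iff)

lemma natural_mem: "natural n \<Longrightarrow> m \<epsilon> n \<Longrightarrow> natural m"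
  unfolding natural_iff using ordinal_mem[of n m] ordinal_trans[of n m] by blast

lemma natural_suc [simp]: "natural n \<Longrightarrow> natural (suc n)"
  unfolding natural_iff mem_suc by (metis ordinal_suc)

lemma natural_cases:
  assumes "natural n" shows "n = zero \<or> (\<exists>k. n = suc k \<and> natural k)"
proof -
  have "n = zero \<or> (\<exists>k. n = suc k)" using assms unfolding natural_iff by blast
  then show ?thesis using natural_mem[OF assms] by (metis mem_suc)
qed

text \<open>The natural numbers of the model may be ill-founded from the outside, so induction holds
  only for definable \<open>P\<close>. It comes from a least counterexample, not from induction in
  HOL.\<close>

lemma natural_induct:
  assumes "natural n" "P zero" "\<And>k. natural k \<Longrightarrow> P k \<Longrightarrow> P (suc k)"
    and "df {UNIV} (\<lambda>A e. P (e 0))"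
  shows "P n"
proof (rule ccontr)
  assume n: "\<not> P n"
  have "df {UNIV} (\<lambda>A e. natural (e 0) \<and> \<not> P (e 0))" by (intro dfU_intros df_natural assms(4))
  from ordinal_least[of "\<lambda>x. natural x \<and> \<not> P x", OF this natural_ordinal[OF assms(1)]] n assms(1)
  obtain m where "natural m" "\<not> P m" "\<And>c. c \<epsilon> m \<Longrightarrow> \<not> (natural c \<and> \<not> P c)" by metis
  then show False using natural_cases[of m] assms(2,3) by force
qed

lemma isset_natural [simp]: "isset {n. natural n}"
proof -
  obtain w where w: "\<exists>z\<in>ext w. ext z = {}" "\<forall>x\<in>ext w. \<exists>y\<in>ext w. ext y = insert x (ext x)"
    using ax_infinity by blast
  have "zero \<epsilon> w" using w(1) ext_inject[of _ zero] by auto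
  moreover have "suc k \<epsilon> w" if "k \<epsilon> w" for k
    using w(2) that by (metis ext_inject ext_suc mem_ext)
  ultimately have zw: "zero \<epsilon> w" "\<And>k. natural k \<Longrightarrow> k \<epsilon> w \<Longrightarrow> suc k \<epsilon> w" by auto
  have "n \<epsilon> w" if "natural n" for n
    by (rule natural_induct[where P = "\<lambda>n. n \<epsilon> w", OF that zw]) (assumption | intro dfU_intros)+
  then have "{n. natural n} = {n \<in> ext w. natural n}" by auto
  then show ?thesis using isset_sep[of natural w] df_natural0 by simp
qed

definition "omega = setof {n. natural n}"

lemma ext_omega [simp]: "ext omega = {n. natural n}" by (simp add: omega_def)

lemma mem_omega [simp]: "n \<epsilon> omega \<longleftrightarrow> natural n"
  using ext_omega mem_ext by blast

section \<open>Ordered pairs and functions\<close>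

definition "pr x y = setof {setof {x}, setof {x, y}}"

lemma setof_inject: "isset S \<Longrightarrow> isset T \<Longrightarrow> setof S = setof T \<longleftrightarrow> S = T"
  using ext_setof by metis

lemma pr_inject [simp]: "pr x y = pr x' y' \<longleftrightarrow> x = x' \<and> y = y'"
  unfolding pr_def by (simp add: setof_inject doubleton_eq_iff) (metis doubleton_eq_iff insert_absorb2 isset_pair setof_inject)

lemma is_pair_iff [simp]: "is_pair p x y \<longleftrightarrow> p = pr x y"
proof
  assume "is_pair p x y"
  then obtain a b where "ext a = {x}" "ext b = {x, y}" "ext p = {a, b}"
    unfolding Defs.is_pair_def by blast
  then show "p = pr x y" unfolding pr_def by (metis setof_ext)
next
  assume "p = pr x y"
  then show "is_pair p x y" unfolding Defs.is_pair_def pr_def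
    by (intro exI[of _ "setof {x}"] exI[of _ "setof {x, y}"]) simp
qed

lemma is_pair_eta [simp]: "is_pair p x = (\<lambda>y. p = pr x y)"
  by auto

lemma df_is_pair0: "df G (\<lambda>A e. is_pair (e 0) (e 1) (e 2))"
proof -
  have eq: "is_pair p x y \<longleftrightarrow> (\<exists>a\<in>ext p. \<exists>b\<in>ext p. x \<epsilon> a \<and> (\<forall>z\<in>ext a. z = x) \<and>
    x \<epsilon> b \<and> y \<epsilon> b \<and> (\<forall>z\<in>ext b. z = x \<or> z = y) \<and> (\<forall>c\<in>ext p. c = a \<or> c = b))" (is "_ \<longleftrightarrow> ?R") for p x y
  proof
    assume "is_pair p x y"
    then show ?R unfolding is_pair_iff
      by - (rule bexI[of _ "setof {x}"], rule bexI[of _ "setof {x, y}"], simp_all add: pr_def)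
  next
    assume ?R
    then obtain a b where ab: "a \<in> ext p" "b \<in> ext p" "x \<epsilon> a" "\<forall>z\<in>ext a. z = x"
      "x \<epsilon> b" "y \<epsilon> b" "\<forall>z\<in>ext b. z = x \<or> z = y" "\<forall>c\<in>ext p. c = a \<or> c = b"
      by (elim bexE conjE) (rule that)
    have "x \<in> ext a" "x \<in> ext b" "y \<in> ext b" using ab(3,5,6) by simp_all
    then have "ext a = {x}" and "ext b = {x, y}" using ab(4,7) by blast+
    moreover have "ext p = {a, b}" using ab(1,2,8) by blast
    ultimately
    show "is_pair p x y" unfolding Defs.is_pair_def by blast
  qed
  show ?thesis unfolding eq by (intro df_intros)
qed

lemma df_eq_pr: "tm G t \<Longrightarrow> tm G u \<Longrightarrow> tm G v \<Longrightarrow> df G (\<lambda>A e. t A e = pr (u A e) (v A e))"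
  using df3[where R = "\<lambda>A. is_pair", OF df_is_pair0] by simp

lemma tm_comp2:
  assumes "tm G (\<lambda>A e. F (e 0) (e 1))" "tm G t" "tm G u" shows "tm G (\<lambda>A e. F (t A e) (u A e))"
  unfolding tm_def
proof (intro conjI ballI allI impI)
  fix A and e :: "nat \<Rightarrow> 'v" assume a: "A \<in> G" "good A" "range e \<subseteq> A"
  then have "t A e \<in> A" "u A e \<in> A" using assms unfolding tm_def by blast+
  then have "range (\<lambda>n. if n = 0 then t A e else u A e) \<subseteq> A" by auto
  then have "(\<lambda>e. F (e 0) (e 1)) (\<lambda>n::nat. if n = 0 then t A e else u A e) \<in> A"
    using assms(1) a unfolding tm_def by blast
  then show "F (t A e) (u A e) \<in> A" by simp
next
  have "df G (\<lambda>A e. e 0 = F (e 1) (e 2))" using assms(1) by (simp add: tm_def numeral_2_eq_2)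
  from df3[where R = "\<lambda>A x y z. x = F y z", OF this tm_var tm_ren[OF assms(2)] tm_ren[OF assms(3)]]
  show "df G (\<lambda>A e. e 0 = F (t A (\<lambda>n. e (Suc n))) (u A (\<lambda>n. e (Suc n))))" .
qed

lemma tm_comp1: "tm G (\<lambda>A e. F (e 0)) \<Longrightarrow> tm G t \<Longrightarrow> tm G (\<lambda>A e. F (t A e))"
  by (rule tm_comp2[where F = "\<lambda>x y. F x"])

lemma tm_pr0: "tm {UNIV} (\<lambda>A e. pr (e 0) (e 1))"
  unfolding tm_def by (intro conjI df_eq_pr tm_var) auto

lemmas tm_pr = tm_comp2[where F = pr, OF tm_pr0]

lemma tm_suc0: "tm {UNIV} (\<lambda>A e. suc (e 0))"
proof -
  have "df {UNIV} (\<lambda>A e. is_succ (e 0) (e (Suc 0)))" by (intro df_is_succ tm_var)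
  then show ?thesis by (simp add: tm_def)
qed

lemmas tm_suc = tm_comp1[where F = suc, OF tm_suc0]

lemma df_pr_mem0: "df G (\<lambda>A e. pr (e 0) (e 1) \<epsilon> e 2)"
proof -
  have eq: "pr x y \<epsilon> f \<longleftrightarrow> (\<exists>p\<in>ext f. p = pr x y)" for x y f by auto
  show ?thesis unfolding eq by (intro df_intros df_eq_pr)
qed

lemmas df_pr_mem = df3[where R = "\<lambda>A x y f. pr x y \<epsilon> f", OF df_pr_mem0]

lemma good_pr: "good A \<Longrightarrow> pr x y \<in> A \<Longrightarrow> x \<in> A \<and> y \<in> A"
proof -
  assume a: "good A" "pr x y \<in> A"
  have "setof {x, y} \<epsilon> pr x y" "x \<epsilon> setof {x, y}" "y \<epsilon> setof {x, y}" by (auto simp: pr_def)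
  then show ?thesis using a good_mem by metis
qed

lemma func_iff: "func f D \<longleftrightarrow> (\<forall>p. p \<epsilon> f \<longrightarrow> (\<exists>x\<in>D. \<exists>y. p = pr x y)) \<and> (\<forall>x\<in>D. \<exists>!y. pr x y \<epsilon> f)"
  unfolding Defs.func_def by auto

lemma app_eq: "app f x = (THE y. pr x y \<epsilon> f)"
  unfolding Defs.app_def by simp

lemma app_mem: "func f D \<Longrightarrow> x \<in> D \<Longrightarrow> pr x (app f x) \<epsilon> f"
  unfolding func_iff app_eq by (rule theI') blast

lemma app_iff: "func f D \<Longrightarrow> x \<in> D \<Longrightarrow> pr x y \<epsilon> f \<longleftrightarrow> y = app f x"
  using app_mem[of f D x] unfolding func_iff by blast

lemma func_mem_iff:
  assumes "func f D" shows "z \<epsilon> f \<longleftrightarrow> (\<exists>x\<in>D. z = pr x (app f x))"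
proof
  assume "z \<epsilon> f"
  moreover from this obtain x y where "x \<in> D" "z = pr x y" using assms unfolding func_iff by metis
  ultimately show "\<exists>x\<in>D. z = pr x (app f x)" using app_iff[OF assms, of x y] by metis
next
  assume "\<exists>x\<in>D. z = pr x (app f x)"
  then show "z \<epsilon> f" using app_mem[OF assms] by metis
qed

lemma func_ext:
  assumes "func f D" "func g D" "\<And>x. x \<in> D \<Longrightarrow> app f x = app g x" shows "f = g"
  by (rule ext_eqI) (simp add: func_mem_iff[OF assms(1)] func_mem_iff[OF assms(2)] assms(3))

text \<open>\<open>app\<close> is a definite description and undefined off the domain; this totalization of it is
  definable.\<close>

definition "appd f x = (if \<exists>!y. pr x y \<epsilon> f then app f x else x)"

lemma appd_eq: "func f D \<Longrightarrow> x \<in> D \<Longrightarrow> appd f x = app f x"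
  unfolding appd_def func_iff by auto

lemma df_uniq0: "df G (\<lambda>A e. \<exists>!y. pr (e 1) y \<epsilon> e 0)"
proof -
  have eq: "(\<exists>!y. pr x y \<epsilon> f) \<longleftrightarrow> (\<exists>y. pr x y \<epsilon> f \<and> \<not> (\<exists>z. pr x z \<epsilon> f \<and> z \<noteq> y))" for f x by blast
  have cl: "y \<in> A" if "good A" "range e \<subseteq> A" "pr x y \<epsilon> e i" for A x y e and i :: nat
    using that good_pr good_mem by (metis range_subsetD)
  show ?thesis
    unfolding eq by (intro df_ex df_intros df_pr_mem) (blast intro: cl)+
qed

text \<open>A value found in \<open>f\<close> is a component of a pair in \<open>f\<close>, hence in
  the class by transitivity. The default value \<open>x\<close> is in the class anyway, so
  \<open>appd\<close> is an operation on every good class.\<close>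

lemma tm_appd0: "tm G (\<lambda>A e. appd (e 0) (e 1))"
  unfolding tm_def
proof (intro conjI ballI allI impI)
  fix A and e :: "nat \<Rightarrow> 'v" assume a: "good A" "range e \<subseteq> A"
  then have e: "e i \<in> A" for i by auto
  show "appd (e 0) (e 1) \<in> A"
  proof (cases "\<exists>!y. pr (e 1) y \<epsilon> e 0")
    case True
    then have "pr (e 1) (app (e 0) (e 1)) \<epsilon> e 0" unfolding app_eq by (rule theI')
    then have "app (e 0) (e 1) \<in> A" using good_pr[OF a(1) good_mem[OF a(1) e]] by blast
    then show ?thesis using True unfolding appd_def by simp
  next
    case False
    then show ?thesis using e unfolding appd_def by simp
  qed
next
  have eq: "y = appd f x \<longleftrightarrow> ((\<exists>!y. pr x y \<epsilon> f) \<and> pr x y \<epsilon> f) \<or> (\<not> (\<exists>!y. pr x y \<epsilon> f) \<and> y = x)" for f x y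
  proof (cases "\<exists>!y. pr x y \<epsilon> f")
    case True
    then have "pr x (app f x) \<epsilon> f" unfolding app_eq by (rule theI')
    then show ?thesis using True unfolding appd_def by auto
  next
    case False
    then show ?thesis unfolding appd_def by simp
  qed
  show "df G (\<lambda>A e. e 0 = appd (e (Suc 0)) (e (Suc 1)))"
    unfolding eq by (intro df_intros df_pr_mem df2[where R = "\<lambda>A f x. \<exists>!y. pr x y \<epsilon> f", OF df_uniq0])
qed

lemmas tm_appd = tm_comp2[where F = appd, OF tm_appd0]

lemma df_func0: "df G (\<lambda>A e. func (e 0) (ext (e 1)))"
proof -
  have eq: "func f (ext X) \<longleftrightarrow> (\<forall>p\<in>ext f. \<exists>x\<in>ext X. \<exists>y. p = pr x y) \<and> (\<forall>x\<in>ext X. \<exists>!y. pr x y \<epsilon> f)" for f X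
    unfolding func_iff by auto
  have cl: "y \<in> A" if "good A" "range e \<subseteq> A" "e i = pr x y" for A x y e and i :: nat
    using that good_pr by (metis range_subsetD)
  show ?thesis
    unfolding eq by (intro df_intros df_ex df_eq_pr df2[where R = "\<lambda>A f x. \<exists>!y. pr x y \<epsilon> f", OF df_uniq0])
      (blast intro: cl)+
qed

lemmas df_func = df2[where R = "\<lambda>A f X. func f (ext X)", OF df_func0]

lemma lam_exists:
  assumes "tm {UNIV} (\<lambda>A e. F (e 0))"
  shows "\<exists>f. func f (ext X) \<and> (\<forall>x\<in>ext X. app f x = F x)"
proof -
  have i: "isset ((\<lambda>x. pr x (F x)) ` ext X)"
    by (rule isset_image) (intro tm_pr tm_var assms)
  let ?f = "setof ((\<lambda>x. pr x (F x)) ` ext X)"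
  have f: "func ?f (ext X)" unfolding func_iff by (auto simp: i)
  have "app ?f x = F x" if "x \<epsilon> X" for x
  proof -
    have "pr x (F x) \<epsilon> ?f" using that i by auto
    then show ?thesis using app_iff[OF f] that by auto
  qed
  with f show ?thesis by auto
qed

lemma lam_eq: "func f (ext X) \<Longrightarrow> (\<And>x. x \<epsilon> X \<Longrightarrow> app f x = F x) \<Longrightarrow> lam X F = f"
  unfolding Defs.lam_def by (rule the_equality) (auto intro: func_ext)

lemma func_lam:
  assumes "tm {UNIV} (\<lambda>A e. F (e 0))"
  shows "func (lam X F) (ext X)" "x \<epsilon> X \<Longrightarrow> app (lam X F) x = F x"
proof -
  obtain f where "func f (ext X)" "\<forall>x\<in>ext X. app f x = F x" using lam_exists[OF assms] by blast
  moreover from this have "lam X F = f" by (intro lam_eq) auto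
  ultimately show "func (lam X F) (ext X)" "x \<epsilon> X \<Longrightarrow> app (lam X F) x = F x" by auto
qed

section \<open>Unions, disjoint sums and choice functions\<close>

lemma isset_UN:
  assumes "tm {UNIV} (\<lambda>A e. F (e 0))" shows "isset (\<Union>x\<in>ext X. ext (F x))"
proof -
  have "(\<Union>x\<in>ext X. ext (F x)) = (\<Union>y\<in>ext (setof (F ` ext X)). ext y)"
    by (simp add: isset_image[OF assms])
  then show ?thesis by (simp only: isset_Union)
qed

lemma tm_slice: "tm {UNIV} (\<lambda>A e. setof ((\<lambda>y. pr (e 0) y) ` ext (F (e 0))))"
  if "tm {UNIV} (\<lambda>A e. F (e 0))" for F
proof (rule tm_setof)
  show "isset (pr (e 0) ` ext (F (e 0)))" for e :: "nat \<Rightarrow> 'v"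
    by (rule isset_image) (intro tm_pr tm_var tm_constU)
  show "df {UNIV} (\<lambda>A e. e 0 \<in> pr (e (Suc 0)) ` ext (F (e (Suc 0))))"
    unfolding image_iff using tm_ren[OF that, of "\<lambda>i. Suc i"] by (intro dfU_intros df_eq_pr) simp
qed

lemma isset_Sigma:
  assumes "tm {UNIV} (\<lambda>A e. F (e 0))"
  shows "isset {p. \<exists>x y. x \<epsilon> X \<and> y \<epsilon> F x \<and> p = pr x y}"
proof -
  have "isset (pr x ` ext (F x))" for x by (rule isset_image) (intro tm_pr tm_var tm_constU)
  then have "{p. \<exists>x y. x \<epsilon> X \<and> y \<epsilon> F x \<and> p = pr x y} = (\<Union>x\<in>ext X. ext (setof (pr x ` ext (F x))))"
    by auto
  also have "isset \<dots>" by (rule isset_UN) (rule tm_slice[OF assms])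
  finally show ?thesis .
qed

text \<open>The axiom picks from pairwise disjoint sets, so \<open>F x\<close> is replaced by the
  pairs with first component \<open>x\<close>. The choice set, cut down to such pairs, is already
  the desired function.\<close>

lemma choice_sets:
  assumes "tm {UNIV} (\<lambda>A e. F (e 0))" "\<And>x. x \<epsilon> X \<Longrightarrow> ext (F x) \<noteq> {}"
  shows "\<exists>f. func f (ext X) \<and> (\<forall>x\<in>ext X. app f x \<epsilon> F x)"
proof -
  let ?S = "\<lambda>x. setof (pr x ` ext (F x))"
  have i: "isset (pr x ` ext (F x))" for x by (rule isset_image) (intro tm_pr tm_var tm_constU)
  let ?Fam = "setof (?S ` ext X)"
  have Fam: "isset (?S ` ext X)" by (rule isset_image) (rule tm_slice[OF assms(1)])
  have "\<exists>c. \<forall>y\<in>ext ?Fam. \<exists>!z. z \<in> ext c \<inter> ext y"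
    by (rule raw_choice) (use Fam i assms(2) in auto)
  then obtain c where "\<forall>y\<in>ext ?Fam. \<exists>!z. z \<in> ext c \<inter> ext y" by blast
  then have cx: "\<exists>!z. z \<in> ext c \<inter> pr x ` ext (F x)" if "x \<epsilon> X" for x
    using that by (simp add: Fam i)
  have c: "\<exists>!y. pr x y \<epsilon> c \<and> y \<epsilon> F x" if x: "x \<epsilon> X" for x
  proof -
    obtain z where z: "z \<in> ext c \<inter> pr x ` ext (F x)" "\<And>w. w \<in> ext c \<inter> pr x ` ext (F x) \<Longrightarrow> w = z"
      using cx[OF x] by (elim ex1E) blast
    from z(1) obtain y where y: "z = pr x y" "y \<epsilon> F x" by auto
    show ?thesis
    proof (rule ex1I)
      show "pr x y \<epsilon> c \<and> y \<epsilon> F x" using z(1) y by simp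
      show "w = y" if "pr x w \<epsilon> c \<and> w \<epsilon> F x" for w
        using z(2)[of "pr x w"] that y(1) by simp
    qed
  qed
  let ?P = "setof {p. \<exists>x y. x \<epsilon> X \<and> y \<epsilon> F x \<and> p = pr x y}"
  let ?f = "setof {p \<in> ext ?P. p \<epsilon> c}"
  have fi: "isset {p \<in> ext ?P. p \<epsilon> c}" by (rule isset_sep) (intro dfU_intros)
  have pf: "p \<epsilon> ?f \<longleftrightarrow> p \<epsilon> c \<and> (\<exists>x y. x \<epsilon> X \<and> y \<epsilon> F x \<and> p = pr x y)" for p
    using fi isset_Sigma[OF assms(1)] by auto
  have f: "func ?f (ext X)" unfolding func_iff pf
  proof (intro conjI allI impI ballI)
    fix x assume "x \<in> ext X"
    then show "\<exists>!y. pr x y \<epsilon> c \<and> (\<exists>xa ya. xa \<epsilon> X \<and> ya \<epsilon> F xa \<and> pr x y = pr xa ya)"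
      using c[of x] by simp
  qed auto
  have "app ?f x \<epsilon> F x" if "x \<in> ext X" for x
    using app_mem[OF f that] unfolding pf by auto
  with f show ?thesis by blast
qed

section \<open>Levels and collection\<close>

lemmas dfU = dfU_intros tm_pr tm_suc df_natural df_ordinal tm_appd df_func df_transitive

lemma isset_iff: "isset S \<longleftrightarrow> (\<exists>w. \<forall>z. z \<epsilon> w \<longleftrightarrow> z \<in> S)"
  unfolding isset_def using mem_ext by (metis set_eqI)

lemma sep_ex:
  assumes "df {UNIV} (\<lambda>A e. P (e 0))"
  shows "\<exists>y. \<forall>z. z \<epsilon> y \<longleftrightarrow> z \<epsilon> x \<and> P z"
proof -
  have "isset {z \<in> ext x. P z}" by (rule isset_sep[OF assms])
  then have "z \<epsilon> setof {z \<in> ext x. P z} \<longleftrightarrow> z \<epsilon> x \<and> P z" for z by simp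
  then show ?thesis by blast
qed

lemma rep_ex:
  assumes "df {UNIV} (\<lambda>A e. R (e 0) (e 1))" "\<And>z. z \<epsilon> x \<Longrightarrow> \<exists>!w. R z w"
  shows "\<exists>y. \<forall>w. w \<epsilon> y \<longleftrightarrow> (\<exists>z. z \<epsilon> x \<and> R z w)"
proof -
  have "isset {w. \<exists>z\<in>ext x. R z w}" by (rule isset_rep[OF assms])
  then have "w \<epsilon> setof {w. \<exists>z\<in>ext x. R z w} \<longleftrightarrow> (\<exists>z. z \<epsilon> x \<and> R z w)" for w by auto
  then show ?thesis by blast
qed

lemma union_ex: "\<exists>y. \<forall>z. z \<epsilon> y \<longleftrightarrow> (\<exists>w. w \<epsilon> x \<and> z \<epsilon> w)"
proof -
  have "z \<epsilon> setof (\<Union>y\<in>ext x. ext y) \<longleftrightarrow> (\<exists>w. w \<epsilon> x \<and> z \<epsilon> w)" for z by auto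
  then show ?thesis by blast
qed

lemma insert_ex: "\<exists>y. \<forall>z. z \<epsilon> y \<longleftrightarrow> z = a \<or> z \<epsilon> x"
proof -
  have "z \<epsilon> setof (insert a (ext x)) \<longleftrightarrow> z = a \<or> z \<epsilon> x" for z by auto
  then show ?thesis by blast
qed

lemma Un_ex: "\<exists>z. \<forall>w. w \<epsilon> z \<longleftrightarrow> w \<epsilon> x \<or> w \<epsilon> y"
proof -
  have "w \<epsilon> setof (ext x \<union> ext y) \<longleftrightarrow> w \<epsilon> x \<or> w \<epsilon> y" for w by auto
  then show ?thesis by blast
qed

definition "trail x S \<longleftrightarrow>
  (\<forall>p\<in>ext S. p = pr zero x \<or> (\<exists>k y y'. p = pr (suc k) y \<and> pr k y' \<epsilon> S \<and> y \<epsilon> y'))"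

text \<open>\<open>reach x n z\<close>: there is a chain \<open>z \<epsilon> \<dots> \<epsilon> x\<close> of length \<open>n\<close>. A set \<open>S\<close> of pairs traces the
  chain backwards, which avoids recursion on \<open>n\<close>.\<close>

definition "reach x n z \<longleftrightarrow> (\<exists>S. trail x S \<and> pr n z \<epsilon> S)"

lemma df_reach0: "df {UNIV} (\<lambda>A e. reach (e 0) (e 1) (e 2))"
  unfolding reach_def trail_def by (intro dfU)

lemmas df_reach = df3[where R = "\<lambda>A. reach", OF df_reach0]

lemma trailD: "trail x S \<Longrightarrow> p \<epsilon> S \<Longrightarrow>
    p = pr zero x \<or> (\<exists>k y y'. p = pr (suc k) y \<and> pr k y' \<epsilon> S \<and> y \<epsilon> y')"
  unfolding trail_def by simp

lemma reach_zero [simp]: "reach x zero z \<longleftrightarrow> z = x"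
proof
  assume "reach x zero z"
  then obtain S where "trail x S" "pr zero z \<epsilon> S" unfolding reach_def by blast
  from trailD[OF this] show "z = x" by simp
next
  assume "z = x"
  then show "reach x zero z" unfolding reach_def trail_def
    by (intro exI[of _ "setof {pr zero x}"]) simp
qed

lemma reach_suc [simp]: "reach x (suc n) z \<longleftrightarrow> (\<exists>y. reach x n y \<and> z \<epsilon> y)"
proof
  assume "reach x (suc n) z"
  then obtain S where S: "trail x S" "pr (suc n) z \<epsilon> S" unfolding reach_def by blast
  from trailD[OF S] obtain y where "pr n y \<epsilon> S" "z \<epsilon> y" by auto
  then show "\<exists>y. reach x n y \<and> z \<epsilon> y" using S(1) unfolding reach_def by blast
next
  assume "\<exists>y. reach x n y \<and> z \<epsilon> y"
  then obtain y S where S: "trail x S" "pr n y \<epsilon> S" "z \<epsilon> y" unfolding reach_def by blast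
  obtain S' where m: "\<And>p. p \<epsilon> S' \<longleftrightarrow> p = pr (suc n) z \<or> p \<epsilon> S"
    using insert_ex[of "pr (suc n) z" S] by blast
  have "trail x S'" unfolding trail_def Ball_def mem_ext m
    using trailD[OF S(1)] S(2,3) by blast
  then show "reach x (suc n) z" unfolding reach_def using m by blast
qed

lemma isset_reach: "natural n \<Longrightarrow> isset {z. reach x n z}"
  unfolding isset_iff mem_Collect_eq
proof (rule natural_induct[where P = "\<lambda>n. \<exists>w. \<forall>z. z \<epsilon> w \<longleftrightarrow> reach x n z"])
  show "\<exists>w. \<forall>z. z \<epsilon> w \<longleftrightarrow> reach x zero z" by (intro exI[of _ "setof {x}"]) simp
next
  fix k assume "\<exists>w. \<forall>z. z \<epsilon> w \<longleftrightarrow> reach x k z"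
  then obtain w where w: "\<And>z. z \<epsilon> w \<longleftrightarrow> reach x k z" by blast
  then show "\<exists>w. \<forall>z. z \<epsilon> w \<longleftrightarrow> reach x (suc k) z"
    by (intro exI[of _ "setof (\<Union>y\<in>ext w. ext y)"]) auto
next
  show "df {UNIV} (\<lambda>A e. \<exists>w. \<forall>z. z \<epsilon> w \<longleftrightarrow> reach x (e 0) z)" by (intro dfU df_reach)
qed

text \<open>\<open>T\<close> is the transitive closure of the singleton of \<open>x\<close>: the
  sets of end points of chains of length \<open>n\<close> are collected by replacement over
  \<open>omega\<close> and united.\<close>

lemma tc_ex: "\<exists>T. \<forall>z. z \<epsilon> T \<longleftrightarrow> (\<exists>n. natural n \<and> reach x n z)"
proof -
  let ?R = "\<lambda>n w. \<forall>z. z \<epsilon> w \<longleftrightarrow> reach x n z"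
  have R: "\<exists>!w. ?R n w" if "natural n" for n
    using isset_reach[OF that, of x] unfolding isset_iff mem_Collect_eq by (auto intro: ext_eqI)
  have "df {UNIV} (\<lambda>A e. ?R (e 0) (e 1))" by (intro dfU df_reach)
  then have "\<exists>L. \<forall>w. w \<epsilon> L \<longleftrightarrow> (\<exists>n. n \<epsilon> omega \<and> ?R n w)"
    by (rule rep_ex) (use R in simp)
  then obtain L where L: "\<And>w. w \<epsilon> L \<longleftrightarrow> (\<exists>n. n \<epsilon> omega \<and> ?R n w)" by blast
  obtain T where T: "\<And>z. z \<epsilon> T \<longleftrightarrow> (\<exists>w. w \<epsilon> L \<and> z \<epsilon> w)"
    using union_ex[of L] by blast
  have "z \<epsilon> T \<longleftrightarrow> (\<exists>n. natural n \<and> reach x n z)" for z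
  proof
    assume "z \<epsilon> T"
    then obtain w n where "natural n" "?R n w" "z \<epsilon> w" unfolding T L by auto
    then show "\<exists>n. natural n \<and> reach x n z" by blast
  next
    assume "\<exists>n. natural n \<and> reach x n z"
    then obtain n where n: "natural n" "reach x n z" by blast
    then obtain w where w: "?R n w" using R[OF n(1)] by (elim ex1E)
    then have "w \<epsilon> L" unfolding L mem_omega using n(1) by blast
    then show "z \<epsilon> T" unfolding T using w n(2) by blast
  qed
  then show ?thesis by blast
qed

text \<open>Foundation is about sets, and \<open>P\<close> may be a proper class. An element minimal
  in the part of \<open>P\<close> inside the transitive closure is minimal everywhere, because its
  own elements belong to that closure.\<close>

lemma eps_least:
  assumes "df {UNIV} (\<lambda>A e. P (e 0))" "P x"
  obtains y where "P y" "\<And>z. z \<epsilon> y \<Longrightarrow> \<not> P z"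
proof -
  obtain T where T: "\<And>z. z \<epsilon> T \<longleftrightarrow> (\<exists>n. natural n \<and> reach x n z)"
    using tc_ex[of x] by blast
  have "x \<epsilon> T" unfolding T by (rule exI[of _ zero]) simp
  from minimal_elem[of P, OF assms(1) this assms(2)]
  obtain y where y: "y \<epsilon> T" "P y" "\<And>w. w \<epsilon> y \<Longrightarrow> w \<epsilon> T \<Longrightarrow> \<not> P w" by metis
  have "z \<epsilon> T" if "z \<epsilon> y" for z
    using y(1) that unfolding T by (metis natural_suc reach_suc)
  then have "\<not> P z" if "z \<epsilon> y" for z using that y(3) by blast
  then show ?thesis by (rule that[OF y(2)])
qed

lemma eps_induct:
  assumes "\<And>y. (\<And>z. z \<epsilon> y \<Longrightarrow> P z) \<Longrightarrow> P y" "df {UNIV} (\<lambda>A e. P (e 0))" shows "P x"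
proof (rule ccontr)
  assume "\<not> P x"
  from eps_least[of "\<lambda>x. \<not> P x", OF df_not[OF assms(2)] this]
  obtain y where "\<not> P y" "\<And>z. z \<epsilon> y \<Longrightarrow> \<not> \<not> P z" by metis
  then show False using assms(1)[of y] by blast
qed

text \<open>Levels in the sense of Scott and Potter, without ordinals: a history contains with each
  member \<open>c\<close> all levels below \<open>c\<close>, and \<open>c\<close> consists of the subsets of these.\<close>

definition "hist h \<longleftrightarrow> (\<forall>c\<in>ext h. \<forall>x. x \<epsilon> c \<longleftrightarrow> (\<exists>d. d \<epsilon> h \<and> d \<epsilon> c \<and> ext x \<subseteq> ext d))"

definition "lev s \<longleftrightarrow> (\<exists>h. hist h \<and> (\<forall>x. x \<epsilon> s \<longleftrightarrow> (\<exists>d. d \<epsilon> h \<and> ext x \<subseteq> ext d)))"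

lemma df_lev0: "df {UNIV} (\<lambda>A e. lev (e 0))"
  unfolding lev_def hist_def by (intro dfU)

lemmas df_lev = df1[where R = "\<lambda>A. lev", OF df_lev0]

lemma histD: "hist h \<Longrightarrow> c \<epsilon> h \<Longrightarrow> x \<epsilon> c \<longleftrightarrow> (\<exists>d. d \<epsilon> h \<and> d \<epsilon> c \<and> ext x \<subseteq> ext d)"
  unfolding hist_def Ball_def mem_ext by blast

lemma subextD: "ext x \<subseteq> ext y \<Longrightarrow> z \<epsilon> x \<Longrightarrow> z \<epsilon> y"
  unfolding subset_iff mem_ext by blast

text \<open>Members of a history are transitive, by induction on \<open>c\<close>: an element
  \<open>y\<close> of \<open>c\<close> is contained in some lower \<open>d\<close>, which is
  transitive, so the elements of \<open>y\<close> are subsets of \<open>d\<close> and hence elements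
  of \<open>c\<close>.\<close>

lemma hist_mem_subset: "hist h \<Longrightarrow> c \<epsilon> h \<Longrightarrow> y \<epsilon> c \<Longrightarrow> ext y \<subseteq> ext c"
proof -
  assume h: "hist h"
  have "c \<epsilon> h \<longrightarrow> (\<forall>y\<in>ext c. ext y \<subseteq> ext c)"
  proof (rule eps_induct[where P = "\<lambda>c. c \<epsilon> h \<longrightarrow> (\<forall>y\<in>ext c. ext y \<subseteq> ext c)"], intro impI ballI subsetI)
    fix c y z
    assume IH: "\<And>d. d \<epsilon> c \<Longrightarrow> d \<epsilon> h \<longrightarrow> (\<forall>y\<in>ext d. ext y \<subseteq> ext d)"
      and c: "c \<epsilon> h" and y: "y \<in> ext c" and z: "z \<in> ext y"
    obtain d where d: "d \<epsilon> h" "d \<epsilon> c" "ext y \<subseteq> ext d"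
      using histD[OF h c, of y] y unfolding mem_ext by blast
    then have "ext z \<subseteq> ext d" using IH[OF d(2)] z by blast
    then have "z \<epsilon> c" using histD[OF h c, of z] d(1,2) by blast
    then show "z \<in> ext c" by simp
  qed (intro dfU)
  then show "c \<epsilon> h \<Longrightarrow> y \<epsilon> c \<Longrightarrow> ext y \<subseteq> ext c" by simp
qed

text \<open>The members of \<open>h\<close> that lie in \<open>c\<close> form a history again,
  because \<open>c\<close> is transitive, and the level of that history is \<open>c\<close>.\<close>

lemma hist_lev: assumes h: "hist h" "c \<epsilon> h" shows "lev c"
proof -
  have "df {UNIV} (\<lambda>A e. e 0 \<epsilon> c)" by (intro dfU)
  from sep_ex[of "\<lambda>d. d \<epsilon> c", OF this] obtain g where m: "\<And>d. d \<epsilon> g \<longleftrightarrow> d \<epsilon> h \<and> d \<epsilon> c" by blast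
  have tr: "e \<epsilon> c" if "d \<epsilon> c" "e \<epsilon> d" for d e
    by (rule subextD[OF hist_mem_subset[OF h that(1)] that(2)])
  have "hist g" unfolding hist_def
  proof (intro ballI allI)
    fix d x assume "d \<in> ext g"
    then have d: "d \<epsilon> h" "d \<epsilon> c" using m by auto
    show "x \<epsilon> d \<longleftrightarrow> (\<exists>e. e \<epsilon> g \<and> e \<epsilon> d \<and> ext x \<subseteq> ext e)"
      using histD[OF h(1) d(1), of x] tr[OF d(2)] unfolding m by blast
  qed
  moreover have "x \<epsilon> c \<longleftrightarrow> (\<exists>d. d \<epsilon> g \<and> ext x \<subseteq> ext d)" for x unfolding m using histD[OF h, of x] by blast
  ultimately show ?thesis unfolding lev_def by blast
qed

lemma lev_iff: assumes "lev s" shows "x \<epsilon> s \<longleftrightarrow> (\<exists>c. lev c \<and> c \<epsilon> s \<and> ext x \<subseteq> ext c)"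
proof -
  obtain h where h: "hist h" "\<And>x. x \<epsilon> s \<longleftrightarrow> (\<exists>d. d \<epsilon> h \<and> ext x \<subseteq> ext d)"
    using assms unfolding lev_def by blast
  show ?thesis
  proof
    assume "x \<epsilon> s"
    then obtain d where "d \<epsilon> h" "ext x \<subseteq> ext d" unfolding h(2) by blast
    moreover from this have "d \<epsilon> s" unfolding h(2) by blast
    ultimately show "\<exists>c. lev c \<and> c \<epsilon> s \<and> ext x \<subseteq> ext c" using hist_lev[OF h(1)] by blast
  next
    assume "\<exists>c. lev c \<and> c \<epsilon> s \<and> ext x \<subseteq> ext c"
    then show "x \<epsilon> s" unfolding h(2) by (metis subset_trans)
  qed
qed

lemma lev_trans: assumes "lev s" "x \<epsilon> s" "y \<epsilon> x" shows "y \<epsilon> s"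
proof -
  obtain h where h: "hist h" "\<And>x. x \<epsilon> s \<longleftrightarrow> (\<exists>d. d \<epsilon> h \<and> ext x \<subseteq> ext d)"
    using assms unfolding lev_def by blast
  from assms(2) obtain d where d: "d \<epsilon> h" "ext x \<subseteq> ext d" unfolding h(2) by blast
  have "ext y \<subseteq> ext d" using hist_mem_subset[OF h(1) d(1)] subextD[OF d(2) assms(3)] .
  then show ?thesis unfolding h(2) using d(1) by blast
qed

text \<open>By \<open>lev_iff\<close> a level is determined by the levels in it. For incomparable
  \<open>s\<close> and \<open>t\<close> the two induction hypotheses put every level in
  \<open>s\<close> into \<open>t\<close> and conversely.\<close>

lemma lev_linear: "lev s \<Longrightarrow> lev t \<Longrightarrow> s \<epsilon> t \<or> s = t \<or> t \<epsilon> s"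
proof -
  have "lev s \<longrightarrow> (\<forall>t. lev t \<longrightarrow> s \<epsilon> t \<or> s = t \<or> t \<epsilon> s)"
  proof (rule eps_induct[where P = "\<lambda>s. lev s \<longrightarrow> (\<forall>t. lev t \<longrightarrow> s \<epsilon> t \<or> s = t \<or> t \<epsilon> s)"], intro impI allI)
    fix s t
    assume IH: "\<And>z. z \<epsilon> s \<Longrightarrow> lev z \<longrightarrow> (\<forall>t. lev t \<longrightarrow> z \<epsilon> t \<or> z = t \<or> t \<epsilon> z)" and s: "lev s"
    have "lev t \<longrightarrow> s \<epsilon> t \<or> s = t \<or> t \<epsilon> s"
    proof (rule eps_induct[where P = "\<lambda>t. lev t \<longrightarrow> s \<epsilon> t \<or> s = t \<or> t \<epsilon> s"], rule impI, rule ccontr)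
      fix t
      assume IH2: "\<And>z. z \<epsilon> t \<Longrightarrow> lev z \<longrightarrow> s \<epsilon> z \<or> s = z \<or> z \<epsilon> s" and t: "lev t"
        and n: "\<not> (s \<epsilon> t \<or> s = t \<or> t \<epsilon> s)"
      have a: "z \<epsilon> s" if "z \<epsilon> t" "lev z" for z
        using IH2[OF that(1)] that n lev_trans[OF t that(1)] by blast
      have b: "z \<epsilon> t" if "z \<epsilon> s" "lev z" for z
        using IH[OF that(1)] that n t lev_trans[OF s that(1)] by blast
      have "z \<epsilon> s \<longleftrightarrow> z \<epsilon> t" for z
        using lev_iff[OF s, of z] lev_iff[OF t, of z] a b by blast
      then have "s = t" by (rule ext_eqI)
      with n show False by blast
    qed (intro dfU df_lev)
    then show "lev t \<Longrightarrow> s \<epsilon> t \<or> s = t \<or> t \<epsilon> s" by blast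
  qed (intro dfU df_lev)
  then show "lev s \<Longrightarrow> lev t \<Longrightarrow> s \<epsilon> t \<or> s = t \<or> t \<epsilon> s" by blast
qed

lemma tm_Pow0: "tm {UNIV} (\<lambda>A e. setof {y. ext y \<subseteq> ext (e 0)})"
  by (rule tm_setof) (simp, unfold mem_Collect_eq, intro dfU)

text \<open>A set of levels that is closed downwards is itself a history.\<close>

lemma lev_of_closed:
  assumes "\<And>c. c \<epsilon> H \<Longrightarrow> lev c" "\<And>c d. c \<epsilon> H \<Longrightarrow> lev d \<Longrightarrow> d \<epsilon> c \<Longrightarrow> d \<epsilon> H"
  shows "\<exists>s. lev s \<and> (\<forall>x. x \<epsilon> s \<longleftrightarrow> (\<exists>d. d \<epsilon> H \<and> ext x \<subseteq> ext d))"
proof -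
  have i: "isset (\<Union>c\<in>ext H. ext (setof {y. ext y \<subseteq> ext c}))" by (rule isset_UN) (rule tm_Pow0)
  have "\<exists>S. \<forall>x. x \<epsilon> S \<longleftrightarrow> (\<exists>d. d \<epsilon> H \<and> ext x \<subseteq> ext d)"
  proof (intro exI allI)
    fix x show "x \<epsilon> setof (\<Union>c\<in>ext H. ext (setof {y. ext y \<subseteq> ext c})) \<longleftrightarrow> (\<exists>d. d \<epsilon> H \<and> ext x \<subseteq> ext d)"
      unfolding mem_setof[OF i] by auto
  qed
  then obtain S where S: "\<And>x. x \<epsilon> S \<longleftrightarrow> (\<exists>d. d \<epsilon> H \<and> ext x \<subseteq> ext d)" by blast
  have "hist H" unfolding hist_def
  proof (intro ballI allI)
    fix c x assume "c \<in> ext H"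
    then have c: "c \<epsilon> H" by simp
    show "x \<epsilon> c \<longleftrightarrow> (\<exists>d. d \<epsilon> H \<and> d \<epsilon> c \<and> ext x \<subseteq> ext d)"
      using lev_iff[OF assms(1)[OF c], of x] assms(1) assms(2)[OF c] by blast
  qed
  then show ?thesis using S unfolding lev_def by blast
qed

lemma lev_above: assumes "lev s" shows "\<exists>t. lev t \<and> (\<forall>x. ext x \<subseteq> ext s \<longrightarrow> x \<epsilon> t)"
proof -
  obtain K where K: "\<And>c. c \<epsilon> K \<longleftrightarrow> c \<epsilon> s \<and> lev c" using sep_ex[of lev, OF df_lev0] by blast
  obtain H where H: "\<And>c. c \<epsilon> H \<longleftrightarrow> c = s \<or> c \<epsilon> K"
    using insert_ex[of s K] by blast
  have "\<exists>t. lev t \<and> (\<forall>x. x \<epsilon> t \<longleftrightarrow> (\<exists>d. d \<epsilon> H \<and> ext x \<subseteq> ext d))"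
    by (rule lev_of_closed; unfold H K) (use assms lev_trans in blast)+
  then show ?thesis unfolding H by blast
qed

text \<open>Uniqueness turns "the least level satisfying \<open>P\<close>" into a functional
  relation, so that replacement can serve relations with many values (Scott's trick).\<close>

lemma lev_least:
  assumes "df {UNIV} (\<lambda>A e. P (e 0))" "\<exists>s. lev s \<and> P s"
  shows "\<exists>!s. lev s \<and> P s \<and> (\<forall>t. lev t \<longrightarrow> P t \<longrightarrow> s = t \<or> s \<epsilon> t)"
proof -
  obtain a where "lev a \<and> P a" using assms(2) by blast
  moreover have "df {UNIV} (\<lambda>A e. lev (e 0) \<and> P (e 0))" by (intro dfU df_lev assms(1))
  ultimately obtain s where s: "lev s \<and> P s" "\<And>z. z \<epsilon> s \<Longrightarrow> \<not> (lev z \<and> P z)"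
    using eps_least[of "\<lambda>s. lev s \<and> P s" a] by metis
  show ?thesis
  proof (rule ex1I)
    show "lev s \<and> P s \<and> (\<forall>t. lev t \<longrightarrow> P t \<longrightarrow> s = t \<or> s \<epsilon> t)" using s lev_linear by blast
    show "t = s" if "lev t \<and> P t \<and> (\<forall>u. lev u \<longrightarrow> P u \<longrightarrow> t = u \<or> t \<epsilon> u)" for t
      using s that by blast
  qed
qed

text \<open>The least levels containing the elements of \<open>x\<close>, together with all levels
  below them, generate a level that includes \<open>x\<close> as a subset. A level above it has
  \<open>x\<close> as an element.\<close>

lemma in_lev: "\<exists>s. lev s \<and> x \<epsilon> s"
proof (rule eps_induct[where P = "\<lambda>x. \<exists>s. lev s \<and> x \<epsilon> s"])
  fix x assume IH: "\<And>y. y \<epsilon> x \<Longrightarrow> \<exists>s. lev s \<and> y \<epsilon> s"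
  let ?R = "\<lambda>y s. lev s \<and> y \<epsilon> s \<and> (\<forall>t. lev t \<longrightarrow> y \<epsilon> t \<longrightarrow> s = t \<or> s \<epsilon> t)"
  have R: "\<exists>!s. ?R y s" if "y \<epsilon> x" for y
    by (rule lev_least) (intro dfU, rule IH[OF that])
  have "df {UNIV} (\<lambda>A e. ?R (e 0) (e 1))" by (intro dfU df_lev)
  from rep_ex[of ?R x, OF this R]
  obtain L where L: "\<And>s. s \<epsilon> L \<longleftrightarrow> (\<exists>y. y \<epsilon> x \<and> ?R y s)" by blast
  obtain U where U: "\<And>c. c \<epsilon> U \<longleftrightarrow> (\<exists>s. s \<epsilon> L \<and> c \<epsilon> s)"
    using union_ex[of L] by blast
  obtain K where K: "\<And>c. c \<epsilon> K \<longleftrightarrow> c \<epsilon> U \<and> lev c" using sep_ex[of lev, OF df_lev0] by blast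
  obtain H where "\<And>c. c \<epsilon> H \<longleftrightarrow> c \<epsilon> L \<or> c \<epsilon> K"
    using Un_ex[of L K] by blast
  then have H: "c \<epsilon> H \<longleftrightarrow> c \<epsilon> L \<or> (lev c \<and> (\<exists>s. s \<epsilon> L \<and> c \<epsilon> s))" for c unfolding K U by blast
  have levL: "lev s" if "s \<epsilon> L" for s using that unfolding L by blast
  have "\<exists>s. lev s \<and> (\<forall>x. x \<epsilon> s \<longleftrightarrow> (\<exists>d. d \<epsilon> H \<and> ext x \<subseteq> ext d))"
  proof (rule lev_of_closed)
    show "lev c" if "c \<epsilon> H" for c using that levL unfolding H by blast
    show "d \<epsilon> H" if "c \<epsilon> H" "lev d" "d \<epsilon> c" for c d
      using that levL lev_trans unfolding H by blast
  qed
  then obtain s where s: "lev s" "\<And>x. x \<epsilon> s \<longleftrightarrow> (\<exists>d. d \<epsilon> H \<and> ext x \<subseteq> ext d)" by blast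
  have "ext x \<subseteq> ext s"
  proof
    fix y assume "y \<in> ext x"
    then have y: "y \<epsilon> x" by simp
    obtain l where l: "?R y l" using R[OF y] by blast
    then have lL: "l \<epsilon> L" unfolding L using y by blast
    have "ext y \<subseteq> ext l"
    proof
      fix z assume "z \<in> ext y"
      then show "z \<in> ext l" using lev_trans[of l y z] l unfolding mem_ext by blast
    qed
    then show "y \<in> ext s" unfolding mem_ext s(2) H using lL by blast
  qed
  then show "\<exists>s. lev s \<and> x \<epsilon> s" using lev_above[OF s(1)] by blast
qed (intro dfU df_lev)

section \<open>Choice for definable relations\<close>

lemma tm_the:
  assumes "df {UNIV} (\<lambda>A e. Q (e 0) (e 1))" "\<And>x. \<exists>!w. Q x w"
  shows "tm {UNIV} (\<lambda>A e. THE w. Q (e 0) w)"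
proof -
  have "w = (THE w. Q x w) \<longleftrightarrow> Q x w" for x w using assms(2)[of x] by (metis the1_equality)
  moreover have "df {UNIV} (\<lambda>A e. Q (e (Suc 0)) (e 0))"
    by (rule df2[where R = "\<lambda>A. Q", OF assms(1)]) (rule tm_var)+
  ultimately show ?thesis by (simp add: tm_def)
qed

text \<open>The witnesses for \<open>x\<close> may form a proper class. Those in the least level
  that contains any form a set \<open>W x\<close>, and \<open>choice_sets\<close> selects from
  these.\<close>

theorem choice:
  assumes "df {UNIV} (\<lambda>A e. R (e 0) (e 1))" "\<And>x. x \<epsilon> X \<Longrightarrow> \<exists>y. R x y"
  shows "\<exists>f. func f (ext X) \<and> (\<forall>x\<in>ext X. R x (app f x))"
proof -
  \<comment> \<open>Where \<open>R x\<close> has no witness, everything counts as one. The least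
    level then exists for every \<open>x\<close>, as a definable operation requires.\<close>
  define R' where "R' x y \<longleftrightarrow> R x y \<or> \<not> (\<exists>z. R x z)" for x y
  have dR: "tm {UNIV} t \<Longrightarrow> tm {UNIV} u \<Longrightarrow> df {UNIV} (\<lambda>A e. R' (t A e) (u A e))" for t u
  proof (rule df2[where R = "\<lambda>A. R'"])
    show "df {UNIV} (\<lambda>A e. R' (e 0) (e 1))"
      unfolding R'_def by (intro dfU df2[where R = "\<lambda>A. R", OF assms(1)])
  qed
  define Q where "Q x s \<longleftrightarrow> lev s \<and> (\<exists>y\<in>ext s. R' x y) \<and>
    (\<forall>t. lev t \<longrightarrow> (\<exists>y\<in>ext t. R' x y) \<longrightarrow> s = t \<or> s \<epsilon> t)" for x s
  have Q: "\<exists>!s. Q x s" for x unfolding Q_def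
  proof (rule lev_least)
    obtain y where "R' x y" unfolding R'_def by blast
    moreover obtain s where "lev s" "y \<epsilon> s" using in_lev by blast
    ultimately show "\<exists>s. lev s \<and> (\<exists>y\<in>ext s. R' x y)" unfolding Bex_def mem_ext by blast
  qed (intro dfU dR)
  define L where "L x = (THE s. Q x s)" for x
  have tL: "tm {UNIV} (\<lambda>A e. L (e 0))"
    unfolding L_def by (rule tm_the[OF _ Q]) (unfold Q_def, intro dfU df_lev dR)
  have i: "isset {y \<in> ext (L x). R' x y}" for x by (rule isset_sep) (intro dR dfU)
  define W where "W x = setof {y \<in> ext (L x). R' x y}" for x
  have W: "y \<epsilon> W x \<longleftrightarrow> y \<epsilon> L x \<and> R' x y" for x y unfolding W_def using i by simp
  have "tm {UNIV} (\<lambda>A e. setof {y \<in> ext (L (e 0)). R' (e 0) y})"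
    by (rule tm_setof[OF i], unfold mem_Collect_eq) (intro dfU dR tm_comp1[where F = L, OF tL])
  then have tW: "tm {UNIV} (\<lambda>A e. W (e 0))" by (simp only: W_def)
  have ne: "ext (W x) \<noteq> {}" for x
  proof -
    have "Q x (L x)" unfolding L_def by (rule theI') (rule Q)
    then obtain y where "y \<in> ext (L x)" "R' x y" unfolding Q_def by blast
    then have "y \<in> ext (W x)" by (simp add: W)
    then show ?thesis by blast
  qed
  from choice_sets[OF tW ne] obtain f where f: "func f (ext X)" "\<forall>x\<in>ext X. app f x \<epsilon> W x" by blast
  have "R x (app f x)" if "x \<in> ext X" for x
  proof -
    have "R' x (app f x)" using f(2) that unfolding W by blast
    then show ?thesis using assms(2)[of x] that unfolding R'_def by auto
  qed
  with f(1) show ?thesis by blast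
qed

section \<open>Countably complete ultrafilters and the theorem of Los\<close>

definition "big X U P \<longleftrightarrow> (\<exists>S\<in>ext U. ext S = {x \<in> ext X. P x})"

lemma eq_mod_big: "eq_mod X U f g \<longleftrightarrow> big X U (\<lambda>x. app f x = app g x)"
  unfolding Defs.eq_mod_def big_def ..

lemma mem_mod_big: "mem_mod X U f g \<longleftrightarrow> big X U (\<lambda>x. app f x \<epsilon> app g x)"
  unfolding Defs.mem_mod_def big_def ..

lemma big_cong: "(\<And>x. x \<epsilon> X \<Longrightarrow> P x = Q x) \<Longrightarrow> big X U P = big X U Q"
proof -
  assume "\<And>x. x \<epsilon> X \<Longrightarrow> P x = Q x"
  then have "{x \<in> ext X. P x} = {x \<in> ext X. Q x}" by auto
  then show ?thesis unfolding big_def by simp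
qed

lemma ccD:
  assumes "cc_ultrafilter UNIV X U"
  shows cc_sub: "S \<epsilon> U \<Longrightarrow> ext S \<subseteq> ext X" and cc_ne: "S \<epsilon> U \<Longrightarrow> ext S \<noteq> {}"
    and cc_top: "X \<epsilon> U"
    and cc_up: "S \<epsilon> U \<Longrightarrow> ext S \<subseteq> ext T \<Longrightarrow> ext T \<subseteq> ext X \<Longrightarrow> T \<epsilon> U"
    and cc_compl: "ext S \<subseteq> ext X \<Longrightarrow> S \<epsilon> U \<or> (\<exists>T\<in>ext U. ext T = ext X - ext S)"
    and cc_countable: "func f {n. natural n} \<Longrightarrow> (\<And>n. natural n \<Longrightarrow> app f n \<epsilon> U) \<Longrightarrow>
        \<exists>T\<in>ext U. ext T = {x \<in> ext X. \<forall>n. natural n \<longrightarrow> x \<epsilon> app f n}"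
proof -
  note h = assms[unfolded Defs.cc_ultrafilter_def, THEN conjunct2, THEN conjunct2]
  note a = h[THEN conjunct1] h[THEN conjunct2, THEN conjunct1]
    h[THEN conjunct2, THEN conjunct2, THEN conjunct1]
    h[THEN conjunct2, THEN conjunct2, THEN conjunct2, THEN conjunct1]
    h[THEN conjunct2, THEN conjunct2, THEN conjunct2, THEN conjunct2]
  have U: "S \<epsilon> U \<longleftrightarrow> S \<in> ext U" for S by simp
  show "S \<epsilon> U \<Longrightarrow> ext S \<subseteq> ext X" "S \<epsilon> U \<Longrightarrow> ext S \<noteq> {}" using a(1) unfolding U by blast+
  show "X \<epsilon> U" by (rule a(2))
  show "S \<epsilon> U \<Longrightarrow> ext S \<subseteq> ext T \<Longrightarrow> ext T \<subseteq> ext X \<Longrightarrow> T \<epsilon> U" using a(3) unfolding U by blast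
  show "ext S \<subseteq> ext X \<Longrightarrow> S \<epsilon> U \<or> (\<exists>T\<in>ext U. ext T = ext X - ext S)" using a(4) by blast
  show "func f {n. natural n} \<Longrightarrow> (\<And>n. natural n \<Longrightarrow> app f n \<epsilon> U) \<Longrightarrow>
        \<exists>T\<in>ext U. ext T = {x \<in> ext X. \<forall>n. natural n \<longrightarrow> x \<epsilon> app f n}" using a(5) by blast
qed

text \<open>Countable completeness speaks of a function in the model; a definable family of large
  sets becomes such a function by \<open>choice\<close>.\<close>

lemma cc_countable_rel:
  assumes cc: "cc_ultrafilter UNIV X U"
    and d: "df {UNIV} (\<lambda>A e. R (e 0) (e 1))"
    and R: "\<And>n. natural n \<Longrightarrow> \<exists>S. S \<epsilon> U \<and> R n S"
  shows "\<exists>T. T \<epsilon> U \<and> (\<forall>x. x \<epsilon> T \<longrightarrow> x \<epsilon> X \<and> (\<forall>n. natural n \<longrightarrow> (\<exists>S. S \<epsilon> U \<and> R n S \<and> x \<epsilon> S)))"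
proof -
  have "df {UNIV} (\<lambda>A e. e 1 \<epsilon> U \<and> R (e 0) (e 1))" by (intro dfU d)
  then have "\<exists>f. func f (ext omega) \<and> (\<forall>n\<in>ext omega. app f n \<epsilon> U \<and> R n (app f n))"
    by (rule choice) (use R in simp)
  then obtain f where f: "func f {n. natural n}" "\<And>n. natural n \<Longrightarrow> app f n \<epsilon> U \<and> R n (app f n)"
    by auto
  have "\<exists>T\<in>ext U. ext T = {x \<in> ext X. \<forall>n. natural n \<longrightarrow> x \<epsilon> app f n}"
    by (rule cc_countable[OF cc f(1)]) (use f(2) in blast)
  then obtain T where T: "T \<in> ext U" "ext T = {x \<in> ext X. \<forall>n. natural n \<longrightarrow> x \<epsilon> app f n}" by blast
  have "x \<epsilon> X \<and> (\<forall>n. natural n \<longrightarrow> (\<exists>S. S \<epsilon> U \<and> R n S \<and> x \<epsilon> S))" if "x \<epsilon> T" for x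
  proof -
    have "x \<in> ext T" using that by simp
    then have "x \<epsilon> X" "\<forall>n. natural n \<longrightarrow> x \<epsilon> app f n" unfolding T(2) by auto
    then show ?thesis using f(2) by blast
  qed
  then show ?thesis using T(1) unfolding mem_ext by blast
qed

text \<open>The definition has no clause for two sets; the countable sequence
  \<open>S, T, T, ...\<close> gives their intersection.\<close>

lemma cc_inter:
  assumes cc: "cc_ultrafilter UNIV X U" and S: "S \<epsilon> U" and T: "T \<epsilon> U"
  shows "\<exists>R. R \<epsilon> U \<and> ext R \<subseteq> ext S \<inter> ext T"
proof -
  let ?R = "\<lambda>n y. (n = zero \<and> y = S) \<or> (n \<noteq> zero \<and> y = T)"
  have d: "df {UNIV} (\<lambda>A e. ?R (e 0) (e 1))" by (intro dfU)
  have "\<And>n. natural n \<Longrightarrow> \<exists>W. W \<epsilon> U \<and> ?R n W" using S T by blast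
  from cc_countable_rel[OF cc, of ?R, OF d this] obtain W where
    W: "W \<epsilon> U" "\<And>x n. x \<epsilon> W \<Longrightarrow> natural n \<Longrightarrow> \<exists>S. S \<epsilon> U \<and> ?R n S \<and> x \<epsilon> S"
    by blast
  have "x \<epsilon> S \<and> x \<epsilon> T" if "x \<epsilon> W" for x
    using W(2)[OF that natural_zero] W(2)[OF that natural_suc[OF natural_zero]] suc_neq_zero(1) by blast
  then show ?thesis using W(1) by (intro exI[of _ W]) auto
qed

text \<open>\<open>big\<close> asks that the exact set of points satisfying \<open>P\<close> belongs
  to \<open>U\<close>. For definable \<open>P\<close> separation forms this set, so that any member
  of \<open>U\<close> on which \<open>P\<close> holds suffices. This is why the laws for
  \<open>big\<close> carry \<open>df\<close> premises.\<close>

lemma big_iff: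
  assumes cc: "cc_ultrafilter UNIV X U" and d: "df {UNIV} (\<lambda>A e. P (e 0))"
  shows "big X U P \<longleftrightarrow> (\<exists>S. S \<epsilon> U \<and> (\<forall>x. x \<epsilon> S \<longrightarrow> P x))"
proof
  assume "big X U P"
  then obtain S where S: "S \<epsilon> U" "ext S = {x \<in> ext X. P x}" unfolding big_def by auto
  have "P x" if "x \<epsilon> S" for x
  proof -
    have "x \<in> ext S" using that by simp
    then show ?thesis unfolding S(2) by simp
  qed
  then show "\<exists>S. S \<epsilon> U \<and> (\<forall>x. x \<epsilon> S \<longrightarrow> P x)" using S(1) by blast
next
  assume "\<exists>S. S \<epsilon> U \<and> (\<forall>x. x \<epsilon> S \<longrightarrow> P x)"
  then obtain S where S: "S \<epsilon> U" "\<And>x. x \<epsilon> S \<Longrightarrow> P x" by blast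
  obtain T where T: "\<And>x. x \<epsilon> T \<longleftrightarrow> x \<epsilon> X \<and> P x" using sep_ex[of P X, OF d] by blast
  have "T \<epsilon> U"
    by (rule cc_up[OF cc S(1)]) (use cc_sub[OF cc S(1)] S(2) T in \<open>auto simp: subset_iff\<close>)
  then have "T \<in> ext U" by simp
  moreover have "ext T = {x \<in> ext X. P x}" by (intro set_eqI) (simp add: T)
  ultimately show "big X U P" unfolding big_def by blast
qed

lemma bigI:
  assumes "cc_ultrafilter UNIV X U" "df {UNIV} (\<lambda>A e. P (e 0))" "S \<epsilon> U" "\<And>x. x \<epsilon> S \<Longrightarrow> P x"
  shows "big X U P"
  by (rule iffD2[OF big_iff[OF assms(1,2)]]) (use assms(3,4) in blast)

lemma bigE:
  assumes "big X U P"
  obtains S where "S \<epsilon> U" "\<And>x. x \<epsilon> S \<Longrightarrow> P x \<and> x \<epsilon> X"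
proof -
  obtain S where S: "S \<epsilon> U" "ext S = {x \<in> ext X. P x}" using assms unfolding big_def by auto
  have "P x \<and> x \<epsilon> X" if "x \<epsilon> S" for x
  proof -
    have "x \<in> ext S" using that by simp
    then show ?thesis unfolding S(2) by simp
  qed
  with S(1) show ?thesis by (rule that)
qed

lemma big_nonempty: "cc_ultrafilter UNIV X U \<Longrightarrow> big X U P \<Longrightarrow> \<exists>x. x \<epsilon> X \<and> P x"
  by (erule bigE) (use cc_ne in fastforce)

lemma big_all:
  assumes "cc_ultrafilter UNIV X U" "df {UNIV} (\<lambda>A e. P (e 0))" "\<And>x. x \<epsilon> X \<Longrightarrow> P x"
  shows "big X U P"
  using bigI[of X U P X, OF assms(1,2) cc_top[OF assms(1)]] assms(3) by blast

lemma big_mono: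
  assumes "cc_ultrafilter UNIV X U" "df {UNIV} (\<lambda>A e. Q (e 0))" "big X U P"
    "\<And>x. x \<epsilon> X \<Longrightarrow> P x \<Longrightarrow> Q x"
  shows "big X U Q"
proof -
  obtain S where S: "S \<epsilon> U" "\<And>x. x \<epsilon> S \<Longrightarrow> P x \<and> x \<epsilon> X" using bigE[OF assms(3)] by metis
  then show ?thesis by (intro bigI[OF assms(1,2)]) (use assms(4) in blast)+
qed

lemma big_conj:
  assumes "cc_ultrafilter UNIV X U" "df {UNIV} (\<lambda>A e. P (e 0))" "df {UNIV} (\<lambda>A e. Q (e 0))"
  shows "big X U (\<lambda>x. P x \<and> Q x) \<longleftrightarrow> big X U P \<and> big X U Q"
proof (intro iffI conjI)
  assume b: "big X U (\<lambda>x. P x \<and> Q x)"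
  show "big X U P" by (rule big_mono[OF assms(1,2) b]) blast
  show "big X U Q" by (rule big_mono[OF assms(1,3) b]) blast
next
  assume a: "big X U P \<and> big X U Q"
  obtain S where S: "S \<epsilon> U" "\<And>x. x \<epsilon> S \<Longrightarrow> P x \<and> x \<epsilon> X" using bigE a by metis
  obtain T where T: "T \<epsilon> U" "\<And>x. x \<epsilon> T \<Longrightarrow> Q x \<and> x \<epsilon> X" using bigE a by metis
  obtain R where R: "R \<epsilon> U" "ext R \<subseteq> ext S \<inter> ext T" using cc_inter[OF assms(1) S(1) T(1)] by blast
  show "big X U (\<lambda>x. P x \<and> Q x)"
  proof (rule bigI[OF assms(1) _ R(1)])
    show "df {UNIV} (\<lambda>A e. P (e 0) \<and> Q (e 0))" by (intro dfU assms)
    fix x assume "x \<epsilon> R"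
    then have "x \<epsilon> S" "x \<epsilon> T" using R(2) by (auto simp: subset_iff)
    then show "P x \<and> Q x" using S(2) T(2) by blast
  qed
qed

lemma big_not:
  assumes "cc_ultrafilter UNIV X U" "df {UNIV} (\<lambda>A e. P (e 0))"
  shows "big X U (\<lambda>x. \<not> P x) \<longleftrightarrow> \<not> big X U P"
proof
  assume "big X U (\<lambda>x. \<not> P x)"
  moreover have "df {UNIV} (\<lambda>A e. \<not> P (e 0))" by (intro dfU assms)
  ultimately have "\<not> big X U P \<or> big X U (\<lambda>x. P x \<and> \<not> P x)"
    using big_conj[of X U P "\<lambda>x. \<not> P x", OF assms] by blast
  then show "\<not> big X U P" using big_nonempty[OF assms(1), of "\<lambda>x. P x \<and> \<not> P x"] by blast
next
  assume n: "\<not> big X U P"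
  obtain T where T: "\<And>x. x \<epsilon> T \<longleftrightarrow> x \<epsilon> X \<and> P x" using sep_ex[of P X, OF assms(2)] by blast
  have TX: "ext T = {x \<in> ext X. P x}" by (intro set_eqI) (simp add: T)
  then have "T \<notin> ext U" using n unfolding big_def by blast
  then have "\<not> T \<epsilon> U" by simp
  moreover have "ext T \<subseteq> ext X" unfolding TX by blast
  ultimately obtain S where "S \<in> ext U" "ext S = ext X - ext T" using cc_compl[OF assms(1)] by blast
  moreover have "ext X - ext T = {x \<in> ext X. \<not> P x}" unfolding TX by blast
  ultimately show "big X U (\<lambda>x. \<not> P x)" unfolding big_def by blast
qed

lemma big_disj:
  assumes "cc_ultrafilter UNIV X U" "df {UNIV} (\<lambda>A e. P (e 0))" "df {UNIV} (\<lambda>A e. Q (e 0))"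
  shows "big X U (\<lambda>x. P x \<or> Q x) \<longleftrightarrow> big X U P \<or> big X U Q"
proof -
  have n: "df {UNIV} (\<lambda>A e. \<not> P (e 0))" "df {UNIV} (\<lambda>A e. \<not> Q (e 0))"
    "df {UNIV} (\<lambda>A e. P (e 0) \<or> Q (e 0))" by (intro dfU assms)+
  have "big X U (\<lambda>x. \<not> (P x \<or> Q x)) \<longleftrightarrow> \<not> big X U P \<and> \<not> big X U Q"
    unfolding de_Morgan_disj
    using big_conj[of X U "\<lambda>x. \<not> P x" "\<lambda>x. \<not> Q x", OF assms(1) n(1,2)] big_not[of X U P] big_not[of X U Q] assms
    by blast
  then show ?thesis using big_not[of X U "\<lambda>x. P x \<or> Q x", OF assms(1) n(3)] by blast
qed

lemma big_countable:
  assumes cc: "cc_ultrafilter UNIV X U" and d: "df {UNIV} (\<lambda>A e. R (e 0) (e 1))"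
    and R: "\<And>n. natural n \<Longrightarrow> big X U (R n)"
  shows "big X U (\<lambda>x. \<forall>n. natural n \<longrightarrow> R n x)"
proof -
  let ?R = "\<lambda>n S. \<forall>x\<in>ext S. R n x"
  note dR = df2[where R = "\<lambda>A. R", OF d]
  have d': "df {UNIV} (\<lambda>A e. ?R (e 0) (e 1))" by (intro dfU dR)
  have "\<exists>S. S \<epsilon> U \<and> ?R n S" if "natural n" for n
    using bigE[OF R[OF that]] unfolding Ball_def mem_ext by metis
  from cc_countable_rel[OF cc, of ?R, OF d' this] obtain T where T: "T \<epsilon> U"
    "\<And>x n. x \<epsilon> T \<Longrightarrow> natural n \<Longrightarrow> \<exists>S. S \<epsilon> U \<and> ?R n S \<and> x \<epsilon> S" by blast
  show ?thesis
  proof (rule bigI[OF cc _ T(1)])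
    show "df {UNIV} (\<lambda>A e. \<forall>n. natural n \<longrightarrow> R n (e 0))" by (intro dfU dR)
    fix x assume "x \<epsilon> T"
    then show "\<forall>n. natural n \<longrightarrow> R n x" using T(2)[of x] unfolding Ball_def mem_ext by blast
  qed
qed

text \<open>Satisfaction for all formulas at once is not definable in the model. For each fixed
  \<open>p\<close> it is, by \<open>p\<close> itself with the terms substituted; the recursion on
  \<open>p\<close> takes place in HOL.\<close>

lemma df_satR_subst:
  "(\<And>i. tm {UNIV} (t i)) \<Longrightarrow> df {UNIV} (\<lambda>A e. satR E UNIV (\<lambda>i. t i A e) p)"
proof (induction p arbitrary: t)
  case (Ex i p)
  have "df {UNIV} (\<lambda>A e. satR E UNIV (\<lambda>j. if j = i then e 0 else t j A (\<lambda>n. e (Suc n))) p)"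
  proof -
    have "tm {UNIV} (\<lambda>A e. if j = i then e 0 else t j A (\<lambda>n. e (Suc n)))" for j
      using tm_ren[OF Ex.prems[of j], of Suc] tm_var by (cases "j = i") simp_all
    from Ex.IH[of "\<lambda>j A e. if j = i then e 0 else t j A (\<lambda>n. e (Suc n))", OF this] show ?thesis .
  qed
  then have "df {UNIV} (\<lambda>A e. \<exists>x. satR E UNIV (\<lambda>j. if j = i then x else t j A e) p)"
    by (rule df_exU)
  then show ?case by (simp add: fun_upd_def)
qed (auto intro!: df_mem df_eq df_not df_and)

end

section \<open>The ultrapower of the universe and the theorem of Los\<close>

locale ultra = zfc E for E :: "'v \<Rightarrow> 'v \<Rightarrow> bool" (infix "\<epsilon>" 50) +
  fixes X U :: 'v and c :: "'v \<Rightarrow> 'v"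
  assumes cc: "cc_ultrafilter UNIV X U" and cm: "Defs.collapse_map E UNIV X U c"
begin

definition "M = c ` functions_on UNIV X"

lemma functions_on_iff [simp]: "f \<in> functions_on UNIV X \<longleftrightarrow> func f (ext X)"
  unfolding Defs.functions_on_def by simp

lemma c_eq:
  assumes "func f (ext X)" "func g (ext X)"
  shows "c f = c g \<longleftrightarrow> big X U (\<lambda>x. appd f x = appd g x)"
proof -
  have "c f = c g \<longleftrightarrow> eq_mod X U f g" using cm assms unfolding Defs.collapse_map_def by simp
  also have "\<dots> \<longleftrightarrow> big X U (\<lambda>x. appd f x = appd g x)" unfolding eq_mod_big
    by (rule big_cong) (simp add: appd_eq[OF assms(1)] appd_eq[OF assms(2)])
  finally show ?thesis .
qed

lemma c_mem0:
  assumes "func g (ext X)"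
  shows "y \<epsilon> c g \<longleftrightarrow> (\<exists>f. func f (ext X) \<and> y = c f \<and> big X U (\<lambda>x. appd f x \<epsilon> appd g x))"
proof -
  have "ext (c g) = c ` {f \<in> functions_on UNIV X. mem_mod X U f g}"
    using cm assms unfolding Defs.collapse_map_def by simp
  then have "y \<epsilon> c g \<longleftrightarrow> y \<in> c ` {f \<in> functions_on UNIV X. mem_mod X U f g}"
    using mem_ext[of y "c g"] by simp
  also have "\<dots> \<longleftrightarrow> (\<exists>f. func f (ext X) \<and> y = c f \<and> mem_mod X U f g)" by auto
  also have "\<dots> \<longleftrightarrow> (\<exists>f. func f (ext X) \<and> y = c f \<and> big X U (\<lambda>x. appd f x \<epsilon> appd g x))"
  proof -
    have "mem_mod X U f g \<longleftrightarrow> big X U (\<lambda>x. appd f x \<epsilon> appd g x)" if "func f (ext X)" for f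
      unfolding mem_mod_big by (rule big_cong) (simp add: appd_eq[OF assms] appd_eq[OF that])
    then show ?thesis by blast
  qed
  finally show ?thesis .
qed

text \<open>\<open>collapse_map\<close> only says that an element of \<open>c g\<close> has some
  representative below \<open>g\<close>. It is exchanged for the given \<open>f\<close>, which
  agrees with it almost everywhere.\<close>

lemma c_mem:
  assumes f: "func f (ext X)" and g: "func g (ext X)"
  shows "c f \<epsilon> c g \<longleftrightarrow> big X U (\<lambda>x. appd f x \<epsilon> appd g x)"
proof
  assume "c f \<epsilon> c g"
  then obtain h where h: "func h (ext X)" "c f = c h" "big X U (\<lambda>x. appd h x \<epsilon> appd g x)"
    unfolding c_mem0[OF g] by blast
  have d: "df {UNIV} (\<lambda>A e. appd f (e 0) = appd h (e 0))" "df {UNIV} (\<lambda>A e. appd h (e 0) \<epsilon> appd g (e 0))"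
    "df {UNIV} (\<lambda>A e. appd f (e 0) \<epsilon> appd g (e 0))"
    by (intro dfU)+
  have "big X U (\<lambda>x. appd f x = appd h x \<and> appd h x \<epsilon> appd g x)"
    using big_conj[of X U "\<lambda>x. appd f x = appd h x" "\<lambda>x. appd h x \<epsilon> appd g x", OF cc d(1,2)] h c_eq[OF f h(1)] by blast
  then show "big X U (\<lambda>x. appd f x \<epsilon> appd g x)" by (rule big_mono[OF cc d(3)]) simp
next
  assume "big X U (\<lambda>x. appd f x \<epsilon> appd g x)"
  then show "c f \<epsilon> c g" unfolding c_mem0[OF g] using f by blast
qed

lemma M_iff: "y \<in> M \<longleftrightarrow> (\<exists>f. func f (ext X) \<and> y = c f)"
  unfolding M_def by auto

lemma Los:
  assumes "\<And>i. func (e i) (ext X)"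
  shows "satR E M (\<lambda>i. c (e i)) p \<longleftrightarrow> big X U (\<lambda>x. satR E UNIV (\<lambda>i. appd (e i) x) p)"
  using assms
proof (induction p arbitrary: e)
  case (Mem i j)
  then show ?case using c_mem[of "e i" "e j"] by simp
next
  case (Equal i j)
  then show ?case using c_eq[of "e i" "e j"] by simp
next
  case (Neg p)
  have "df {UNIV} (\<lambda>A e'. satR E UNIV (\<lambda>i. appd (e i) (e' 0)) p)"
    by (rule df_satR_subst) (intro dfU)
  from big_not[of X U "\<lambda>x. satR E UNIV (\<lambda>i. appd (e i) x) p", OF cc this] Neg
  show ?case by simp
next
  case (Conj p q)
  have "df {UNIV} (\<lambda>A e'. satR E UNIV (\<lambda>i. appd (e i) (e' 0)) p)" for p
    by (rule df_satR_subst) (intro dfU)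
  from big_conj[of X U "\<lambda>x. satR E UNIV (\<lambda>i. appd (e i) x) p" "\<lambda>x. satR E UNIV (\<lambda>i. appd (e i) x) q", OF cc this this]
    Conj
  show ?case by simp
next
  case (Ex k p)
  let ?P = "\<lambda>x y. satR E UNIV ((\<lambda>i. appd (e i) x)(k := y)) p"
  have d: "df {UNIV} (\<lambda>A e'. ?P (e' 0) (e' 1))"
  proof -
    have "tm {UNIV} (\<lambda>A e'. if i = k then e' 1 else appd (e i) (e' 0))" for i
      by (cases "i = k") (simp_all, (intro dfU)+)
    from df_satR_subst[of "\<lambda>i A e'. if i = k then e' 1 else appd (e i) (e' 0)", OF this]
    show ?thesis unfolding fun_upd_def .
  qed
  note dP = df2[where R = "\<lambda>A. ?P", OF d]
  have step: "satR E M ((\<lambda>i. c (e i))(k := c f)) p \<longleftrightarrow> big X U (\<lambda>x. ?P x (appd f x))"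
    if "func f (ext X)" for f
  proof -
    have 1: "(\<lambda>i. c (e i))(k := c f) = (\<lambda>i. c ((e(k := f)) i))"
      and 2: "(\<lambda>i. appd (e i) x)(k := appd f x) = (\<lambda>i. appd ((e(k := f)) i) x)" for x
      by (auto simp: fun_eq_iff)
    show ?thesis unfolding 1 2 by (rule Ex.IH) (use Ex.prems that in simp)
  qed
  have dE: "df {UNIV} (\<lambda>A e'. \<exists>y. ?P (e' 0) y)" by (rule df_exU, rule dP) (intro dfU)+
  have "satR E M (\<lambda>i. c (e i)) (fm.Ex k p) \<longleftrightarrow>
      (\<exists>f. func f (ext X) \<and> satR E M ((\<lambda>i. c (e i))(k := c f)) p)"
    unfolding satR.simps Bex_def M_iff by blast
  also have "\<dots> \<longleftrightarrow> (\<exists>f. func f (ext X) \<and> big X U (\<lambda>x. ?P x (appd f x)))"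
    using step by (intro arg_cong[where f = HOL.Ex] ext conj_cong refl) blast
  also have "\<dots> \<longleftrightarrow> big X U (\<lambda>x. \<exists>y. ?P x y)"
  proof
    assume "\<exists>f. func f (ext X) \<and> big X U (\<lambda>x. ?P x (appd f x))"
    then obtain f where "big X U (\<lambda>x. ?P x (appd f x))" by blast
    then show "big X U (\<lambda>x. \<exists>y. ?P x y)" by (rule big_mono[OF cc dE]) blast
  next
    assume b: "big X U (\<lambda>x. \<exists>y. ?P x y)"
    \<comment> \<open>Points without a witness lie outside the large set, but \<open>choice\<close>
      needs a total relation on \<open>X\<close>; there any value is allowed.\<close>
    let ?Q = "\<lambda>x y. ?P x y \<or> \<not> (\<exists>z. ?P x z)"
    have "df {UNIV} (\<lambda>A e'. ?Q (e' 0) (e' 1))"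
    proof (rule df_or, rule d, rule df_not, rule df_exU, rule dP)
    qed (intro dfU)+
    then have "\<exists>f. func f (ext X) \<and> (\<forall>x\<in>ext X. ?Q x (app f x))" by (rule choice) blast
    then obtain f where f: "func f (ext X)" "\<forall>x\<in>ext X. ?Q x (app f x)" by blast
    have "big X U (\<lambda>x. ?P x (appd f x))"
    proof (rule big_mono[OF cc _ b])
      show "df {UNIV} (\<lambda>A e'. ?P (e' 0) (appd f (e' 0)))" by (rule dP) (intro dfU)+
      fix x assume "x \<epsilon> X" "\<exists>y. ?P x y"
      then show "?P x (appd f x)" using f(2) appd_eq[OF f(1), of x] by auto
    qed
    with f(1) show "\<exists>f. func f (ext X) \<and> big X U (\<lambda>x. ?P x (appd f x))" by blast
  qed
  finally show ?case by simp
qed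

definition "cst a = lam X (\<lambda>_. a)"

lemma cst: "func (cst a) (ext X)" "x \<epsilon> X \<Longrightarrow> appd (cst a) x = a"
proof -
  have t: "tm {UNIV} (\<lambda>A e. a)" by (rule tm_constU)
  show 1: "func (cst a) (ext X)" unfolding cst_def by (rule func_lam[OF t])
  show "appd (cst a) x = a" if "x \<epsilon> X"
    using appd_eq[OF 1, of x] func_lam(2)[OF t that] that unfolding cst_def by simp
qed

text \<open>\<open>zero\<close> is the only parameter of a formula that is uniform over all classes.
  It has to be fixed by the embedding for such a formula to be transferred unchanged.\<close>

lemma c_zero: "c (cst zero) = zero"
proof (rule ext_eqI)
  fix y
  have "\<not> y \<epsilon> c (cst zero)"
  proof
    assume "y \<epsilon> c (cst zero)"
    then obtain f where "big X U (\<lambda>x. appd f x \<epsilon> appd (cst zero) x)" unfolding c_mem0[OF cst(1)] by blast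
    then show False using big_nonempty[OF cc] cst(2)[of _ zero] mem_zero by fastforce
  qed
  then show "y \<epsilon> c (cst zero) \<longleftrightarrow> y \<epsilon> zero" by simp
qed

lemma M_trans: "x \<in> M \<Longrightarrow> y \<epsilon> x \<Longrightarrow> y \<in> M"
proof -
  assume "x \<in> M" "y \<epsilon> x"
  then obtain g where g: "func g (ext X)" "y \<epsilon> c g" unfolding M_iff by blast
  then show ?thesis using c_mem0[OF g(1), of y] unfolding M_iff by blast
qed

text \<open>The successor of a class is represented by the pointwise successor. This is the
  induction step for showing that \<open>M\<close> contains all natural numbers.\<close>

lemma M_suc: assumes "k \<in> M" shows "suc k \<in> M"
proof -
  obtain f where f: "func f (ext X)" "k = c f" using assms unfolding M_iff by blast
  let ?g = "lam X (\<lambda>x. suc (appd f x))"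
  have t: "tm {UNIV} (\<lambda>A e. suc (appd f (e 0)))" by (intro dfU)
  have g: "func ?g (ext X)" "x \<epsilon> X \<Longrightarrow> appd ?g x = suc (appd f x)" for x
  proof -
    show 1: "func ?g (ext X)" by (rule func_lam[OF t])
    show "x \<epsilon> X \<Longrightarrow> appd ?g x = suc (appd f x)"
      using appd_eq[OF 1, of x] func_lam(2)[OF t, of x] by simp
  qed
  have "y \<epsilon> c ?g \<longleftrightarrow> y \<epsilon> suc k" if y: "y \<in> M" for y
  proof -
    obtain h where h: "func h (ext X)" "y = c h" using y unfolding M_iff by blast
    have d: "df {UNIV} (\<lambda>A e. appd h (e 0) = appd f (e 0))" "df {UNIV} (\<lambda>A e. appd h (e 0) \<epsilon> appd f (e 0))"
      by (intro dfU)+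
    have "y \<epsilon> c ?g \<longleftrightarrow> big X U (\<lambda>x. appd h x \<epsilon> appd ?g x)" unfolding h(2) by (rule c_mem[OF h(1) g(1)])
    also have "\<dots> \<longleftrightarrow> big X U (\<lambda>x. appd h x = appd f x \<or> appd h x \<epsilon> appd f x)"
      by (rule big_cong) (simp add: g(2))
    also have "\<dots> \<longleftrightarrow> y = k \<or> y \<epsilon> k"
      using big_disj[of X U "\<lambda>x. appd h x = appd f x" "\<lambda>x. appd h x \<epsilon> appd f x", OF cc d]
        c_eq[OF h(1) f(1)] c_mem[OF h(1) f(1)] unfolding h(2) f(2) by blast
    finally show ?thesis by simp
  qed
  moreover have cg: "c ?g \<in> M" using g(1) unfolding M_iff by blast
  ultimately have "y \<epsilon> c ?g \<longleftrightarrow> y \<epsilon> suc k" for y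
    using M_trans[OF cg, of y] M_trans[OF assms, of y] assms unfolding mem_suc by blast
  then have "c ?g = suc k" by (rule ext_eqI)
  with cg show ?thesis by simp
qed

text \<open>The definability of \<open>c\<close>, part of \<open>collapse_map\<close>, makes
  \<open>M\<close> a definable class, so that membership in \<open>M\<close> is open to induction on
  the natural numbers of the model.\<close>

lemma df_M: "df {UNIV} (\<lambda>A e. e 0 \<in> M)"
proof -
  have "definable E (\<lambda>f y. f \<in> functions_on UNIV X \<and> y = c f)"
    using cm unfolding Defs.collapse_map_def by blast
  from df_definable[OF this] have "df {UNIV} (\<lambda>A e. func (e 0) (ext X) \<and> e 1 = c (e 0))" by simp
  note dfx = df2[where R = "\<lambda>A f y. func f (ext X) \<and> y = c f", OF this]
  show ?thesis unfolding M_iff by (rule df_exU, rule dfx) (intro dfU)+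
qed

lemma good_M: "good M"
proof -
  have "n \<in> M" if "natural n" for n
  proof (rule natural_induct[where P = "\<lambda>n. n \<in> M", OF that])
    show "zero \<in> M" unfolding M_iff using cst(1)[of zero] c_zero by metis
  qed (simp_all add: M_suc df_M)
  then show ?thesis unfolding good_def using M_trans by auto
qed

text \<open>One formula defines \<open>P\<close> both over \<open>M\<close> and over the universe,
  so \<open>Los\<close> compares the two readings. Its parameters are all \<open>zero\<close>,
  represented by constant functions.\<close>

lemma los_df:
  assumes "df UNIV P" "\<And>i. func (e i) (ext X)"
  shows "P M (\<lambda>i. c (e i)) \<longleftrightarrow> big X U (\<lambda>x. P UNIV (\<lambda>i. appd (e i) x))"
proof (rule dfE[OF assms(1)])
  fix p e0
  assume p: "\<And>A e. A \<in> UNIV \<Longrightarrow> good A \<Longrightarrow> range e \<subseteq> A \<Longrightarrow> P A e = satR E A (merge e e0) p"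
    and "UNIV = {UNIV :: 'v set} \<or> range e0 \<subseteq> {zero}"
  \<comment> \<open>In \<open>df UNIV\<close> the symbol stands for the collection of all classes,
    which is more than the one class \<open>UNIV\<close>. So the alternative that would allow
    arbitrary parameters is excluded.\<close>
  moreover have "UNIV \<noteq> {UNIV :: 'v set}" by (metis UNIV_I empty_not_UNIV singletonD)
  ultimately have "range e0 \<subseteq> {zero}" by blast
  then have e0: "e0 i = zero" for i by blast
  let ?e = "merge e (\<lambda>_. cst zero)"
  have f: "func (?e i) (ext X)" for i using assms(2) cst(1) by (simp add: merge_def)
  have "range (\<lambda>i. c (e i)) \<subseteq> M" using assms(2) unfolding M_def by auto
  from p[OF _ good_M this] have "P M (\<lambda>i. c (e i)) = satR E M (merge (\<lambda>i. c (e i)) e0) p" by simp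
  also have "merge (\<lambda>i. c (e i)) e0 = (\<lambda>i. c (?e i))"
    by (auto simp: merge_def e0 c_zero fun_eq_iff)
  also have "satR E M (\<lambda>i. c (?e i)) p \<longleftrightarrow> big X U (\<lambda>x. satR E UNIV (\<lambda>i. appd (?e i) x) p)"
    by (rule Los) (rule f)
  also have "\<dots> \<longleftrightarrow> big X U (\<lambda>x. P UNIV (\<lambda>i. appd (e i) x))"
  proof (rule big_cong)
    fix x assume x: "x \<epsilon> X"
    have "(\<lambda>i. appd (?e i) x) = merge (\<lambda>i. appd (e i) x) e0"
      using cst(2)[OF x] by (auto simp: merge_def e0 fun_eq_iff)
    then show "satR E UNIV (\<lambda>i. appd (?e i) x) p = P UNIV (\<lambda>i. appd (e i) x)"
      using p[of UNIV "\<lambda>i. appd (e i) x"] by simp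
  qed
  finally show ?thesis .
qed

theorem transfer:
  assumes "df UNIV P" "\<And>e. P UNIV e" "range e \<subseteq> M" shows "P M e"
proof -
  have "\<forall>i. \<exists>f. func f (ext X) \<and> e i = c f" using assms(3) M_iff by blast
  then obtain F where F: "\<And>i. func (F i) (ext X)" "\<And>i. e i = c (F i)" by metis
  have "big X U (\<lambda>x. P UNIV (\<lambda>i. appd (F i) x))"
    unfolding big_def using assms(2) cc_top[OF cc] by (intro bexI[of _ X]) auto
  then have "P M (\<lambda>i. c (F i))" using los_df[of P F, OF assms(1) F(1)] by blast
  moreover have "(\<lambda>i. c (F i)) = e" using F(2) by auto
  ultimately show ?thesis by simp
qed

end

section \<open>Internal ultrafilters of an ultrapower\<close>

context zfc
begin

text \<open>The equation of classes in \<open>big\<close> becomes bounded quantification, which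
  means the same in every good class.\<close>

lemma big_exact:
  "big X U P \<longleftrightarrow> (\<exists>S\<in>ext U. (\<forall>x\<in>ext S. x \<epsilon> X \<and> P x) \<and> (\<forall>x\<in>ext X. P x \<longrightarrow> x \<epsilon> S))"
proof -
  have "ext S = {x \<in> ext X. P x} \<longleftrightarrow> (\<forall>x\<in>ext S. x \<epsilon> X \<and> P x) \<and> (\<forall>x\<in>ext X. P x \<longrightarrow> x \<epsilon> S)" for S
    unfolding set_eq_iff mem_Collect_eq Ball_def mem_ext by blast
  then show ?thesis unfolding big_def by blast
qed

lemma df_big:
  assumes "tm G X" "tm G U" "df G (\<lambda>A e. P A (e 0) (\<lambda>n. e (Suc n)))"
  shows "df G (\<lambda>A e. big (X A e) (U A e) (\<lambda>x. P A x e))"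
proof -
  have P: "df G (\<lambda>A e. P A (e 0) (\<lambda>n. e (Suc (Suc n))))"
    using df_ren[OF assms(3), of "\<lambda>n. if n = 0 then 0 else Suc n"] by simp
  have X: "tm G (\<lambda>A e. X A (\<lambda>n. e (Suc n)))" "tm G (\<lambda>A e. X A (\<lambda>n. e (Suc (Suc n))))"
    using tm_ren[OF assms(1), of Suc] tm_ren[OF assms(1), of "\<lambda>n. Suc (Suc n)"] .
  show ?thesis unfolding big_exact
    by (intro df_Bex assms(2) df_and df_Ball df_imp df_mem tm_var X P)
qed

lemma finset_less_iff:
  "finset_less a b \<longleftrightarrow> (\<exists>m\<in>ext b. \<not> m \<epsilon> a \<and> (\<forall>z\<in>ext a. \<not> z \<epsilon> b \<longrightarrow> z = m \<or> z \<epsilon> m) \<and>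
     (\<forall>z\<in>ext b. \<not> z \<epsilon> a \<longrightarrow> z = m \<or> z \<epsilon> m))"
  unfolding Defs.finset_less_def Bex_def Ball_def Un_iff Diff_iff mem_ext by blast

lemma df_finset_less0: "df G (\<lambda>A e. finset_less (e 0) (e 1))"
  unfolding finset_less_iff by (intro df_intros)

lemmas df_finset_less = df2[where R = "\<lambda>A. finset_less", OF df_finset_less0]

text \<open>The domain is a class and not a term. Quantifiers over \<open>A\<close> do instead: a
  good class contains all natural numbers, and the values of a function in \<open>A\<close> lie in
  \<open>A\<close>.\<close>

lemma df_funcN0: "df G (\<lambda>A e. func (e 0) {n. natural n})"
proof -
  have "df G (\<lambda>A e. (\<forall>p\<in>ext (e 0). \<exists>x\<in>A. natural x \<and> (\<exists>y\<in>A. p = pr x y)) \<and>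
     (\<forall>x\<in>A. natural x \<longrightarrow> (\<exists>!y. pr x y \<epsilon> e 0)))"
    by (intro df_intros df_natural df_eq_pr df2[where R = "\<lambda>A f x. \<exists>!y. pr x y \<epsilon> f", OF df_uniq0])
  then show ?thesis
  proof (rule df_cong)
    fix A and e :: "nat \<Rightarrow> 'v" assume A: "good A" "range e \<subseteq> A"
    then have "e 0 \<in> A" by blast
    then have y: "y \<in> A" if "pr x y \<epsilon> e 0" for x y
      using good_pr[OF A(1) good_mem[OF A(1) _ that]] by blast
    show "func (e 0) {n. natural n} = ((\<forall>p\<in>ext (e 0). \<exists>x\<in>A. natural x \<and> (\<exists>y\<in>A. p = pr x y)) \<and>
     (\<forall>x\<in>A. natural x \<longrightarrow> (\<exists>!y. pr x y \<epsilon> e 0)))" (is "_ = ?R")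
    proof
      assume f: "func (e 0) {n. natural n}"
      have "\<exists>x\<in>A. natural x \<and> (\<exists>y\<in>A. p = pr x y)" if "p \<in> ext (e 0)" for p
      proof -
        obtain x y where xy: "natural x" "p = pr x y" using f \<open>p \<in> ext (e 0)\<close> unfolding func_iff mem_ext by blast
        then show ?thesis using y[of x y] good_natural[OF A(1) xy(1)] that unfolding mem_ext by blast
      qed
      then show ?R using f unfolding func_iff by blast
    next
      assume R: ?R
      show "func (e 0) {n. natural n}" unfolding func_iff
        using R good_natural[OF A(1)] unfolding Ball_def mem_ext by blast
    qed
  qed
qed

lemmas df_funcN = df1[where R = "\<lambda>A f. func f {n. natural n}", OF df_funcN0]

text \<open>In this form a single formula can be read off for all good classes: quantifiers are
  bounded or range over \<open>A\<close>, and \<open>app\<close> gives way to \<open>appd\<close>.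
  The equation \<open>y = y\<close> merely turns nonemptiness into a bounded quantifier.\<close>

lemma cc_ultrafilter_iff:
  assumes A: "good A" and "X \<in> A" "U \<in> A"
  shows "cc_ultrafilter A X U \<longleftrightarrow>
     (\<forall>S\<in>ext U. ext S \<subseteq> ext X \<and> (\<exists>y\<in>ext S. y = y)) \<and> X \<epsilon> U \<and>
     (\<forall>S\<in>ext U. \<forall>T\<in>A. ext S \<subseteq> ext T \<and> ext T \<subseteq> ext X \<longrightarrow> T \<epsilon> U) \<and>
     (\<forall>S\<in>A. ext S \<subseteq> ext X \<longrightarrow> S \<epsilon> U \<or> big X U (\<lambda>x. \<not> x \<epsilon> S)) \<and>
     (\<forall>f\<in>A. func f {n. natural n} \<and> (\<forall>n\<in>A. natural n \<longrightarrow> appd f n \<epsilon> U) \<longrightarrow>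
        big X U (\<lambda>x. \<forall>n\<in>A. natural n \<longrightarrow> x \<epsilon> appd f n))" (is "_ = ?R")
proof -
  have ne: "(\<exists>y\<in>S. y = y) \<longleftrightarrow> S \<noteq> {}" for S :: "'v set" by blast
  have compl: "(\<exists>T\<in>ext U. ext T = ext X - ext S) \<longleftrightarrow> big X U (\<lambda>x. \<not> x \<epsilon> S)" for S
  proof -
    have "ext X - ext S = {x \<in> ext X. \<not> x \<epsilon> S}" by auto
    then show ?thesis unfolding big_def by (simp only:)
  qed
  have nat: "(\<forall>n\<in>A. natural n \<longrightarrow> Q n) \<longleftrightarrow> (\<forall>n. natural n \<longrightarrow> Q n)" for Q
    using good_natural[OF A] by blast
  have ct: "(func f {n. natural n} \<and> (\<forall>n. natural n \<longrightarrow> app f n \<epsilon> U) \<longrightarrow>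
        (\<exists>T\<in>ext U. ext T = {x \<in> ext X. \<forall>n. natural n \<longrightarrow> x \<epsilon> app f n})) \<longleftrightarrow>
     (func f {n. natural n} \<and> (\<forall>n\<in>A. natural n \<longrightarrow> appd f n \<epsilon> U) \<longrightarrow>
        big X U (\<lambda>x. \<forall>n\<in>A. natural n \<longrightarrow> x \<epsilon> appd f n))" for f
  proof (cases "func f {n. natural n}")
    case True
    then have a: "app f n = appd f n" if "natural n" for n using appd_eq[OF True, of n] that by simp
    have e: "(\<forall>n. natural n \<longrightarrow> app f n \<epsilon> U) \<longleftrightarrow> (\<forall>n. natural n \<longrightarrow> appd f n \<epsilon> U)"
      "(\<forall>n. natural n \<longrightarrow> x \<epsilon> app f n) \<longleftrightarrow> (\<forall>n. natural n \<longrightarrow> x \<epsilon> appd f n)" for x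
      using a by metis+
    show ?thesis unfolding nat big_def e by (rule refl)
  qed blast
  show ?thesis unfolding Defs.cc_ultrafilter_def ne ct compl using assms(2,3) by blast
qed

lemma df_cc0: "df G (\<lambda>A e. cc_ultrafilter A (e 0) (e 1))"
proof (rule df_cong)
  fix A and e :: "nat \<Rightarrow> 'v" assume "A \<in> G" "good A" "range e \<subseteq> A"
  then have "e 0 \<in> A" "e 1 \<in> A" by blast+
  with \<open>good A\<close> show "cc_ultrafilter A (e 0) (e 1) =
     ((\<forall>S\<in>ext (e 1). ext S \<subseteq> ext (e 0) \<and> (\<exists>y\<in>ext S. y = y)) \<and> e 0 \<epsilon> e 1 \<and>
     (\<forall>S\<in>ext (e 1). \<forall>T\<in>A. ext S \<subseteq> ext T \<and> ext T \<subseteq> ext (e 0) \<longrightarrow> T \<epsilon> e 1) \<and>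
     (\<forall>S\<in>A. ext S \<subseteq> ext (e 0) \<longrightarrow> S \<epsilon> e 1 \<or> big (e 0) (e 1) (\<lambda>x. \<not> x \<epsilon> S)) \<and>
     (\<forall>f\<in>A. func f {n. natural n} \<and> (\<forall>n\<in>A. natural n \<longrightarrow> appd f n \<epsilon> e 1) \<longrightarrow>
        big (e 0) (e 1) (\<lambda>x. \<forall>n\<in>A. natural n \<longrightarrow> x \<epsilon> appd f n)))"
    by (rule cc_ultrafilter_iff)
qed (intro df_intros df_big df_natural df_funcN tm_appd)

lemmas df_cc = df2[where R = "\<lambda>A. cc_ultrafilter A", OF df_cc0]

lemmas dfA = df_intros df_big df_natural df_func df_cc df_finset_less tm_appd

section \<open>Facts about ultrafilters that are transferred to the ultrapower\<close>

lemma big_subst_elem: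
  assumes "cc_ultrafilter UNIV X U" "big X U (\<lambda>x. appd f x = appd f' x)"
    "big X U (\<lambda>x. appd f' x \<epsilon> appd g x)"
  shows "big X U (\<lambda>x. appd f x \<epsilon> appd g x)"
proof -
  have d: "df {UNIV} (\<lambda>A e. appd f (e 0) = appd f' (e 0))"
    "df {UNIV} (\<lambda>A e. appd f' (e 0) \<epsilon> appd g (e 0))" "df {UNIV} (\<lambda>A e. appd f (e 0) \<epsilon> appd g (e 0))"
    by (intro dfU)+
  have "big X U (\<lambda>x. appd f x = appd f' x \<and> appd f' x \<epsilon> appd g x)"
    using big_conj[of X U "\<lambda>x. appd f x = appd f' x", OF assms(1) d(1,2)] assms(2,3) by blast
  then show ?thesis by (rule big_mono[OF assms(1) d(3)]) simp
qed

lemma const_func_ex: "\<exists>f. func f (ext X) \<and> (\<forall>x\<in>ext X. appd f x = a)"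
proof -
  have t: "tm {UNIV} (\<lambda>A e. a)" by (rule tm_constU)
  have "appd (lam X (\<lambda>_. a)) x = a" if "x \<in> ext X" for x
    using appd_eq[OF func_lam(1)[OF t] that] func_lam(2)[OF t, of x X] that by simp
  then show ?thesis using func_lam(1)[OF t, of X] by blast
qed

text \<open>This is Los for \<open>finset_less\<close>, phrased with functions alone:
  \<open>h\<close> represents the largest element of the symmetric difference. If the conclusion
  failed, one could choose, almost everywhere, an element of the pointwise symmetric difference that
  is neither \<open>h x\<close> nor below it; the resulting function would contradict the assumption
  on all \<open>z\<close>.\<close>

lemma big_finset_less:
  assumes cc: "cc_ultrafilter UNIV X U"
    and h: "big X U (\<lambda>x. appd h x \<epsilon> appd k x)" "\<not> big X U (\<lambda>x. appd h x \<epsilon> appd g x)"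
    and z: "\<And>z. func z (ext X) \<Longrightarrow>
      big X U (\<lambda>x. appd z x \<epsilon> appd g x) \<and> \<not> big X U (\<lambda>x. appd z x \<epsilon> appd k x) \<or>
      big X U (\<lambda>x. appd z x \<epsilon> appd k x) \<and> \<not> big X U (\<lambda>x. appd z x \<epsilon> appd g x) \<Longrightarrow>
      big X U (\<lambda>x. appd z x = appd h x) \<or> big X U (\<lambda>x. appd z x \<epsilon> appd h x)"
  shows "big X U (\<lambda>x. finset_less (appd g x) (appd k x))"
proof (rule ccontr)
  let ?D = "\<lambda>x y. (y \<epsilon> appd g x \<and> \<not> y \<epsilon> appd k x \<or> y \<epsilon> appd k x \<and> \<not> y \<epsilon> appd g x) \<and>
    \<not> (y = appd h x \<or> y \<epsilon> appd h x)"
  let ?C = "\<lambda>x y. ?D x y \<or> \<not> (\<exists>y. ?D x y)"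
  assume n: "\<not> big X U (\<lambda>x. finset_less (appd g x) (appd k x))"
  have dm: "df {UNIV} (\<lambda>A e. appd f (e 0) \<epsilon> appd f' (e 0))" for f f' by (intro dfU)
  have dn: "df {UNIV} (\<lambda>A e. \<not> appd f (e 0) \<epsilon> appd f' (e 0))" for f f' by (intro dfU)
  have deq: "df {UNIV} (\<lambda>A e. appd f (e 0) = appd f' (e 0))" for f f' by (intro dfU)
  have dl: "df {UNIV} (\<lambda>A e. finset_less (appd g (e 0)) (appd k (e 0)))" by (intro dfU df_finset_less)
  have dC: "df {UNIV} (\<lambda>A e. ?C (e 0) (e 1))" by (intro dfU)
  have "\<exists>z. func z (ext X) \<and> (\<forall>x\<in>ext X. ?C x (app z x))"
    by (rule choice[OF dC]) blast
  then obtain f where f: "func f (ext X)" "\<forall>x\<in>ext X. ?C x (app f x)" by blast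
  have b: "big X U (\<lambda>x. (appd h x \<epsilon> appd k x \<and> \<not> appd h x \<epsilon> appd g x) \<and> \<not> finset_less (appd g x) (appd k x))"
  proof -
    have d1: "df {UNIV} (\<lambda>A e. appd h (e 0) \<epsilon> appd k (e 0) \<and> \<not> appd h (e 0) \<epsilon> appd g (e 0))"
      and d2: "df {UNIV} (\<lambda>A e. \<not> finset_less (appd g (e 0)) (appd k (e 0)))"
      by (intro dfU df_finset_less)+
    show ?thesis
      using big_conj[of X U "\<lambda>x. appd h x \<epsilon> appd k x \<and> \<not> appd h x \<epsilon> appd g x", OF cc d1 d2]
        big_conj[of X U "\<lambda>x. appd h x \<epsilon> appd k x", OF cc dm dn]
        big_not[of X U "\<lambda>x. appd h x \<epsilon> appd g x", OF cc dm]
        big_not[of X U "\<lambda>x. finset_less (appd g x) (appd k x)", OF cc dl] h n by blast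
  qed
  have D: "big X U (\<lambda>x. ?D x (appd f x))"
  proof (rule big_mono[OF cc _ b])
    show "df {UNIV} (\<lambda>A e. ?D (e 0) (appd f (e 0)))" by (intro dfU)
    fix x assume x: "x \<epsilon> X"
      and l: "(appd h x \<epsilon> appd k x \<and> \<not> appd h x \<epsilon> appd g x) \<and> \<not> finset_less (appd g x) (appd k x)"
    then have "\<exists>y. ?D x y" unfolding finset_less_iff Bex_def Ball_def mem_ext by blast
    moreover have "?C x (appd f x)" using f(2) x appd_eq[OF f(1), of x] by (metis mem_ext)
    ultimately show "?D x (appd f x)" by blast
  qed
  have imp: "big X U P" if "df {UNIV} (\<lambda>A e. P (e 0))" "\<And>x. ?D x (appd f x) \<Longrightarrow> P x" for P
    by (rule big_mono[OF cc that(1) D]) (rule that(2))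
  have "big X U (\<lambda>x. appd f x \<epsilon> appd g x \<and> \<not> appd f x \<epsilon> appd k x \<or> appd f x \<epsilon> appd k x \<and> \<not> appd f x \<epsilon> appd g x)"
    by (rule imp) ((intro dfU)[1], blast)
  moreover have "df {UNIV} (\<lambda>A e. appd f (e 0) \<epsilon> appd g (e 0) \<and> \<not> appd f (e 0) \<epsilon> appd k (e 0))"
    "df {UNIV} (\<lambda>A e. appd f (e 0) \<epsilon> appd k (e 0) \<and> \<not> appd f (e 0) \<epsilon> appd g (e 0))" by (intro dfU)+
  ultimately have "big X U (\<lambda>x. appd f x \<epsilon> appd g x \<and> \<not> appd f x \<epsilon> appd k x) \<or>
      big X U (\<lambda>x. appd f x \<epsilon> appd k x \<and> \<not> appd f x \<epsilon> appd g x)"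
    using big_disj[of X U "\<lambda>x. appd f x \<epsilon> appd g x \<and> \<not> appd f x \<epsilon> appd k x"
      "\<lambda>x. appd f x \<epsilon> appd k x \<and> \<not> appd f x \<epsilon> appd g x", OF cc] by blast
  then have "big X U (\<lambda>x. appd f x \<epsilon> appd g x) \<and> \<not> big X U (\<lambda>x. appd f x \<epsilon> appd k x) \<or>
      big X U (\<lambda>x. appd f x \<epsilon> appd k x) \<and> \<not> big X U (\<lambda>x. appd f x \<epsilon> appd g x)"
    using big_conj[of X U "\<lambda>x. appd f x \<epsilon> appd g x" "\<lambda>x. \<not> appd f x \<epsilon> appd k x", OF cc dm dn]
      big_conj[of X U "\<lambda>x. appd f x \<epsilon> appd k x" "\<lambda>x. \<not> appd f x \<epsilon> appd g x", OF cc dm dn]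
      big_not[of X U "\<lambda>x. appd f x \<epsilon> appd k x", OF cc dm]
      big_not[of X U "\<lambda>x. appd f x \<epsilon> appd g x", OF cc dm] by blast
  from z[OF f(1) this] show False
  proof
    assume "big X U (\<lambda>x. appd f x = appd h x)"
    moreover have "big X U (\<lambda>x. \<not> appd f x = appd h x)"
      by (rule imp) ((intro dfU)[1], blast)
    ultimately show False using big_not[of X U "\<lambda>x. appd f x = appd h x", OF cc deq] by blast
  next
    assume "big X U (\<lambda>x. appd f x \<epsilon> appd h x)"
    moreover have "big X U (\<lambda>x. \<not> appd f x \<epsilon> appd h x)"
      by (rule imp) ((intro dfU)[1], blast)
    ultimately show False using big_not[of X U "\<lambda>x. appd f x \<epsilon> appd h x", OF cc dm] by blast
  qed
qed

text \<open>\<open>Z\<close> is the image of \<open>U\<close> under \<open>g\<close>, restricted to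
  subsets of \<open>D\<close>. Each clause of the definition reduces to the corresponding law for
  \<open>big\<close>.\<close>

lemma pushforward:
  assumes cc: "cc_ultrafilter UNIV X U" and gD: "big X U (\<lambda>x. appd g x \<epsilon> D)"
  shows "\<exists>Z. cc_ultrafilter UNIV D Z \<and> (\<forall>T. T \<epsilon> Z \<longleftrightarrow> ext T \<subseteq> ext D \<and> big X U (\<lambda>x. appd g x \<epsilon> T))"
proof -
  have dT: "df {UNIV} (\<lambda>A e. ext (e 0) \<subseteq> ext D \<and> big X U (\<lambda>x. appd g x \<epsilon> e 0))"
    by (intro dfU df_big)
  have dm: "df {UNIV} (\<lambda>A e. appd g (e 0) \<epsilon> T)" for T by (intro dfU)
  from sep_ex[of "\<lambda>T. ext T \<subseteq> ext D \<and> big X U (\<lambda>x. appd g x \<epsilon> T)" "setof {y. ext y \<subseteq> ext D}", OF dT]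
  obtain Z where "\<And>T. T \<epsilon> Z \<longleftrightarrow> T \<epsilon> setof {y. ext y \<subseteq> ext D} \<and> ext T \<subseteq> ext D \<and> big X U (\<lambda>x. appd g x \<epsilon> T)"
    by blast
  then have Z: "T \<epsilon> Z \<longleftrightarrow> ext T \<subseteq> ext D \<and> big X U (\<lambda>x. appd g x \<epsilon> T)" for T by simp
  have up: "T \<epsilon> Z" if "S \<epsilon> Z" "ext S \<subseteq> ext T" "ext T \<subseteq> ext D" for S T
  proof -
    have "big X U (\<lambda>x. appd g x \<epsilon> S)" using that(1) unfolding Z by blast
    then have "big X U (\<lambda>x. appd g x \<epsilon> T)"
      by (rule big_mono[OF cc dm]) (rule subextD[OF that(2)])
    then show ?thesis unfolding Z using that(3) by blast
  qed
  have "cc_ultrafilter UNIV D Z"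
    unfolding cc_ultrafilter_iff[OF good_UNIV UNIV_I UNIV_I]
  proof (intro conjI ballI impI)
    fix S assume "S \<in> ext Z"
    then have S: "ext S \<subseteq> ext D" "big X U (\<lambda>x. appd g x \<epsilon> S)" using Z by auto
    show "ext S \<subseteq> ext D" by (rule S(1))
    show "\<exists>y\<in>ext S. y = y" using big_nonempty[OF cc S(2)] by auto
  next
    show "D \<epsilon> Z" unfolding Z using gD by blast
  next
    fix S T assume "S \<in> ext Z" "ext S \<subseteq> ext T \<and> ext T \<subseteq> ext D"
    then show "T \<epsilon> Z" using up[of S T] by simp
  next
    fix S assume SD: "ext S \<subseteq> ext D"
    show "S \<epsilon> Z \<or> big D Z (\<lambda>x. \<not> x \<epsilon> S)"
    proof (cases "S \<epsilon> Z")
      case False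
      then have "big X U (\<lambda>x. \<not> appd g x \<epsilon> S)" using big_not[of X U "\<lambda>x. appd g x \<epsilon> S", OF cc dm] SD Z by blast
      moreover have dn: "df {UNIV} (\<lambda>A e. \<not> appd g (e 0) \<epsilon> S)" by (intro dfU)
      ultimately have b: "big X U (\<lambda>x. appd g x \<epsilon> D \<and> \<not> appd g x \<epsilon> S)"
        using big_conj[of X U "\<lambda>x. appd g x \<epsilon> D" "\<lambda>x. \<not> appd g x \<epsilon> S", OF cc dm dn] gD by blast
      have "df {UNIV} (\<lambda>A e. \<not> e 0 \<epsilon> S)" by (intro dfU)
      from sep_ex[of "\<lambda>a. \<not> a \<epsilon> S" D, OF this] obtain T where T: "\<And>a. a \<epsilon> T \<longleftrightarrow> a \<epsilon> D \<and> \<not> a \<epsilon> S" by blast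
      have TD: "ext T = {x \<in> ext D. \<not> x \<epsilon> S}" by (intro set_eqI) (simp add: T)
      have "big X U (\<lambda>x. appd g x \<epsilon> T)" using b unfolding T .
      moreover have "ext T \<subseteq> ext D" unfolding TD by blast
      ultimately have "T \<in> ext Z" unfolding mem_ext Z by blast
      then show ?thesis using TD unfolding big_def by blast
    qed blast
  next
    fix f assume f: "func f {n. natural n} \<and> (\<forall>n\<in>UNIV. natural n \<longrightarrow> appd f n \<epsilon> Z)"
    have dR: "df {UNIV} (\<lambda>A e. appd g (e 1) \<epsilon> appd f (e 0))" by (intro dfU)
    have b: "big X U (\<lambda>x. \<forall>n. natural n \<longrightarrow> appd g x \<epsilon> appd f n)"
      by (rule big_countable[OF cc dR]) (use f Z in blast)
    have dN: "df {UNIV} (\<lambda>A e. \<forall>n. natural n \<longrightarrow> appd g (e 0) \<epsilon> appd f n)" by (intro dfU)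
    have dN': "df {UNIV} (\<lambda>A e. \<forall>n\<in>UNIV. natural n \<longrightarrow> e 0 \<epsilon> appd f n)"
      unfolding ball_UNIV by (intro dfU)
    have b2: "big X U (\<lambda>x. appd g x \<epsilon> D \<and> (\<forall>n. natural n \<longrightarrow> appd g x \<epsilon> appd f n))"
      using big_conj[of X U "\<lambda>x. appd g x \<epsilon> D" "\<lambda>x. \<forall>n. natural n \<longrightarrow> appd g x \<epsilon> appd f n", OF cc dm dN] gD b
      by blast
    from sep_ex[of "\<lambda>a. \<forall>n\<in>UNIV. natural n \<longrightarrow> a \<epsilon> appd f n" D, OF dN']
    obtain T where T: "\<And>a. a \<epsilon> T \<longleftrightarrow> a \<epsilon> D \<and> (\<forall>n\<in>UNIV. natural n \<longrightarrow> a \<epsilon> appd f n)" by blast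
    have TD: "ext T = {x \<in> ext D. \<forall>n\<in>UNIV. natural n \<longrightarrow> x \<epsilon> appd f n}" by (intro set_eqI) (simp add: T)
    have "big X U (\<lambda>x. appd g x \<epsilon> T)" using b2 unfolding T by simp
    moreover have "ext T \<subseteq> ext D" unfolding TD by blast
    ultimately have "T \<in> ext Z" unfolding mem_ext Z by blast
    then show "big D Z (\<lambda>x. \<forall>n\<in>UNIV. natural n \<longrightarrow> x \<epsilon> appd f n)" using TD unfolding big_def by blast
  qed
  with Z show ?thesis by blast
qed

text \<open>In this and the next three definitions the hypotheses are built into the predicate,
  because transfer needs statements that are true in \<open>UNIV\<close> for all arguments
  whatsoever.\<close>

definition "subst_elem A X U f f' g \<longleftrightarrow> (cc_ultrafilter A X U \<and>
  big X U (\<lambda>x. appd f x = appd f' x) \<and> big X U (\<lambda>x. appd f' x \<epsilon> appd g x) \<longrightarrow>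
  big X U (\<lambda>x. appd f x \<epsilon> appd g x))"

definition "has_const A X a \<longleftrightarrow> (\<exists>f\<in>A. func f (ext X) \<and> (\<forall>x\<in>ext X. appd f x = a))"

definition "reflects_less A X U h k g \<longleftrightarrow> (cc_ultrafilter A X U \<and>
  big X U (\<lambda>x. appd h x \<epsilon> appd k x) \<and> \<not> big X U (\<lambda>x. appd h x \<epsilon> appd g x) \<and>
  (\<forall>z\<in>A. func z (ext X) \<longrightarrow>
      big X U (\<lambda>x. appd z x \<epsilon> appd g x) \<and> \<not> big X U (\<lambda>x. appd z x \<epsilon> appd k x) \<or>
      big X U (\<lambda>x. appd z x \<epsilon> appd k x) \<and> \<not> big X U (\<lambda>x. appd z x \<epsilon> appd g x) \<longrightarrow>
      big X U (\<lambda>x. appd z x = appd h x) \<or> big X U (\<lambda>x. appd z x \<epsilon> appd h x)) \<longrightarrow>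
  big X U (\<lambda>x. finset_less (appd g x) (appd k x)))"

text \<open>The point is that \<open>Z\<close> is found in \<open>A\<close>: in the ultrapower it is
  then the class of a function.\<close>

definition "has_pushforward A X U g D s \<longleftrightarrow> (cc_ultrafilter A X U \<and>
  big X U (\<lambda>x. appd g x \<epsilon> D) \<and> big X U (\<lambda>x. finset_less (appd g x) s) \<longrightarrow>
  (\<exists>Z\<in>A. cc_ultrafilter A D Z \<and> big D Z (\<lambda>a. finset_less a s) \<and>
    (\<forall>T\<in>A. T \<epsilon> Z \<longleftrightarrow> ext T \<subseteq> ext D \<and> big X U (\<lambda>x. appd g x \<epsilon> T))))"

lemma df_schemes:
  shows "df G (\<lambda>A e. subst_elem A (e 0) (e (Suc 0)) (e (Suc (Suc 0))) (e (Suc (Suc (Suc 0)))) (e (Suc (Suc (Suc (Suc 0))))))"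
    and "df G (\<lambda>A e. has_const A (e 0) (e (Suc 0)))"
    and "df G (\<lambda>A e. reflects_less A (e 0) (e (Suc 0)) (e (Suc (Suc 0))) (e (Suc (Suc (Suc 0)))) (e (Suc (Suc (Suc (Suc 0))))))"
    and "df G (\<lambda>A e. has_pushforward A (e 0) (e (Suc 0)) (e (Suc (Suc 0))) (e (Suc (Suc (Suc 0)))) (e (Suc (Suc (Suc (Suc 0))))))"
  unfolding subst_elem_def has_const_def reflects_less_def has_pushforward_def by (intro dfA)+

lemma has_pushforward_UNIV: "has_pushforward UNIV X U g D s"
  unfolding has_pushforward_def
proof (intro impI, elim conjE)
  assume cc: "cc_ultrafilter UNIV X U" and gD: "big X U (\<lambda>x. appd g x \<epsilon> D)"
    and gs: "big X U (\<lambda>x. finset_less (appd g x) s)"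
  obtain Z where Z: "cc_ultrafilter UNIV D Z" "\<And>T. T \<epsilon> Z \<longleftrightarrow> ext T \<subseteq> ext D \<and> big X U (\<lambda>x. appd g x \<epsilon> T)"
    using pushforward[OF cc gD] by blast
  have d: "df {UNIV} (\<lambda>A e. appd g (e 0) \<epsilon> D)" "df {UNIV} (\<lambda>A e. finset_less (appd g (e 0)) s)"
    and ds: "df {UNIV} (\<lambda>A e. finset_less (e 0) s)" by (intro dfU df_finset_less)+
  have b: "big X U (\<lambda>x. appd g x \<epsilon> D \<and> finset_less (appd g x) s)"
    using big_conj[of X U "\<lambda>x. appd g x \<epsilon> D" "\<lambda>x. finset_less (appd g x) s", OF cc d] gD gs by blast
  from sep_ex[of "\<lambda>a. finset_less a s" D, OF ds] obtain T where T: "\<And>a. a \<epsilon> T \<longleftrightarrow> a \<epsilon> D \<and> finset_less a s" by blast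
  have TD: "ext T = {x \<in> ext D. finset_less x s}" by (intro set_eqI) (simp add: T)
  have "big X U (\<lambda>x. appd g x \<epsilon> T)" using b unfolding T .
  moreover have "ext T \<subseteq> ext D" unfolding TD by blast
  ultimately have "T \<in> ext Z" unfolding mem_ext Z(2) by blast
  then have "big D Z (\<lambda>a. finset_less a s)" using TD unfolding big_def by blast
  with Z show "\<exists>Z\<in>UNIV. cc_ultrafilter UNIV D Z \<and> big D Z (\<lambda>a. finset_less a s) \<and>
    (\<forall>T\<in>UNIV. T \<epsilon> Z \<longleftrightarrow> ext T \<subseteq> ext D \<and> big X U (\<lambda>x. appd g x \<epsilon> T))" by blast
qed

end

context ultra
begin

lemma transfer2:
  assumes "df UNIV (\<lambda>A e. P A (e 0) (e (Suc 0)))" "\<And>x y. P UNIV x y" "x \<in> M" "y \<in> M"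
  shows "P M x y"
proof -
  have "range (scons x (\<lambda>_. y)) \<subseteq> M" using assms(3,4) by (intro range_scons) auto
  from transfer[OF assms(1,2) this] show ?thesis by simp
qed

lemma transfer5:
  assumes "df UNIV (\<lambda>A e. P A (e 0) (e (Suc 0)) (e (Suc (Suc 0))) (e (Suc (Suc (Suc 0)))) (e (Suc (Suc (Suc (Suc 0))))))"
    "\<And>x y z v w. P UNIV x y z v w" "x \<in> M" "y \<in> M" "z \<in> M" "v \<in> M" "w \<in> M"
  shows "P M x y z v w"
proof -
  have "range (scons x (scons y (scons z (scons v (\<lambda>_. w))))) \<subseteq> M"
    using assms(3-) by (intro range_scons) auto
  from transfer[OF assms(1,2) this] show ?thesis by simp
qed

lemma subst_elem_M: "X' \<in> M \<Longrightarrow> W \<in> M \<Longrightarrow> f \<in> M \<Longrightarrow> f' \<in> M \<Longrightarrow> g \<in> M \<Longrightarrow> subst_elem M X' W f f' g"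
  by (rule transfer5[where P = subst_elem, OF df_schemes(1)])
     (auto simp: subst_elem_def intro: big_subst_elem)

lemma has_const_M: "X' \<in> M \<Longrightarrow> a \<in> M \<Longrightarrow> has_const M X' a"
  by (rule transfer2[where P = has_const, OF df_schemes(2)]) (use const_func_ex in \<open>auto simp: has_const_def\<close>)

lemma reflects_less_M:
  "X' \<in> M \<Longrightarrow> W \<in> M \<Longrightarrow> h \<in> M \<Longrightarrow> k \<in> M \<Longrightarrow> g \<in> M \<Longrightarrow> reflects_less M X' W h k g"
proof (rule transfer5[where P = reflects_less, OF df_schemes(3)])
  show "reflects_less UNIV X U h k g" for X U h k g
    unfolding reflects_less_def by (intro impI, elim conjE, rule big_finset_less) blast+
qed

lemma has_pushforward_M:
  "X' \<in> M \<Longrightarrow> W \<in> M \<Longrightarrow> g \<in> M \<Longrightarrow> D \<in> M \<Longrightarrow> s \<in> M \<Longrightarrow> has_pushforward M X' W g D s"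
  by (rule transfer5[where P = has_pushforward, OF df_schemes(4)]) (rule has_pushforward_UNIV)

end

section \<open>The ultrapower of an ultrapower by an internal ultrafilter\<close>

locale ultra2 = ultra E X U c for E :: "'v \<Rightarrow> 'v \<Rightarrow> bool" (infix "\<epsilon>" 50) and X U c +
  fixes Y W :: 'v and d :: "'v \<Rightarrow> 'v"
  assumes ccW: "cc_ultrafilter M Y W" and cmW: "Defs.collapse_map E M Y W d"

context ultra
begin

definition "idf = lam X (\<lambda>x. x)"

lemma idf: "func idf (ext X)" "x \<epsilon> X \<Longrightarrow> appd idf x = x"
proof -
  have t: "tm {UNIV} (\<lambda>A e. e 0)" by (rule tm_var)
  show 1: "func idf (ext X)" unfolding idf_def by (rule func_lam[OF t])
  show "appd idf x = x" if "x \<epsilon> X"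
    using appd_eq[OF 1, of x] func_lam(2)[OF t that] that unfolding idf_def by simp
qed

lemma c_in_M: "func f (ext X) \<Longrightarrow> c f \<in> M" unfolding M_iff by blast

text \<open>\<open>c (cst B)\<close> is the image of \<open>B\<close> under the ultrapower embedding
  and \<open>c idf\<close> is the seed, so this recovers \<open>U\<close> from its embedding and
  seed.\<close>

lemma seed_mem: "c idf \<epsilon> c (cst B) \<longleftrightarrow> big X U (\<lambda>x. x \<epsilon> B)"
  unfolding c_mem[OF idf(1) cst(1)] by (rule big_cong) (simp add: idf cst)

lemma los3:
  assumes "df UNIV (\<lambda>A e. P A (e 0) (e (Suc 0)) (e (Suc (Suc 0))))"
    "func f (ext X)" "func g (ext X)" "func h (ext X)"
  shows "P M (c f) (c g) (c h) \<longleftrightarrow> big X U (\<lambda>x. P UNIV (appd f x) (appd g x) (appd h x))"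
proof -
  have "func (scons f (scons g (\<lambda>_. h)) i) (ext X)" for i
    using assms(2-4) unfolding scons_def by (simp split: nat.splits)
  from los_df[of _ "scons f (scons g (\<lambda>_. h))", OF assms(1) this] show ?thesis by simp
qed

end

context ultra2
begin

lemma Y_M: "Y \<in> M" and W_M: "W \<in> M" and Y_W: "Y \<epsilon> W"
  using ccW unfolding Defs.cc_ultrafilter_def by blast+

lemma W_ne: assumes "S \<epsilon> W" shows "ext S \<noteq> {}"
proof -
  have "\<forall>S\<in>ext W. ext S \<subseteq> ext Y \<and> ext S \<noteq> {}" using ccW unfolding Defs.cc_ultrafilter_def by blast
  moreover have "S \<in> ext W" using assms by simp
  ultimately show ?thesis by blast
qed

lemma fo_iff: "f \<in> functions_on M Y \<longleftrightarrow> f \<in> M \<and> func f (ext Y)"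
  unfolding Defs.functions_on_def by blast

lemma d_eq:
  assumes "f \<in> functions_on M Y" "g \<in> functions_on M Y"
  shows "d f = d g \<longleftrightarrow> big Y W (\<lambda>y. appd f y = appd g y)"
proof -
  have fg: "func f (ext Y)" "func g (ext Y)" using assms unfolding fo_iff by blast+
  have "d f = d g \<longleftrightarrow> eq_mod Y W f g" using cmW assms unfolding Defs.collapse_map_def by blast
  also have "\<dots> \<longleftrightarrow> big Y W (\<lambda>y. appd f y = appd g y)" unfolding eq_mod_big
    by (rule big_cong) (simp add: appd_eq[OF fg(1)] appd_eq[OF fg(2)])
  finally show ?thesis .
qed

lemma d_mem0:
  assumes "g \<in> functions_on M Y"
  shows "z \<epsilon> d g \<longleftrightarrow> (\<exists>f\<in>functions_on M Y. z = d f \<and> big Y W (\<lambda>y. appd f y \<epsilon> appd g y))"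
proof -
  have g: "func g (ext Y)" using assms unfolding fo_iff by blast
  have "ext (d g) = d ` {f \<in> functions_on M Y. mem_mod Y W f g}"
    using cmW assms unfolding Defs.collapse_map_def by blast
  then have "z \<epsilon> d g \<longleftrightarrow> z \<in> d ` {f \<in> functions_on M Y. mem_mod Y W f g}"
    using mem_ext[of z "d g"] by simp
  also have "\<dots> \<longleftrightarrow> (\<exists>f\<in>functions_on M Y. z = d f \<and> mem_mod Y W f g)" by blast
  also have "\<dots> \<longleftrightarrow> (\<exists>f\<in>functions_on M Y. z = d f \<and> big Y W (\<lambda>y. appd f y \<epsilon> appd g y))"
  proof -
    have "mem_mod Y W f g \<longleftrightarrow> big Y W (\<lambda>y. appd f y \<epsilon> appd g y)" if "f \<in> functions_on M Y" for f
    proof -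
      have f: "func f (ext Y)" using that unfolding fo_iff by blast
      show ?thesis unfolding mem_mod_big by (rule big_cong) (simp add: appd_eq[OF f] appd_eq[OF g])
    qed
    then show ?thesis by blast
  qed
  finally show ?thesis .
qed

text \<open>As for \<open>c_mem\<close>, a representative has to be exchanged; here this happens
  inside \<open>M\<close>, by the transferred \<open>subst_elem\<close>.\<close>

lemma d_mem:
  assumes f: "f \<in> functions_on M Y" and g: "g \<in> functions_on M Y"
  shows "d f \<epsilon> d g \<longleftrightarrow> big Y W (\<lambda>y. appd f y \<epsilon> appd g y)"
proof
  assume "d f \<epsilon> d g"
  then obtain h where h: "h \<in> functions_on M Y" "d f = d h" "big Y W (\<lambda>y. appd h y \<epsilon> appd g y)"
    using d_mem0[OF g] by blast
  have "subst_elem M Y W f h g"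
    by (rule subst_elem_M[OF Y_M W_M]) (use f g h(1) fo_iff in blast)+
  then show "big Y W (\<lambda>y. appd f y \<epsilon> appd g y)"
    unfolding subst_elem_def using ccW h(3) d_eq[OF f h(1)] h(2) by blast
next
  assume "big Y W (\<lambda>y. appd f y \<epsilon> appd g y)"
  then show "d f \<epsilon> d g" using d_mem0[OF g] f by blast
qed

definition "kst a = lam Y (\<lambda>_. a)"

text \<open>\<open>lam\<close> forms the constant function in \<open>V\<close>. The transferred
  \<open>has_const\<close> provides one in \<open>M\<close>, and the two are equal because a
  function is determined by its values.\<close>

lemma kst:
  assumes "a \<in> M" shows "kst a \<in> functions_on M Y" "y \<epsilon> Y \<Longrightarrow> appd (kst a) y = a"
proof -
  obtain f where f: "f \<in> M" "func f (ext Y)" "\<And>y. y \<in> ext Y \<Longrightarrow> appd f y = a"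
    using has_const_M[OF Y_M assms] unfolding has_const_def by blast
  have "kst a = f" unfolding kst_def
    by (rule lam_eq[OF f(2)]) (use f(3) appd_eq[OF f(2)] in simp)
  then show "kst a \<in> functions_on M Y" "y \<epsilon> Y \<Longrightarrow> appd (kst a) y = a"
    using f unfolding fo_iff by simp_all
qed

lemma rep_mem:
  assumes g: "g \<in> functions_on M Y" and B: "B \<in> M"
  shows "d g \<epsilon> d (kst B) \<longleftrightarrow> big Y W (\<lambda>y. appd g y \<epsilon> B)"
  unfolding d_mem[OF g kst(1)[OF B]] by (rule big_cong) (simp add: kst(2)[OF B])

text \<open>The set of \<open>y\<close> with \<open>a \<epsilon> b\<close> is all of
  \<open>Y\<close> or empty.\<close>

lemma embedding_mem:
  assumes a: "a \<in> M" and b: "b \<in> M"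
  shows "d (kst a) \<epsilon> d (kst b) \<longleftrightarrow> a \<epsilon> b"
proof -
  have "d (kst a) \<epsilon> d (kst b) \<longleftrightarrow> big Y W (\<lambda>y. a \<epsilon> b)"
    unfolding rep_mem[OF kst(1)[OF a] b] by (rule big_cong) (simp add: kst(2)[OF a])
  also have "\<dots> \<longleftrightarrow> a \<epsilon> b"
  proof (cases "a \<epsilon> b")
    case True
    then show ?thesis unfolding big_exact using Y_W by (auto intro!: bexI[of _ Y])
  next
    case False
    then show ?thesis unfolding big_exact using W_ne by force
  qed
  finally show ?thesis .
qed

text \<open>The largest difference \<open>m\<close> has a representative \<open>h\<close> in
  \<open>M\<close>. Any \<open>z\<close> in \<open>M\<close> that differs from it on the two sides
  represents an element of the symmetric difference in the ultrapower, so the premises of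
  \<open>reflects_less\<close> hold.\<close>

lemma rep_less:
  assumes g: "g \<in> functions_on M Y" and s: "s \<in> M" and l: "finset_less (d g) (d (kst s))"
  shows "big Y W (\<lambda>y. finset_less (appd g y) s)"
proof -
  note k = kst(1)[OF s]
  obtain m where m: "m \<epsilon> d (kst s)" "\<not> m \<epsilon> d g"
    "\<And>z. z \<epsilon> d g \<Longrightarrow> \<not> z \<epsilon> d (kst s) \<Longrightarrow> z = m \<or> z \<epsilon> m"
    "\<And>z. z \<epsilon> d (kst s) \<Longrightarrow> \<not> z \<epsilon> d g \<Longrightarrow> z = m \<or> z \<epsilon> m"
    using l unfolding finset_less_iff Bex_def Ball_def mem_ext by blast
  obtain h where h: "h \<in> functions_on M Y" "m = d h" using m(1) d_mem0[OF k] by blast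
  have "reflects_less M Y W h (kst s) g"
    by (rule reflects_less_M[OF Y_M W_M]) (use h(1) k g fo_iff in blast)+
  moreover have "big Y W (\<lambda>y. appd h y \<epsilon> appd (kst s) y)" "\<not> big Y W (\<lambda>y. appd h y \<epsilon> appd g y)"
    using m(1,2) d_mem[OF h(1) k] d_mem[OF h(1) g] unfolding h(2) by blast+
  moreover have "big Y W (\<lambda>y. appd z y = appd h y) \<or> big Y W (\<lambda>y. appd z y \<epsilon> appd h y)"
    if "z \<in> M" "func z (ext Y)" and
      "big Y W (\<lambda>x. appd z x \<epsilon> appd g x) \<and> \<not> big Y W (\<lambda>x. appd z x \<epsilon> appd (kst s) x) \<or>
       big Y W (\<lambda>x. appd z x \<epsilon> appd (kst s) x) \<and> \<not> big Y W (\<lambda>x. appd z x \<epsilon> appd g x)" for z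
  proof -
    have z: "z \<in> functions_on M Y" using that(1,2) unfolding fo_iff by blast
    have "d z \<epsilon> d g \<and> \<not> d z \<epsilon> d (kst s) \<or> d z \<epsilon> d (kst s) \<and> \<not> d z \<epsilon> d g"
      using that(3) unfolding d_mem[OF z g] d_mem[OF z k] .
    then have "d z = d h \<or> d z \<epsilon> d h" using m(3,4) unfolding h(2) by blast
    then show ?thesis unfolding d_eq[OF z h(1)] d_mem[OF z h(1)] .
  qed
  ultimately have "big Y W (\<lambda>y. finset_less (appd g y) (appd (kst s) y))"
    unfolding reflects_less_def using ccW by blast
  then show ?thesis using big_cong[of Y "\<lambda>y. finset_less (appd g y) (appd (kst s) y)" "\<lambda>y. finset_less (appd g y) s"]
      kst(2)[OF s] by simp
qed

text \<open>The relation of three classes to which \<open>los3\<close> is applied. As the seed is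
  represented by the identity, \<open>s\<close> becomes the point \<open>x\<close> itself.\<close>

definition "measures_below A D Z s \<longleftrightarrow> cc_ultrafilter A D Z \<and> big D Z (\<lambda>a. finset_less a s)"

text \<open>With \<open>Z\<close> the image of \<open>W\<close> under \<open>g\<close> and
  \<open>F\<close> a representative of \<open>Z\<close>, the last equivalence is a chain:
  \<open>d g\<close> lies in the image of \<open>T\<close> under both embeddings iff the first
  embedding sends \<open>T\<close> into \<open>Z\<close>, iff \<open>T \<epsilon> appd F x\<close>
  for almost all \<open>x\<close>.\<close>

theorem ketonen_function:
  assumes g: "g \<in> functions_on M Y"
    and gD: "d g \<epsilon> d (kst (c (cst D)))" and gs: "finset_less (d g) (d (kst (c idf)))"
  shows "\<exists>F. func F (ext X) \<and>
    big X U (\<lambda>x. cc_ultrafilter UNIV D (appd F x) \<and> big D (appd F x) (\<lambda>a. finset_less a x)) \<and>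
    (\<forall>T. ext T \<subseteq> ext D \<longrightarrow> (d g \<epsilon> d (kst (c (cst T))) \<longleftrightarrow> big X U (\<lambda>x. T \<epsilon> appd F x)))"
proof -
  note cM = c_in_M[OF cst(1)] and sM = c_in_M[OF idf(1)]
  have gM: "g \<in> M" using g unfolding fo_iff by blast
  have "has_pushforward M Y W g (c (cst D)) (c idf)"
    by (rule has_pushforward_M[OF Y_M W_M gM cM sM])
  moreover have "big Y W (\<lambda>y. appd g y \<epsilon> c (cst D))" using gD rep_mem[OF g cM] by blast
  ultimately obtain Z where Z: "Z \<in> M" "cc_ultrafilter M (c (cst D)) Z" "big (c (cst D)) Z (\<lambda>a. finset_less a (c idf))"
    "\<And>T. T \<in> M \<Longrightarrow> T \<epsilon> Z \<longleftrightarrow> ext T \<subseteq> ext (c (cst D)) \<and> big Y W (\<lambda>y. appd g y \<epsilon> T)"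
    unfolding has_pushforward_def using ccW rep_less[OF g sM gs] by blast
  obtain F where F: "func F (ext X)" "Z = c F" using Z(1) unfolding M_iff by blast
  have "measures_below M (c (cst D)) (c F) (c idf)" unfolding measures_below_def using Z(2,3) F(2) by blast
  moreover have "df UNIV (\<lambda>A e. measures_below A (e 0) (e (Suc 0)) (e (Suc (Suc 0))))"
    unfolding measures_below_def by (intro dfA)
  ultimately have "big X U (\<lambda>x. measures_below UNIV (appd (cst D) x) (appd F x) (appd idf x))"
    using los3[of measures_below, OF _ cst(1) F(1) idf(1)] by blast
  then have 1: "big X U (\<lambda>x. cc_ultrafilter UNIV D (appd F x) \<and> big D (appd F x) (\<lambda>a. finset_less a x))"
    using big_cong[of X "\<lambda>x. measures_below UNIV (appd (cst D) x) (appd F x) (appd idf x)"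
        "\<lambda>x. cc_ultrafilter UNIV D (appd F x) \<and> big D (appd F x) (\<lambda>a. finset_less a x)"]
      cst(2) idf(2) unfolding measures_below_def by simp
  have 2: "d g \<epsilon> d (kst (c (cst T))) \<longleftrightarrow> big X U (\<lambda>x. T \<epsilon> appd F x)" if T: "ext T \<subseteq> ext D" for T
  proof -
    \<comment> \<open>The embedding preserves inclusion; \<open>Z\<close> has only subsets of
      \<open>c (cst D)\<close> as members.\<close>
    have "z \<epsilon> c (cst D)" if "z \<epsilon> c (cst T)" for z
    proof -
      obtain f where f: "func f (ext X)" "z = c f" "big X U (\<lambda>x. appd f x \<epsilon> appd (cst T) x)"
        using \<open>z \<epsilon> c (cst T)\<close> unfolding c_mem0[OF cst(1)] by blast
      have dd: "df {UNIV} (\<lambda>A e. appd f (e 0) \<epsilon> appd (cst D) (e 0))" by (intro dfU)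
      have "big X U (\<lambda>x. appd f x \<epsilon> appd (cst D) x)"
        by (rule big_mono[OF cc dd f(3)]) (use subextD[OF T] cst(2) in simp)
      then show ?thesis unfolding f(2) c_mem[OF f(1) cst(1)] .
    qed
    then have "ext (c (cst T)) \<subseteq> ext (c (cst D))" by (auto simp: subset_iff)
    then have "d g \<epsilon> d (kst (c (cst T))) \<longleftrightarrow> c (cst T) \<epsilon> Z" using Z(4)[OF cM] rep_mem[OF g cM] by blast
    also have "\<dots> \<longleftrightarrow> big X U (\<lambda>x. T \<epsilon> appd F x)"
      unfolding F(2) c_mem[OF cst(1) F(1)] by (rule big_cong) (simp add: cst(2))
    finally show ?thesis .
  qed
  show ?thesis using F(1) 1 2 by blast
qed

end

section \<open>Comparisons and the Ketonen order\<close>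

context zfc
begin

text \<open>The underlying set is the largest member of the ultrafilter. So the underlying sets
  hidden in the existential quantifiers of \<open>ultrapower\<close> and \<open>uniform\<close>
  agree.\<close>

lemma cc_unique: "cc_ultrafilter UNIV X U \<Longrightarrow> cc_ultrafilter UNIV X' U \<Longrightarrow> X = X'"
  using cc_sub[of X U X'] cc_sub[of X' U X] cc_top[of X U] cc_top[of X' U] by (metis ext_inject subset_antisym)

text \<open>The last clause says that \<open>U0\<close> is the limit of the \<open>F x\<close> along
  \<open>U1\<close>. Its converse, for ultrafilters, follows by passing to complements.\<close>

definition "ketonen X0 U0 X1 U1 F \<longleftrightarrow> func F (ext X1) \<and>
  big X1 U1 (\<lambda>x. cc_ultrafilter UNIV X0 (appd F x) \<and> big X0 (appd F x) (\<lambda>a. finset_less a x)) \<and>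
  (\<forall>T. ext T \<subseteq> ext X0 \<longrightarrow> T \<epsilon> U0 \<longrightarrow> big X1 U1 (\<lambda>x. T \<epsilon> appd F x))"

text \<open>\<open>t0\<close> lies in the image of \<open>B\<close> iff \<open>B\<close> is large
  for \<open>U0\<close>, and \<open>t1\<close> iff it is large for \<open>U1\<close>; both composite
  embeddings give the same image. "Large" is expressed by \<open>big\<close>, because
  \<open>B\<close> need not be a subset of \<open>X0\<close> or \<open>X1\<close>.\<close>

theorem comparison_cases:
  assumes "Defs.comparison E U0 U1 W0 W1 t0 t1"
  obtains X0 X1 where "cc_ultrafilter UNIV X0 U0" "cc_ultrafilter UNIV X1 U1"
    "t0 = t1 \<Longrightarrow> \<forall>B. big X0 U0 (\<lambda>x. x \<epsilon> B) \<longleftrightarrow> big X1 U1 (\<lambda>x. x \<epsilon> B)"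
    "finset_less t0 t1 \<Longrightarrow> \<exists>F. ketonen X0 U0 X1 U1 F"
proof -
  obtain M0 j0 s0 M1 j1 s1 N0 k0 r0 N1 k1 r1 where
    u0: "Defs.ultrapower E UNIV U0 M0 j0 s0" and u1: "Defs.ultrapower E UNIV U1 M1 j1 s1"
    and v0: "Defs.ultrapower E M0 W0 N0 k0 r0" and v1: "Defs.ultrapower E M1 W1 N1 k1 r1"
    and N: "N0 = N1" and kj: "k0 \<circ> j0 = k1 \<circ> j1" and t: "t0 = k0 s0" "t1 = k1 s1"
    using assms unfolding Defs.comparison_def by blast
  obtain X0 c0 where x0: "cc_ultrafilter UNIV X0 U0" "Defs.collapse_map E UNIV X0 U0 c0"
    "M0 = c0 ` functions_on UNIV X0" "\<forall>a\<in>UNIV. j0 a = c0 (lam X0 (\<lambda>_. a))" "s0 = c0 (lam X0 (\<lambda>x. x))"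
    using u0 unfolding Defs.ultrapower_def by blast
  obtain X1 c1 where x1: "cc_ultrafilter UNIV X1 U1" "Defs.collapse_map E UNIV X1 U1 c1"
    "M1 = c1 ` functions_on UNIV X1" "\<forall>a\<in>UNIV. j1 a = c1 (lam X1 (\<lambda>_. a))" "s1 = c1 (lam X1 (\<lambda>x. x))"
    using u1 unfolding Defs.ultrapower_def by blast
  interpret A0: ultra E X0 U0 c0 by unfold_locales (rule x0(1), rule x0(2))
  interpret A1: ultra E X1 U1 c1 by unfold_locales (rule x1(1), rule x1(2))
  have M0: "M0 = A0.M" using x0(3) unfolding A0.M_def .
  have M1: "M1 = A1.M" using x1(3) unfolding A1.M_def .
  obtain Y0 d0 where y0: "cc_ultrafilter A0.M Y0 W0" "Defs.collapse_map E A0.M Y0 W0 d0"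
    "N0 = d0 ` functions_on A0.M Y0" "\<forall>a\<in>A0.M. k0 a = d0 (lam Y0 (\<lambda>_. a))"
    using v0 unfolding Defs.ultrapower_def M0 by blast
  obtain Y1 d1 where y1: "cc_ultrafilter A1.M Y1 W1" "Defs.collapse_map E A1.M Y1 W1 d1"
    "N1 = d1 ` functions_on A1.M Y1" "\<forall>a\<in>A1.M. k1 a = d1 (lam Y1 (\<lambda>_. a))"
    using v1 unfolding Defs.ultrapower_def M1 by blast
  interpret B0: ultra2 E X0 U0 c0 Y0 W0 d0 by unfold_locales (rule y0(1), rule y0(2))
  interpret B1: ultra2 E X1 U1 c1 Y1 W1 d1 by unfold_locales (rule y1(1), rule y1(2))
  have s: "s0 = c0 A0.idf" "s1 = c1 A1.idf" using x0(5) x1(5) unfolding A0.idf_def A1.idf_def .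
  have j: "j0 B = c0 (A0.cst B)" "j1 B = c1 (A1.cst B)" for B
    using x0(4) x1(4) unfolding A0.cst_def A1.cst_def by blast+
  have k0: "k0 a = d0 (B0.kst a)" if "a \<in> A0.M" for a using y0(4) that unfolding B0.kst_def by blast
  have k1: "k1 a = d1 (B1.kst a)" if "a \<in> A1.M" for a using y1(4) that unfolding B1.kst_def by blast
  note m0 = A0.c_in_M[OF A0.cst(1)] A0.c_in_M[OF A0.idf(1)]
  note m1 = A1.c_in_M[OF A1.cst(1)] A1.c_in_M[OF A1.idf(1)]
  have i: "k0 (j0 B) = k1 (j1 B)" for B using kj by (metis comp_apply)
  have t0: "t0 \<epsilon> k0 (j0 B) \<longleftrightarrow> big X0 U0 (\<lambda>x. x \<epsilon> B)" for B
    unfolding t(1) s(1) j k0[OF m0(1)] k0[OF m0(2)] B0.embedding_mem[OF m0(2) m0(1)] A0.seed_mem ..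
  have t1: "t1 \<epsilon> k1 (j1 B) \<longleftrightarrow> big X1 U1 (\<lambda>x. x \<epsilon> B)" for B
    unfolding t(2) s(2) j k1[OF m1(1)] k1[OF m1(2)] B1.embedding_mem[OF m1(2) m1(1)] A1.seed_mem ..
  show ?thesis
  proof (rule that[OF x0(1) x1(1)])
    assume "t0 = t1"
    then show "\<forall>B. big X0 U0 (\<lambda>x. x \<epsilon> B) \<longleftrightarrow> big X1 U1 (\<lambda>x. x \<epsilon> B)" using t0 t1 i by simp
  next
    assume less: "finset_less t0 t1"
    \<comment> \<open>Because the two final models coincide, \<open>t0\<close>, which comes from the
      first side, has a representative \<open>g\<close> on the second side.\<close>
    have "t0 \<in> N1" using N y0(3) B0.kst(1)[OF m0(2)] unfolding t(1) s(1) k0[OF m0(2)] by blast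
    then obtain g where g: "g \<in> functions_on A1.M Y1" "t0 = d1 g" using y1(3) by blast
    have dX: "df {UNIV} (\<lambda>A e. e 0 \<epsilon> X0)" by (intro dfU)
    have tX: "d1 g \<epsilon> d1 (B1.kst (c1 (A1.cst X0)))"
    proof -
      have "big X0 U0 (\<lambda>x. x \<epsilon> X0)" by (rule big_all[OF x0(1) dX])
      then have "t0 \<epsilon> k1 (j1 X0)" using t0[of X0] i[of X0] by simp
      then show ?thesis unfolding j k1[OF m1(1)] g(2) .
    qed
    have tl: "finset_less (d1 g) (d1 (B1.kst (c1 A1.idf)))"
      using less unfolding g(2) t(2) s(2) k1[OF m1(2)] .
    from B1.ketonen_function[OF g(1) tX tl] obtain F where F: "func F (ext X1)"
      "big X1 U1 (\<lambda>x. cc_ultrafilter UNIV X0 (appd F x) \<and> big X0 (appd F x) (\<lambda>a. finset_less a x))"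
      "\<And>T. ext T \<subseteq> ext X0 \<Longrightarrow> d1 g \<epsilon> d1 (B1.kst (c1 (A1.cst T))) \<longleftrightarrow> big X1 U1 (\<lambda>x. T \<epsilon> appd F x)"
      by blast
    have "big X1 U1 (\<lambda>x. T \<epsilon> appd F x)" if T: "ext T \<subseteq> ext X0" "T \<epsilon> U0" for T
    proof -
      have dT: "df {UNIV} (\<lambda>A e. e 0 \<epsilon> T)" by (intro dfU)
      have "big X0 U0 (\<lambda>x. x \<epsilon> T)" by (rule bigI[OF x0(1) dT T(2)])
      then have "t0 \<epsilon> k1 (j1 T)" using t0[of T] i by simp
      then show ?thesis using F(3)[OF T(1)] unfolding g(2) j k1[OF m1(1)] by blast
    qed
    then have "ketonen X0 U0 X1 U1 F" unfolding ketonen_def using F(1,2) by blast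
    then show "\<exists>F. ketonen X0 U0 X1 U1 F" by blast
  qed
qed

section \<open>Finite sets of ordinals\<close>

lemma ordinal_least_ex:
  assumes "df {UNIV} (\<lambda>A e. P (e 0))" "ordinal a" "P a"
  shows "\<exists>b. ordinal b \<and> P b \<and> (\<forall>c. c \<epsilon> b \<longrightarrow> \<not> P c)"
  by (rule ordinal_least[of P, OF assms]) blast

text \<open>Finiteness in the sense of Tarski, by induction on \<open>n\<close>. At
  \<open>suc k\<close>, if some member of the family omits \<open>k\<close>, one minimizes among
  those; otherwise \<open>k\<close> is deleted from every member, which preserves inclusion both
  ways.\<close>

lemma natural_minimal_subset:
  assumes "natural n" "S0 \<epsilon> F" "\<And>S. S \<epsilon> F \<Longrightarrow> ext S \<subseteq> ext n"
  shows "\<exists>S. S \<epsilon> F \<and> (\<forall>T. T \<epsilon> F \<longrightarrow> ext T \<subseteq> ext S \<longrightarrow> T = S)"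
proof -
  let ?P = "\<lambda>n. \<forall>F. (\<exists>S. S \<epsilon> F) \<and> (\<forall>S. S \<epsilon> F \<longrightarrow> ext S \<subseteq> ext n) \<longrightarrow>
    (\<exists>S. S \<epsilon> F \<and> (\<forall>T. T \<epsilon> F \<longrightarrow> ext T \<subseteq> ext S \<longrightarrow> T = S))"
  have "?P n"
  proof (rule natural_induct[where P = ?P, OF assms(1)])
    show "?P zero"
    proof (intro allI impI, elim conjE exE)
      fix F S assume S: "S \<epsilon> F" "\<forall>S. S \<epsilon> F \<longrightarrow> ext S \<subseteq> ext zero"
      have "T = S" if "T \<epsilon> F" for T
      proof -
        have "ext T = ext S" using S that by auto
        then show ?thesis by simp
      qed
      with S(1) show "\<exists>S. S \<epsilon> F \<and> (\<forall>T. T \<epsilon> F \<longrightarrow> ext T \<subseteq> ext S \<longrightarrow> T = S)" by blast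
    qed
  next
    fix k assume IH: "?P k"
    show "?P (suc k)"
    proof (intro allI impI, elim conjE)
      fix F assume ne: "\<exists>S. S \<epsilon> F" and F: "\<forall>S. S \<epsilon> F \<longrightarrow> ext S \<subseteq> ext (suc k)"
      have sub: "z \<epsilon> k" if "S \<epsilon> F" "z \<epsilon> S" "z \<noteq> k" for S z
        using F that by (auto simp: subset_iff)
      show "\<exists>S. S \<epsilon> F \<and> (\<forall>T. T \<epsilon> F \<longrightarrow> ext T \<subseteq> ext S \<longrightarrow> T = S)"
      proof (cases "\<exists>S. S \<epsilon> F \<and> \<not> k \<epsilon> S")
        case True
        have "df {UNIV} (\<lambda>A e. \<not> k \<epsilon> e 0)" by (intro dfU)
        from sep_ex[of "\<lambda>S. \<not> k \<epsilon> S" F, OF this] obtain G where G: "\<And>S. S \<epsilon> G \<longleftrightarrow> S \<epsilon> F \<and> \<not> k \<epsilon> S" by blast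
        have "ext S \<subseteq> ext k" if "S \<epsilon> G" for S
        proof
          fix z assume "z \<in> ext S"
          then have "z \<epsilon> S" "z \<noteq> k" using that G by auto
          then show "z \<in> ext k" using sub[of S z] that G by simp
        qed
        then obtain S where S: "S \<epsilon> G" "\<And>T. T \<epsilon> G \<Longrightarrow> ext T \<subseteq> ext S \<Longrightarrow> T = S"
          using IH[rule_format, of G] True G by blast
        have "T = S" if "T \<epsilon> F" "ext T \<subseteq> ext S" for T
          using S G that subextD[OF that(2), of k] by blast
        then show ?thesis using S(1) G by blast
      next
        case False
        have "df {UNIV} (\<lambda>A e. \<exists>S. S \<epsilon> F \<and> (\<forall>z. z \<epsilon> S \<longleftrightarrow> z \<epsilon> e 0 \<or> z = k))" by (intro dfU)
        from sep_ex[of "\<lambda>S'. \<exists>S. S \<epsilon> F \<and> (\<forall>z. z \<epsilon> S \<longleftrightarrow> z \<epsilon> S' \<or> z = k)" "setof {y. ext y \<subseteq> ext k}", OF this]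
        obtain G where "\<And>S'. S' \<epsilon> G \<longleftrightarrow> S' \<epsilon> setof {y. ext y \<subseteq> ext k} \<and> (\<exists>S. S \<epsilon> F \<and> (\<forall>z. z \<epsilon> S \<longleftrightarrow> z \<epsilon> S' \<or> z = k))"
          by blast
        then have G: "S' \<epsilon> G \<longleftrightarrow> ext S' \<subseteq> ext k \<and> (\<exists>S. S \<epsilon> F \<and> (\<forall>z. z \<epsilon> S \<longleftrightarrow> z \<epsilon> S' \<or> z = k))" for S' by simp
        have del: "\<exists>S'. S' \<epsilon> G \<and> (\<forall>z. z \<epsilon> S' \<longleftrightarrow> z \<epsilon> S \<and> z \<noteq> k)" if S: "S \<epsilon> F" for S
        proof -
          have "df {UNIV} (\<lambda>A e. e 0 \<noteq> k)" by (intro dfU)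
          from sep_ex[of "\<lambda>z. z \<noteq> k" S, OF this] obtain S' where S': "\<And>z. z \<epsilon> S' \<longleftrightarrow> z \<epsilon> S \<and> z \<noteq> k" by blast
          have "ext S' \<subseteq> ext k" using sub[OF S] S' by (auto simp: subset_iff)
          moreover have "z \<epsilon> S \<longleftrightarrow> z \<epsilon> S' \<or> z = k" for z using S' False S by blast
          ultimately have "S' \<epsilon> G" using S G by blast
          with S' show ?thesis by blast
        qed
        then obtain S' where S': "S' \<epsilon> G" "\<And>T. T \<epsilon> G \<Longrightarrow> ext T \<subseteq> ext S' \<Longrightarrow> T = S'"
          using IH[rule_format, of G] ne G by blast
        then obtain S where S: "S \<epsilon> F" "\<And>z. z \<epsilon> S \<longleftrightarrow> z \<epsilon> S' \<or> z = k" using G by blast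
        have "T = S" if T: "T \<epsilon> F" "ext T \<subseteq> ext S" for T
        proof -
          obtain T' where T': "T' \<epsilon> G" "\<And>z. z \<epsilon> T' \<longleftrightarrow> z \<epsilon> T \<and> z \<noteq> k" using del[OF T(1)] by blast
          have "z \<epsilon> S'" if "z \<epsilon> T'" for z
            using that T'(2)[of z] subextD[OF T(2), of z] S(2)[of z] by blast
          then have "ext T' \<subseteq> ext S'" by (auto simp: subset_iff)
          then have "T' = S'" using S'(2) T'(1) by blast
          then have "z \<epsilon> T \<longleftrightarrow> z \<epsilon> S" for z using T'(2)[of z] S(2)[of z] False T(1) by blast
          then show ?thesis by (rule ext_eqI)
        qed
        then show ?thesis using S(1) by blast
      qed
    qed
  next
    show "df {UNIV} (\<lambda>A e. ?P (e 0))" by (intro dfU)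
  qed
  then show ?thesis using assms(2,3) by blast
qed

text \<open>The pigeonhole principle: \<open>?H\<close> is the graph of an injection of
  \<open>n\<close> into \<open>m\<close>. Take a minimal subset \<open>S\<close> of \<open>n\<close>
  that is closed under it and has an element not hit from \<open>S\<close>. The image of
  \<open>S\<close> is again such a set, the missed element being the image of the old one, so it
  equals \<open>S\<close>; but then nothing in \<open>S\<close> is missed.\<close>

lemma natural_no_bij:
  assumes m: "m \<epsilon> n" and n: "natural n"
    and f: "func f (ext m)" "bij_betw (app f) (ext m) (ext a)"
    and g: "func g (ext n)" "bij_betw (app g) (ext n) (ext a)"
  shows False
proof -
  let ?H = "\<lambda>i j. i \<epsilon> n \<and> j \<epsilon> m \<and> appd g i = appd f j"
  let ?C = "\<lambda>S. (\<forall>i. i \<epsilon> S \<longrightarrow> (\<forall>j. ?H i j \<longrightarrow> j \<epsilon> S)) \<and> (\<exists>w. w \<epsilon> S \<and> (\<forall>i. i \<epsilon> S \<longrightarrow> \<not> ?H i w))"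
  have tot: "\<exists>j. ?H i j" if "i \<epsilon> n" for i
  proof -
    have "app g i \<in> ext a" using g(2) that unfolding bij_betw_def by auto
    then have "app g i \<in> app f ` ext m" using f(2) unfolding bij_betw_def by blast
    then obtain j where "j \<in> ext m" "app g i = app f j" by blast
    then show ?thesis using appd_eq[OF g(1), of i] appd_eq[OF f(1), of j] that by auto
  qed
  have inj: "i = i'" if "?H i j" "?H i' j" for i i' j
  proof -
    have "app g i = app g i'" using that appd_eq[OF g(1), of i] appd_eq[OF g(1), of i'] by simp
    then show ?thesis using g(2) that unfolding bij_betw_def inj_on_def by simp
  qed
  have mn: "z \<epsilon> n" if "z \<epsilon> m" for z
    using ordinal_trans[OF natural_ordinal[OF n] m that] .
  have "df {UNIV} (\<lambda>A e. ?C (e 0))" by (intro dfU)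
  from sep_ex[of ?C "setof {y. ext y \<subseteq> ext n}", OF this]
  obtain F where "\<And>S. S \<epsilon> F \<longleftrightarrow> S \<epsilon> setof {y. ext y \<subseteq> ext n} \<and> ?C S" by blast
  then have F: "S \<epsilon> F \<longleftrightarrow> ext S \<subseteq> ext n \<and> ?C S" for S by simp
  \<comment> \<open>The missed element is \<open>m\<close>: all values of \<open>?H\<close> are
    elements of \<open>m\<close>.\<close>
  have "?C n" using m mn by (metis no_self)
  then have "n \<epsilon> F" unfolding F by blast
  then obtain S where S: "S \<epsilon> F" "\<And>T. T \<epsilon> F \<Longrightarrow> ext T \<subseteq> ext S \<Longrightarrow> T = S"
    using natural_minimal_subset[OF n, of n F] F by blast
  then have SC: "ext S \<subseteq> ext n" "?C S" unfolding F by blast+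
  have "df {UNIV} (\<lambda>A e. \<exists>i. i \<epsilon> S \<and> ?H i (e 0))" by (intro dfU)
  from sep_ex[of "\<lambda>j. \<exists>i. i \<epsilon> S \<and> ?H i j" S, OF this]
  obtain T where T: "\<And>j. j \<epsilon> T \<longleftrightarrow> j \<epsilon> S \<and> (\<exists>i. i \<epsilon> S \<and> ?H i j)" by blast
  from SC(2) obtain w where w: "w \<epsilon> S" "\<And>i. i \<epsilon> S \<Longrightarrow> \<not> ?H i w" by blast
  obtain w' where w': "?H w w'" using tot[OF subextD[OF SC(1) w(1)]] by blast
  have TS: "ext T \<subseteq> ext S" using T by (auto simp: subset_iff)
  have "w' \<epsilon> T" using T[of w'] SC(2) w(1) w' by blast
  moreover have "\<not> ?H i w'" if "i \<epsilon> T" for i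
    using inj[of i w' w] w' that T[of i] w by blast
  moreover have "j \<epsilon> T" if "i \<epsilon> T" "?H i j" for i j
    using T[of j] T[of i] that SC(2) by blast
  ultimately have "?C T" by blast
  then have "T \<epsilon> F" unfolding F using TS SC(1) by blast
  then have "T = S" using S(2) TS by blast
  then show False using T[of w] w by blast
qed

text \<open>For sets of ordinals this is equivalent to finiteness, and it no longer mentions
  bijections or the number of elements.\<close>

definition "ordfin b \<longleftrightarrow> (\<forall>z. z \<epsilon> b \<longrightarrow> ordinal z) \<and>
  (\<forall>D. ext D \<subseteq> ext b \<longrightarrow> (\<exists>z. z \<epsilon> D) \<longrightarrow> (\<exists>m. m \<epsilon> D \<and> (\<forall>z. z \<epsilon> D \<longrightarrow> z = m \<or> z \<epsilon> m)))"

text \<open>To \<open>u\<close> in \<open>D\<close> belongs the set of indices whose value lies in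
  \<open>D\<close> and is at least \<open>u\<close>. A greater \<open>u\<close> has a smaller index
  set, so an inclusion-minimal index set yields the largest element of \<open>D\<close>.\<close>

lemma ordfin_bij:
  assumes n: "natural n" and k: "ordinal k" "ext a \<subseteq> ext k"
    and f: "func f (ext n)" "bij_betw (app f) (ext n) (ext a)"
  shows "ordfin a"
  unfolding ordfin_def
proof (intro conjI allI impI)
  show o: "ordinal z" if "z \<epsilon> a" for z using ordinal_mem[OF k(1) subextD[OF k(2) that]] .
  fix D assume D: "ext D \<subseteq> ext a" and "\<exists>z. z \<epsilon> D"
  then obtain z0 where z0: "z0 \<epsilon> D" by blast
  have oD: "ordinal z" if "z \<epsilon> D" for z using o[OF subextD[OF D that]] .
  let ?S = "\<lambda>u i. appd f i \<epsilon> D \<and> (appd f i = u \<or> u \<epsilon> appd f i)"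
  let ?Q = "\<lambda>S. \<exists>u. u \<epsilon> D \<and> (\<forall>i. i \<epsilon> S \<longleftrightarrow> i \<epsilon> n \<and> ?S u i)"
  have "df {UNIV} (\<lambda>A e. ?Q (e 0))" by (intro dfU)
  from sep_ex[of ?Q "setof {y. ext y \<subseteq> ext n}", OF this]
  obtain F where "\<And>S. S \<epsilon> F \<longleftrightarrow> S \<epsilon> setof {y. ext y \<subseteq> ext n} \<and> ?Q S" by blast
  then have F: "S \<epsilon> F \<longleftrightarrow> ext S \<subseteq> ext n \<and> ?Q S" for S by simp
  have ex: "\<exists>S. S \<epsilon> F \<and> (\<forall>i. i \<epsilon> S \<longleftrightarrow> i \<epsilon> n \<and> ?S u i)" if u: "u \<epsilon> D" for u
  proof -
    have "df {UNIV} (\<lambda>A e. ?S u (e 0))" by (intro dfU)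
    from sep_ex[of "?S u" n, OF this] obtain S where S: "\<And>i. i \<epsilon> S \<longleftrightarrow> i \<epsilon> n \<and> ?S u i" by blast
    have "ext S \<subseteq> ext n" using S by (auto simp: subset_iff)
    then have "S \<epsilon> F" unfolding F using S u by blast
    with S show ?thesis by blast
  qed
  obtain S0 where "S0 \<epsilon> F" using ex[OF z0] by blast
  then obtain S where S: "S \<epsilon> F" "\<And>T. T \<epsilon> F \<Longrightarrow> ext T \<subseteq> ext S \<Longrightarrow> T = S"
    using natural_minimal_subset[OF n, of S0 F] F by blast
  then obtain u where u: "u \<epsilon> D" "\<And>i. i \<epsilon> S \<longleftrightarrow> i \<epsilon> n \<and> ?S u i" using F by blast
  have "z = u \<or> z \<epsilon> u" if z: "z \<epsilon> D" for z
  proof (rule ccontr)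
    assume "\<not> (z = u \<or> z \<epsilon> u)"
    then have uz: "u \<epsilon> z" using ordinal_linear[OF oD[OF z] oD[OF u(1)]] by blast
    obtain T where T: "T \<epsilon> F" "\<And>i. i \<epsilon> T \<longleftrightarrow> i \<epsilon> n \<and> ?S z i" using ex[OF z] by blast
    have "i \<epsilon> S" if "i \<epsilon> T" for i
    proof -
      have i: "i \<epsilon> n" "appd f i \<epsilon> D" "appd f i = z \<or> z \<epsilon> appd f i" using that T(2) by blast+
      then have "u \<epsilon> appd f i" using uz ordinal_trans[OF oD[OF i(2)], of z u] by auto
      then show ?thesis using u(2)[of i] i by blast
    qed
    then have "ext T \<subseteq> ext S" by (auto simp: subset_iff)
    then have TS: "T = S" using S(2) T(1) by blast
    have "u \<in> ext a" using subextD[OF D u(1)] by simp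
    then have "u \<in> app f ` ext n" using f(2) unfolding bij_betw_def by simp
    then obtain i where "i \<in> ext n" "u = app f i" by blast
    then have i: "i \<epsilon> n" "appd f i = u" using appd_eq[OF f(1)] by simp_all
    then have "i \<epsilon> S" using u by blast
    then have "u = z \<or> z \<epsilon> u" using TS T(2)[of i] i by blast
    then show False using uz no_cycle2[OF uz] no_self by blast
  qed
  then show "\<exists>m. m \<epsilon> D \<and> (\<forall>z. z \<epsilon> D \<longrightarrow> z = m \<or> z \<epsilon> m)" using u(1) by blast
qed

text \<open>\<open>I\<close> is a predicate rather than a set, so that the same notion covers
  initial segments of the ordinals and the class of all sets.\<close>

definition "agree_off I b b' \<longleftrightarrow> (\<forall>z. \<not> I z \<longrightarrow> (z \<epsilon> b \<longleftrightarrow> z \<epsilon> b'))"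

definition "has_min_off B I \<longleftrightarrow> (\<forall>b0. B b0 \<longrightarrow>
  (\<exists>b. B b \<and> agree_off I b b0 \<and> (\<forall>b'. B b' \<and> agree_off I b' b0 \<longrightarrow> \<not> finset_less b' b)))"

text \<open>Among the sets agreeing with \<open>b0\<close> off \<open>I\<close>, first minimize the largest element in \<open>I\<close>, call it
  \<open>m\<close>, then minimize below \<open>m\<close>.\<close>

lemma has_min_off_step:
  assumes dB: "df {UNIV} (\<lambda>A e. B (e 0))" and dI: "df {UNIV} (\<lambda>A e. I (e 0))"
    and B: "\<And>b. B b \<Longrightarrow> ordfin b" and down: "\<And>y z. I z \<Longrightarrow> y \<epsilon> z \<Longrightarrow> I y"
    and IH: "\<And>m. ordinal m \<Longrightarrow> I m \<Longrightarrow> has_min_off B (\<lambda>z. z \<epsilon> m)"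
  shows "has_min_off B I"
  unfolding has_min_off_def
proof (intro allI impI)
  fix b0 assume b0: "B b0"
  note dB' = df1[where R = "\<lambda>A. B", OF dB] and dI' = df1[where R = "\<lambda>A. I", OF dI]
  show "\<exists>b. B b \<and> agree_off I b b0 \<and> (\<forall>b'. B b' \<and> agree_off I b' b0 \<longrightarrow> \<not> finset_less b' b)"
  proof (cases "\<exists>b. B b \<and> agree_off I b b0 \<and> (\<forall>z. z \<epsilon> b \<longrightarrow> \<not> I z)")
    case True
    then obtain b where b: "B b" "agree_off I b b0" "\<And>z. z \<epsilon> b \<Longrightarrow> \<not> I z" by blast
    have "\<not> finset_less b' b" if "agree_off I b' b0" for b'
    proof
      assume "finset_less b' b"
      then obtain m where "m \<epsilon> b" "\<not> m \<epsilon> b'" unfolding finset_less_iff by auto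
      then show False using b(2,3) that unfolding agree_off_def by blast
    qed
    with b show ?thesis by blast
  next
    case False
    let ?max = "\<lambda>b m. m \<epsilon> b \<and> I m \<and> (\<forall>z. z \<epsilon> b \<longrightarrow> I z \<longrightarrow> z = m \<or> z \<epsilon> m)"
    let ?P = "\<lambda>m. \<exists>b. B b \<and> agree_off I b b0 \<and> ?max b m"
    have mx: "\<exists>m. ?max b m" if b: "B b" "agree_off I b b0" for b
    proof -
      obtain D where D: "\<And>z. z \<epsilon> D \<longleftrightarrow> z \<epsilon> b \<and> I z" using sep_ex[of I b, OF dI] by blast
      have "ext D \<subseteq> ext b" using D by (auto simp: subset_iff)
      moreover have "\<exists>z. z \<epsilon> D" using D False b by blast
      ultimately obtain m where "m \<epsilon> D" "\<And>z. z \<epsilon> D \<Longrightarrow> z = m \<or> z \<epsilon> m"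
        using B[OF b(1)] unfolding ordfin_def by blast
      then show ?thesis using D by blast
    qed
    have "agree_off I b0 b0" unfolding agree_off_def by blast
    then obtain m0 where m0: "?max b0 m0" using mx[OF b0] by blast
    then have p0: "?P m0" using b0 \<open>agree_off I b0 b0\<close> by blast
    have o0: "ordinal m0" using B[OF b0] m0 unfolding ordfin_def by blast
    have "df {UNIV} (\<lambda>A e. ?P (e 0))" unfolding agree_off_def by (intro dfU dB' dI')
    from ordinal_least_ex[of ?P m0, OF this o0 p0]
    obtain m where m: "ordinal m" "?P m" "\<And>c. c \<epsilon> m \<Longrightarrow> \<not> ?P c" by blast
    then obtain b1 where b1: "B b1" "agree_off I b1 b0" "?max b1 m" by blast
    then obtain b where b: "B b" "agree_off (\<lambda>z. z \<epsilon> m) b b1"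
      "\<And>b'. B b' \<Longrightarrow> agree_off (\<lambda>z. z \<epsilon> m) b' b1 \<Longrightarrow> \<not> finset_less b' b"
      using IH[OF m(1)] unfolding has_min_off_def by blast
    have bb1: "z \<epsilon> b \<longleftrightarrow> z \<epsilon> b1" if "\<not> z \<epsilon> m" for z using b(2) that unfolding agree_off_def by blast
    have bb0: "z \<epsilon> b \<longleftrightarrow> z \<epsilon> b0" if "\<not> I z" for z
      using bb1[of z] b1(2,3) that down[of m z] unfolding agree_off_def by blast
    have "\<not> finset_less b' b" if b': "B b'" "agree_off I b' b0" for b'
    proof
      assume less: "finset_less b' b"
      then obtain u where u: "u \<epsilon> b" "\<not> u \<epsilon> b'" "\<And>z. z \<epsilon> b' \<Longrightarrow> \<not> z \<epsilon> b \<Longrightarrow> z = u \<or> z \<epsilon> u"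
        unfolding finset_less_iff by auto
      have b'0: "z \<epsilon> b' \<longleftrightarrow> z \<epsilon> b0" if "\<not> I z" for z using b'(2) that unfolding agree_off_def by blast
      have "I u" using u(1,2) b'0[of u] bb0[of u] by blast
      then have um: "u = m \<or> u \<epsilon> m" using bb1[of u] u(1) b1(3) by blast
      obtain m' where m': "?max b' m'" using mx[OF b'] by blast
      have "ordinal m'" using B[OF b'(1)] m' unfolding ordfin_def by blast
      moreover have "\<not> m' \<epsilon> m" using m(3)[of m'] b' m' by blast
      ultimately have mm: "m' = m \<or> m \<epsilon> m'" using ordinal_linear[OF _ m(1), of m'] by blast
      \<comment> \<open>If \<open>m'\<close> were above \<open>m\<close>, it would not be in
        \<open>b\<close>, so it would be a difference of \<open>b'\<close> and \<open>b\<close> and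
        thus at most \<open>u\<close>, which is at most \<open>m\<close>.\<close>
      have "m' = m"
      proof (rule ccontr)
        assume ne: "m' \<noteq> m"
        then have mem: "m \<epsilon> m'" using mm by blast
        have "\<not> m' \<epsilon> b" using bb1[OF \<open>\<not> m' \<epsilon> m\<close>] b1(3) m' ne \<open>\<not> m' \<epsilon> m\<close> by blast
        then have "m' = u \<or> m' \<epsilon> u" using u(3) m' by blast
        then show False using um ne \<open>\<not> m' \<epsilon> m\<close> ordinal_trans[OF m(1), of u m'] by blast
      qed
      have "agree_off (\<lambda>z. z \<epsilon> m) b' b1" unfolding agree_off_def
      proof (intro allI impI)
        fix z assume z: "\<not> z \<epsilon> m"
        show "z \<epsilon> b' \<longleftrightarrow> z \<epsilon> b1"
        proof (cases "I z")
          case True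
          then show ?thesis using z m' b1(3) \<open>m' = m\<close> by blast
        next
          case False
          then show ?thesis using b'0[of z] b1(2) unfolding agree_off_def by blast
        qed
      qed
      then show False using b(3)[OF b'(1)] less by blast
    qed
    then show ?thesis using b(1) bb0 unfolding agree_off_def by blast
  qed
qed

text \<open>\<open>B\<close> may be a proper class with no bound on the ordinals involved. Induction
  gives the claim for every initial segment of the ordinals, and one more application of the step,
  with \<open>I\<close> always true, removes the bound.\<close>

theorem finset_less_minimal:
  assumes dB: "df {UNIV} (\<lambda>A e. B (e 0))" and B: "\<And>b. B b \<Longrightarrow> ordfin b" and b0: "B b0"
  shows "\<exists>b. B b \<and> (\<forall>b'. B b' \<longrightarrow> \<not> finset_less b' b)"
proof -
  note dB' = df1[where R = "\<lambda>A. B", OF dB]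
  have ord: "has_min_off B (\<lambda>z. z \<epsilon> a)" if a: "ordinal a" for a
  proof (rule ccontr)
    assume n: "\<not> has_min_off B (\<lambda>z. z \<epsilon> a)"
    have "df {UNIV} (\<lambda>A e. \<not> has_min_off B (\<lambda>z. z \<epsilon> e 0))"
      unfolding has_min_off_def agree_off_def by (intro dfU dB' df_finset_less)
    from ordinal_least_ex[of "\<lambda>a. \<not> has_min_off B (\<lambda>z. z \<epsilon> a)", OF this a n]
    obtain c where c: "ordinal c" "\<not> has_min_off B (\<lambda>z. z \<epsilon> c)" "\<And>m. m \<epsilon> c \<Longrightarrow> has_min_off B (\<lambda>z. z \<epsilon> m)"
      by blast
    have dI: "df {UNIV} (\<lambda>A e. e 0 \<epsilon> c)" by (intro dfU)
    have "has_min_off B (\<lambda>z. z \<epsilon> c)"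
      by (rule has_min_off_step[OF dB dI B]) (use c(3) ordinal_trans[OF c(1)] in blast)+
    with c(2) show False by blast
  qed
  have "has_min_off B (\<lambda>z. True)"
    by (rule has_min_off_step[OF dB _ B]) (use ord df_const in blast)+
  then show ?thesis using b0 unfolding has_min_off_def agree_off_def by blast
qed

section \<open>Descending sequences\<close>

lemma df_ccU:
  assumes "tm {UNIV} t" "tm {UNIV} u" shows "df {UNIV} (\<lambda>A e. cc_ultrafilter UNIV (t A e) (u A e))"
  by (rule df_cong[OF df_cc[OF assms]]) simp

lemma ketonen_wf:
  assumes cc: "\<And>n. natural n \<Longrightarrow> cc_ultrafilter UNIV (X n) (U n)"
    and ket: "\<And>n. natural n \<Longrightarrow> ketonen (X (suc n)) (U (suc n)) (X n) (U n) (F n)"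
    and fin: "\<And>n x. natural n \<Longrightarrow> x \<epsilon> X n \<Longrightarrow> ordfin x"
    and tm: "tm {UNIV} (\<lambda>A e. X (e 0))" "tm {UNIV} (\<lambda>A e. U (e 0))" "tm {UNIV} (\<lambda>A e. F (e 0))"
  shows False
proof -
  note tX = tm_comp1[where F = X, OF tm(1)] and tU = tm_comp1[where F = U, OF tm(2)]
    and tF = tm_comp1[where F = F, OF tm(3)]
  \<comment> \<open>\<open>F n x\<close> is known to be an ultrafilter concentrating below
    \<open>x\<close> only for almost all \<open>x\<close>. At the other points the process breaks
    off at once.\<close>
  define good where "good n x \<longleftrightarrow> cc_ultrafilter UNIV (X (suc n)) (appd (F n) x) \<and>
    big (X (suc n)) (appd (F n) x) (\<lambda>a. finset_less a x)" for n x
  \<comment> \<open>The recursion clause for failing within \<open>suc m\<close> steps: the process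
    breaks off at \<open>x\<close>, or almost every successor \<open>y\<close> of \<open>x\<close>
    fails within \<open>m\<close> steps. \<open>fail\<close> is the least solution, as the
    intersection of all closed sets of coded triples; there is no clause for
    \<open>m = zero\<close>.\<close>
  define closed where "closed C \<longleftrightarrow> (\<forall>m n x. natural m \<and> natural n \<and> x \<epsilon> X n \<and>
      (good n x \<longrightarrow> big (X (suc n)) (appd (F n) x) (\<lambda>y. pr (pr m (suc n)) y \<epsilon> C)) \<longrightarrow>
      pr (pr (suc m) n) x \<epsilon> C)" for C
  define fail where "fail m n x \<longleftrightarrow> (\<forall>C. closed C \<longrightarrow> pr (pr m n) x \<epsilon> C)" for m n x
  have "df {UNIV} (\<lambda>A e. good (e 0) (e 1))"
    unfolding good_def by (intro dfU df_ccU df_big df_finset_less tX tF)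
  note dgood = df2[where R = "\<lambda>A. good", OF this]
  have "df {UNIV} (\<lambda>A e. closed (e 0))"
    unfolding closed_def by (intro dfU dgood df_big tX tF)
  note dclosed = df1[where R = "\<lambda>A. closed", OF this]
  have "df {UNIV} (\<lambda>A e. fail (e 0) (e 1) (e 2))"
    unfolding fail_def by (intro dfU dclosed)
  note dfail = df3[where R = "\<lambda>A. fail", OF this]

  have fail_suc: "fail (suc m) n x" if mn: "natural m" "natural n" "x \<epsilon> X n"
    and b: "good n x \<longrightarrow> big (X (suc n)) (appd (F n) x) (\<lambda>y. fail m (suc n) y)" for m n x
    unfolding fail_def
  proof (intro allI impI)
    fix C assume C: "closed C"
    have "big (X (suc n)) (appd (F n) x) (\<lambda>y. pr (pr m (suc n)) y \<epsilon> C)" if g: "good n x"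
    proof (rule big_mono)
      show "cc_ultrafilter UNIV (X (suc n)) (appd (F n) x)" using g unfolding good_def by blast
      show "big (X (suc n)) (appd (F n) x) (\<lambda>y. fail m (suc n) y)" using b g by blast
      show "df {UNIV} (\<lambda>A e. pr (pr m (suc n)) (e 0) \<epsilon> C)" by (intro dfU)
      show "pr (pr m (suc n)) y \<epsilon> C" if "fail m (suc n) y" for y using that C unfolding fail_def by blast
    qed
    then show "pr (pr (suc m) n) x \<epsilon> C" using C mn unfolding closed_def by blast
  qed

  \<comment> \<open>\<open>fail\<close> quantifies over closed sets, not classes. A set containing
    all relevant triples is needed, from which particular closed sets can be separated.\<close>
  obtain Q where Q: "\<And>m n x. natural m \<Longrightarrow> natural n \<Longrightarrow> x \<epsilon> X n \<Longrightarrow> pr (pr m n) x \<epsilon> Q"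
  proof -
    have i1: "isset {p. \<exists>x y. x \<epsilon> omega \<and> y \<epsilon> omega \<and> p = pr x y}" by (rule isset_Sigma) (rule tm_constU)
    have i2: "isset (\<Union>n\<in>ext omega. ext (X n))" by (rule isset_UN) (rule tm(1))
    let ?P = "setof {p. \<exists>x y. x \<epsilon> omega \<and> y \<epsilon> omega \<and> p = pr x y}"
    let ?X = "setof (\<Union>n\<in>ext omega. ext (X n))"
    have i3: "isset {p. \<exists>x y. x \<epsilon> ?P \<and> y \<epsilon> ?X \<and> p = pr x y}" by (rule isset_Sigma) (rule tm_constU)
    have "pr (pr m n) x \<epsilon> setof {p. \<exists>x y. x \<epsilon> ?P \<and> y \<epsilon> ?X \<and> p = pr x y}"
      if "natural m" "natural n" "x \<epsilon> X n" for m n x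
    proof -
      have "pr m n \<epsilon> ?P" "x \<epsilon> ?X" unfolding mem_setof[OF i1] mem_setof[OF i2] using that by auto
      then show ?thesis unfolding mem_setof[OF i3] by blast
    qed
    then show ?thesis by (rule that)
  qed

  have fail_zero: "\<not> fail zero n x" for n x
  proof
    assume f: "fail zero n x"
    \<comment> \<open>All triples in \<open>Q\<close> with a successor in first place form a closed
      set, and no triple with \<open>zero\<close> there belongs to it.\<close>
    have "df {UNIV} (\<lambda>A e. \<exists>m n x. e 0 = pr (pr (suc m) n) x)" by (intro dfU)
    from sep_ex[of "\<lambda>p. \<exists>m n x. p = pr (pr (suc m) n) x" Q, OF this]
    obtain C where C: "\<And>p. p \<epsilon> C \<longleftrightarrow> p \<epsilon> Q \<and> (\<exists>m n x. p = pr (pr (suc m) n) x)" by blast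
    have "closed C" unfolding closed_def
    proof (intro allI impI, elim conjE)
      fix m n x assume "natural m" "natural n" "x \<epsilon> X n"
      then have "pr (pr (suc m) n) x \<epsilon> Q" by (intro Q) simp_all
      then show "pr (pr (suc m) n) x \<epsilon> C" using C by blast
    qed
    then have "pr (pr zero n) x \<epsilon> C" using f unfolding fail_def by blast
    then obtain m n' x' where "pr (pr zero n) x = pr (pr (suc m) n') x'" using C by blast
    then show False by simp
  qed

  have fail_sucD: "big (X (suc n)) (appd (F n) x) (\<lambda>y. fail m (suc n) y)"
    if mn: "natural m" "natural n" "x \<epsilon> X n" and f: "fail (suc m) n x" and g: "good n x" for m n x
  proof (rule ccontr)
    assume nb: "\<not> big (X (suc n)) (appd (F n) x) (\<lambda>y. fail m (suc n) y)"
    \<comment> \<open>Inversion of the least solution: if the clause did not hold at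
      \<open>?p\<close>, the failing triples without \<open>?p\<close> would still be closed, and so
      \<open>?p\<close> would not fail.\<close>
    let ?p = "pr (pr (suc m) n) x"
    let ?R = "\<lambda>p. p \<noteq> ?p \<and> (\<exists>m n x. p = pr (pr m n) x \<and> fail m n x)"
    have "df {UNIV} (\<lambda>A e. ?R (e 0))" by (intro dfU dfail)
    from sep_ex[of ?R Q, OF this] obtain C where C: "\<And>p. p \<epsilon> C \<longleftrightarrow> p \<epsilon> Q \<and> ?R p" by blast
    have "closed C" unfolding closed_def
    proof (intro allI impI, elim conjE)
      fix m' n' x' assume mn': "natural m'" "natural n'" "x' \<epsilon> X n'"
        and b: "good n' x' \<longrightarrow> big (X (suc n')) (appd (F n') x') (\<lambda>y. pr (pr m' (suc n')) y \<epsilon> C)"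
      have b': "big (X (suc n')) (appd (F n') x') (\<lambda>y. fail m' (suc n') y)" if g': "good n' x'"
      proof (rule big_mono)
        show "cc_ultrafilter UNIV (X (suc n')) (appd (F n') x')" using g' unfolding good_def by blast
        show "big (X (suc n')) (appd (F n') x') (\<lambda>y. pr (pr m' (suc n')) y \<epsilon> C)" using b g' by blast
        show "df {UNIV} (\<lambda>A e. fail m' (suc n') (e 0))" by (intro dfU dfail)
        show "fail m' (suc n') y" if "pr (pr m' (suc n')) y \<epsilon> C" for y
          using that C[of "pr (pr m' (suc n')) y"] by auto
      qed
      then have "fail (suc m') n' x'" using fail_suc[OF mn'] by blast
      moreover have "pr (pr (suc m') n') x' \<noteq> ?p" using b' g nb by auto
      moreover have "pr (pr (suc m') n') x' \<epsilon> Q" using mn' by (intro Q) simp_all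
      ultimately show "pr (pr (suc m') n') x' \<epsilon> C" using C by blast
    qed
    then have "?p \<epsilon> C" using f unfolding fail_def by blast
    then show False using C by blast
  qed

  have dnf: "df {UNIV} (\<lambda>A e. \<not> fail m n (e 0))" for m n by (intro dfU dfail)
  have large: "\<forall>n. natural n \<longrightarrow> big (X n) (U n) (\<lambda>x. \<not> fail m n x)" if "natural m" for m
  proof (rule natural_induct[where P = "\<lambda>m. \<forall>n. natural n \<longrightarrow> big (X n) (U n) (\<lambda>x. \<not> fail m n x)", OF that])
    show "\<forall>n. natural n \<longrightarrow> big (X n) (U n) (\<lambda>x. \<not> fail zero n x)"
      by (intro allI impI big_all[OF cc dnf] fail_zero)
  next
    fix m assume m: "natural m" and IH: "\<forall>n. natural n \<longrightarrow> big (X n) (U n) (\<lambda>x. \<not> fail m n x)"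
    show "\<forall>n. natural n \<longrightarrow> big (X n) (U n) (\<lambda>x. \<not> fail (suc m) n x)"
    proof (intro allI impI)
      fix n assume n: "natural n"
      have k: "big (X n) (U n) (good n)"
        "\<And>T. ext T \<subseteq> ext (X (suc n)) \<Longrightarrow> T \<epsilon> U (suc n) \<Longrightarrow> big (X n) (U n) (\<lambda>x. T \<epsilon> appd (F n) x)"
        using ket[OF n] unfolding ketonen_def good_def by blast+
      have "big (X (suc n)) (U (suc n)) (\<lambda>x. \<not> fail m (suc n) x)" using IH n by simp
      \<comment> \<open>The nonfailing points for \<open>m\<close> contain a member \<open>T\<close>
        of \<open>U (suc n)\<close>. As this ultrafilter is the limit of the \<open>F n x\<close>,
        almost every \<open>F n x\<close> contains \<open>T\<close>, so almost every
        \<open>x\<close> survives one step more.\<close>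
      then obtain T where T: "T \<epsilon> U (suc n)" "\<And>y. y \<epsilon> T \<Longrightarrow> \<not> fail m (suc n) y \<and> y \<epsilon> X (suc n)"
        by (rule bigE) (rule that)
      have TX: "ext T \<subseteq> ext (X (suc n))" using T(2) by (auto simp: subset_iff)
      have dg: "df {UNIV} (\<lambda>A e. good n (e 0))" "df {UNIV} (\<lambda>A e. T \<epsilon> appd (F n) (e 0))"
        by (intro dfU dgood tF)+
      have b: "big (X n) (U n) (\<lambda>x. good n x \<and> T \<epsilon> appd (F n) x)"
        using big_conj[of "X n" "U n" "good n" "\<lambda>x. T \<epsilon> appd (F n) x", OF cc[OF n] dg] k(1) k(2)[OF TX T(1)]
        by blast
      show "big (X n) (U n) (\<lambda>x. \<not> fail (suc m) n x)"
      proof (rule big_mono[OF cc[OF n] dnf b], elim conjE, rule notI)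
        fix x assume x: "x \<epsilon> X n" and g: "good n x" and Tx: "T \<epsilon> appd (F n) x" and f: "fail (suc m) n x"
        have ccx: "cc_ultrafilter UNIV (X (suc n)) (appd (F n) x)" using g unfolding good_def by blast
        have "big (X (suc n)) (appd (F n) x) (\<lambda>y. \<not> fail m (suc n) y)"
          by (rule bigI[OF ccx dnf Tx]) (use T(2) in blast)
        moreover have df': "df {UNIV} (\<lambda>A e. fail m (suc n) (e 0))" by (intro dfU dfail)
        ultimately show False
          using big_not[of "X (suc n)" "appd (F n) x" "fail m (suc n)", OF ccx df'] fail_sucD[OF m n x f g] by blast
      qed
    qed
  next
    show "df {UNIV} (\<lambda>A e. \<forall>n. natural n \<longrightarrow> big (X n) (U n) (\<lambda>x. \<not> fail (e 0) n x))"
      by (intro dfU df_big dfail tX tU)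
  qed

  \<comment> \<open>The points surviving any number of steps are gathered over all \<open>n\<close>,
    because one step leads from \<open>X n\<close> to \<open>X (suc n)\<close> and has to stay in
    \<open>B\<close>.\<close>
  define B where "B x \<longleftrightarrow> (\<exists>n. natural n \<and> x \<epsilon> X n \<and> (\<forall>m. natural m \<longrightarrow> \<not> fail m n x))" for x
  have dB: "df {UNIV} (\<lambda>A e. B (e 0))" unfolding B_def by (intro dfU dfail tX)
  have dR: "df {UNIV} (\<lambda>A e. \<not> fail (e 0) n (e 1))" for n by (intro dfU dfail)
  have "big (X zero) (U zero) (\<lambda>x. \<forall>m. natural m \<longrightarrow> \<not> fail m zero x)"
    by (rule big_countable[OF cc[OF natural_zero] dR]) (use large in simp)
  from big_nonempty[OF cc[OF natural_zero] this]
  obtain x0 where "x0 \<epsilon> X zero" "\<forall>m. natural m \<longrightarrow> \<not> fail m zero x0" by blast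
  then have "B x0" unfolding B_def using natural_zero by blast
  moreover have Bfin: "ordfin b" if "B b" for b using that fin unfolding B_def by blast
  ultimately obtain x where x: "B x" "\<And>y. B y \<Longrightarrow> \<not> finset_less y x"
    using finset_less_minimal[of B x0, OF dB Bfin] by blast
  then obtain n where n: "natural n" "x \<epsilon> X n" "\<And>m. natural m \<Longrightarrow> \<not> fail m n x" unfolding B_def by blast
  \<comment> \<open>A point that is not good already fails within one step.\<close>
  have g: "good n x" using n(3)[OF natural_suc[OF natural_zero]] fail_suc[OF natural_zero n(1,2)] by blast
  then have ccx: "cc_ultrafilter UNIV (X (suc n)) (appd (F n) x)"
    and less: "big (X (suc n)) (appd (F n) x) (\<lambda>a. finset_less a x)" unfolding good_def by blast+
  have "big (X (suc n)) (appd (F n) x) (\<lambda>y. \<not> fail m (suc n) y)" if m: "natural m" for m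
  proof -
    have df': "df {UNIV} (\<lambda>A e. fail m (suc n) (e 0))" by (intro dfU dfail)
    show ?thesis
      using n(3)[OF natural_suc[OF m]] fail_suc[OF m n(1,2)] g
        big_not[of "X (suc n)" "appd (F n) x" "fail m (suc n)", OF ccx df'] by blast
  qed
  \<comment> \<open>For each \<open>m\<close> almost every \<open>y\<close> survives
    \<open>m\<close> steps; countable completeness of \<open>F n x\<close> yields the
    \<open>y\<close> that survive them all. One of these lies below \<open>x\<close>, against
    minimality.\<close>
  then have b: "big (X (suc n)) (appd (F n) x) (\<lambda>y. \<forall>m. natural m \<longrightarrow> \<not> fail m (suc n) y)"
    by (rule big_countable[OF ccx dR])
  have d: "df {UNIV} (\<lambda>A e. finset_less (e 0) x)"
    "df {UNIV} (\<lambda>A e. \<forall>m. natural m \<longrightarrow> \<not> fail m (suc n) (e 0))" by (intro dfU dfail df_finset_less)+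
  have "big (X (suc n)) (appd (F n) x) (\<lambda>y. finset_less y x \<and> (\<forall>m. natural m \<longrightarrow> \<not> fail m (suc n) y))"
    using big_conj[of "X (suc n)" "appd (F n) x" "\<lambda>y. finset_less y x"
      "\<lambda>y. \<forall>m. natural m \<longrightarrow> \<not> fail m (suc n) y", OF ccx d] less b by blast
  from big_nonempty[OF ccx this] obtain y where "y \<epsilon> X (suc n)" "finset_less y x"
    "\<forall>m. natural m \<longrightarrow> \<not> fail m (suc n) y" by blast
  then show False using x(2)[of y] natural_suc[OF n(1)] unfolding B_def by blast
qed

section \<open>Uniform ultrafilters and descending sequences in the seed order\<close>

lemma uniformD:
  assumes "Defs.uniform E U"
  obtains k n X where "ordinal k" "natural n" "is_subsets k n X" "cc_ultrafilter UNIV X U"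
    "\<And>l Y. l \<epsilon> k \<Longrightarrow> is_subsets l n Y \<Longrightarrow> \<not> Y \<epsilon> U"
proof -
  from assms obtain k n X where "ordinal k" "natural n" "is_subsets k n X" "cc_ultrafilter UNIV X U"
    "\<forall>l\<in>ext k. \<forall>Y. is_subsets l n Y \<longrightarrow> \<not> Y \<epsilon> U" unfolding Defs.uniform_def by blast
  then show ?thesis by (intro that[of k n X]) auto
qed

lemma is_subsetsD:
  assumes "is_subsets k n X" "a \<epsilon> X"
  shows "ext a \<subseteq> ext k" "\<exists>f. func f (ext n) \<and> bij_betw (app f) (ext n) (ext a)"
proof -
  have "a \<in> ext X" using assms(2) by simp
  then show "ext a \<subseteq> ext k" "\<exists>f. func f (ext n) \<and> bij_betw (app f) (ext n) (ext a)"
    using assms(1) unfolding Defs.is_subsets_def by blast+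
qed

lemma uniform_ordfin:
  assumes "Defs.uniform E U" "cc_ultrafilter UNIV X U" "x \<epsilon> X" shows "ordfin x"
proof -
  obtain k n X' where u: "ordinal k" "natural n" "is_subsets k n X'" "cc_ultrafilter UNIV X' U"
    using uniformD[OF assms(1)] by metis
  have "x \<epsilon> X'" using cc_unique[OF u(4) assms(2)] assms(3) by simp
  then show ?thesis using ordfin_bij[OF u(2,1)] is_subsetsD[OF u(3)] by blast
qed

text \<open>Almost every point of the second ultrafilter lies in \<open>X0\<close>, which is
  contained in \<open>X1\<close> when \<open>k0\<close> is below \<open>k1\<close>. For uniform
  \<open>U1\<close> this contradicts the leastness of \<open>k1\<close>.\<close>

lemma is_subsets_smaller:
  assumes "cc_ultrafilter UNIV X0 U0" "cc_ultrafilter UNIV X1 U1"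
    and eq: "\<And>B. big X0 U0 (\<lambda>x. x \<epsilon> B) \<longleftrightarrow> big X1 U1 (\<lambda>x. x \<epsilon> B)"
    and "is_subsets k0 n X0" "is_subsets k1 n X1" "ordinal k1" "k0 \<epsilon> k1"
  shows "X0 \<epsilon> U1"
proof -
  have dX: "df {UNIV} (\<lambda>A e. e 0 \<epsilon> X0)" by (intro dfU)
  have "big X1 U1 (\<lambda>x. x \<epsilon> X0)" using eq big_all[of X0 U0 "\<lambda>x. x \<epsilon> X0", OF assms(1) dX] by blast
  moreover have "ext k0 \<subseteq> ext k1" using ordinal_trans[OF assms(6,7)] by (auto simp: subset_iff)
  then have "ext X0 \<subseteq> ext X1" using assms(4,5) unfolding Defs.is_subsets_def by blast
  then have "{x \<in> ext X1. x \<epsilon> X0} = ext X0" by auto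
  ultimately show ?thesis unfolding big_def by (auto simp del: mem_ext simp: mem_ext[symmetric, of _ U1])
qed

text \<open>This excludes the case of equal seed images. The underlying sets have to be identified
  first: a common element has both \<open>n0\<close> and \<open>n1\<close> elements, so these agree,
  and then \<open>k0 = k1\<close> because both are least.\<close>

lemma uniform_eq:
  assumes u: "Defs.uniform E U0" "Defs.uniform E U1"
    and cc: "cc_ultrafilter UNIV X0 U0" "cc_ultrafilter UNIV X1 U1"
    and eq: "\<And>B. big X0 U0 (\<lambda>x. x \<epsilon> B) \<longleftrightarrow> big X1 U1 (\<lambda>x. x \<epsilon> B)"
  shows "U0 = U1"
proof -
  obtain k0 n0 X0' where 0: "ordinal k0" "natural n0" "is_subsets k0 n0 X0'" "cc_ultrafilter UNIV X0' U0"
    "\<And>l Y. l \<epsilon> k0 \<Longrightarrow> is_subsets l n0 Y \<Longrightarrow> \<not> Y \<epsilon> U0" by (rule uniformD[OF u(1)]) (rule that)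
  obtain k1 n1 X1' where 1: "ordinal k1" "natural n1" "is_subsets k1 n1 X1'" "cc_ultrafilter UNIV X1' U1"
    "\<And>l Y. l \<epsilon> k1 \<Longrightarrow> is_subsets l n1 Y \<Longrightarrow> \<not> Y \<epsilon> U1" by (rule uniformD[OF u(2)]) (rule that)
  have X: "X0' = X0" "X1' = X1" using cc_unique[OF 0(4) cc(1)] cc_unique[OF 1(4) cc(2)] .
  note s0 = 0(3)[unfolded X] and s1 = 1(3)[unfolded X]
  have dX: "df {UNIV} (\<lambda>A e. e 0 \<epsilon> S)" for S by (intro dfU)
  have "big X1 U1 (\<lambda>x. x \<epsilon> X0)" using eq big_all[of X0 U0 "\<lambda>x. x \<epsilon> X0", OF cc(1) dX] by blast
  from big_nonempty[OF cc(2) this] obtain a where a: "a \<epsilon> X1" "a \<epsilon> X0" by blast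
  have n: "n0 = n1"
    using ordinal_linear[OF natural_ordinal[OF 0(2)] natural_ordinal[OF 1(2)]]
      is_subsetsD(2)[OF s0 a(2)] is_subsetsD(2)[OF s1 a(1)] natural_no_bij[OF _ 0(2)] natural_no_bij[OF _ 1(2)]
    by blast
  have k: "k0 = k1"
    using ordinal_linear[OF 0(1) 1(1)] is_subsets_smaller[OF cc eq s0 s1[folded n] 1(1)]
      is_subsets_smaller[OF cc(2,1) eq[symmetric] s1[folded n] s0 0(1)] 0(5)[OF _ s1[folded n]] 1(5)[OF _ s0[unfolded n]]
    by blast
  have XX: "X0 = X1" using s0 s1 unfolding n k Defs.is_subsets_def by (metis ext_inject)
  have iff: "S \<epsilon> V \<longleftrightarrow> ext S \<subseteq> ext X1 \<and> big X1 V (\<lambda>x. x \<epsilon> S)" if V: "cc_ultrafilter UNIV X1 V" for S V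
  proof
    assume "S \<epsilon> V"
    then show "ext S \<subseteq> ext X1 \<and> big X1 V (\<lambda>x. x \<epsilon> S)" using cc_sub[OF V] bigI[OF V dX, of S S] by blast
  next
    assume b: "ext S \<subseteq> ext X1 \<and> big X1 V (\<lambda>x. x \<epsilon> S)"
    then obtain T where "T \<epsilon> V" "\<And>x. x \<epsilon> T \<Longrightarrow> x \<epsilon> S \<and> x \<epsilon> X1" using bigE by metis
    then show "S \<epsilon> V" using cc_up[OF V, of T S] b by (auto simp: subset_iff)
  qed
  have "S \<epsilon> U0 \<longleftrightarrow> S \<epsilon> U1" for S
    using iff[OF cc(1)[unfolded XX], of S] iff[OF cc(2), of S] eq[of S] unfolding XX by blast
  then show ?thesis by (rule ext_eqI)
qed

lemma seed_less_ketonen: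
  assumes "Defs.seed_less E U0 U1" "Defs.uniform E U0" "Defs.uniform E U1"
    "cc_ultrafilter UNIV X0 U0" "cc_ultrafilter UNIV X1 U1"
  shows "\<exists>F. ketonen X0 U0 X1 U1 F"
proof -
  obtain W0 W1 t0 t1 where c: "Defs.comparison E U0 U1 W0 W1 t0 t1" "finset_less t0 t1 \<or> t0 = t1"
    using assms(1) unfolding Defs.seed_less_def Defs.seed_le_def by blast
  from c(1) show ?thesis
  proof (rule comparison_cases)
    fix X0' X1'
    assume a: "cc_ultrafilter UNIV X0' U0" "cc_ultrafilter UNIV X1' U1"
      "t0 = t1 \<Longrightarrow> \<forall>B. big X0' U0 (\<lambda>x. x \<epsilon> B) \<longleftrightarrow> big X1' U1 (\<lambda>x. x \<epsilon> B)"
      "finset_less t0 t1 \<Longrightarrow> \<exists>F. ketonen X0' U0 X1' U1 F"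
    have X: "X0' = X0" "X1' = X1" using cc_unique[OF a(1) assms(4)] cc_unique[OF a(2) assms(5)] .
    have "U0 \<noteq> U1" using assms(1) unfolding Defs.seed_less_def by blast
    then have "t0 \<noteq> t1" using uniform_eq[OF assms(2-5)] a(3) unfolding X by blast
    then show ?thesis using a(4) c(2) unfolding X by blast
  qed
qed

text \<open>The underlying sets and the functions \<open>F\<close> exist for each index separately.
  They are chosen inside the model, so that all three sequences are definable operations, as
  \<open>ketonen_wf\<close> requires.\<close>

theorem no_descending_sequence:
  assumes s: "func s {i. natural i}"
    and u: "\<And>i. natural i \<Longrightarrow> Defs.uniform E (app s i)"
    and less: "\<And>i. natural i \<Longrightarrow> Defs.seed_less E (app s (suc i)) (app s i)"
  shows False
proof -
  have s': "app s i = appd s i" if "natural i" for i using appd_eq[OF s, of i] that by simp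
  have u': "Defs.uniform E (appd s i)" if "natural i" for i using u[OF that] s'[OF that] by simp
  have "df {UNIV} (\<lambda>A e. cc_ultrafilter UNIV (e 1) (appd s (e 0)))" by (intro dfU df_ccU)
  then have "\<exists>f. func f (ext omega) \<and> (\<forall>i\<in>ext omega. cc_ultrafilter UNIV (app f i) (appd s i))"
    by (rule choice) (use u' uniformD in \<open>metis mem_omega\<close>)
  then obtain X where X: "func X (ext omega)" "\<forall>i\<in>ext omega. cc_ultrafilter UNIV (app X i) (appd s i)" by blast
  have cc: "cc_ultrafilter UNIV (appd X i) (appd s i)" if "natural i" for i
    using X(2) appd_eq[OF X(1), of i] that by simp
  let ?R = "\<lambda>i F. ketonen (appd X (suc i)) (appd s (suc i)) (appd X i) (appd s i) F"
  have "df {UNIV} (\<lambda>A e. ?R (e 0) (e 1))"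
    unfolding ketonen_def by (intro dfU df_ccU df_big df_finset_less)
  then have "\<exists>f. func f (ext omega) \<and> (\<forall>i\<in>ext omega. ?R i (app f i))"
  proof (rule choice)
    fix i assume "i \<epsilon> omega"
    then have i: "natural i" by simp
    show "\<exists>F. ?R i F"
      by (rule seed_less_ketonen) (use less[OF i] u' cc s' i in simp_all)
  qed
  then obtain F where F: "func F (ext omega)" "\<forall>i\<in>ext omega. ?R i (app F i)" by blast
  have ket: "?R i (appd F i)" if "natural i" for i using F(2) appd_eq[OF F(1), of i] that by simp
  show False
  proof (rule ketonen_wf[where X = "appd X" and U = "appd s" and F = "appd F"])
    show "ordfin x" if "natural n" "x \<epsilon> appd X n" for n x
      using uniform_ordfin[OF u'[OF that(1)] cc[OF that(1)] that(2)] .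
  qed (use cc ket in \<open>(blast | intro dfU)+\<close>)
qed

end

theorem theorem3p10:
  fixes E :: "'v \<Rightarrow> 'v \<Rightarrow> bool"
  assumes "ZFC E"
    and "Ultrapower_Axiom E"
  shows "\<not> (\<exists>s. func E s {i. natural E i} \<and>
    (\<forall>i. natural E i \<longrightarrow> uniform E (app E s i)) \<and>
    (\<forall>i i'. natural E i \<and> is_succ E i' i \<longrightarrow> seed_less E (app E s i') (app E s i)))"
proof -
  interpret zfc E by unfold_locales (rule assms(1))
  show ?thesis
  proof (rule notI, elim exE conjE)
    fix s assume "func s {i. natural i}" "\<forall>i. natural i \<longrightarrow> Defs.uniform E (app s i)"
      "\<forall>i i'. natural i \<and> is_succ i' i \<longrightarrow> Defs.seed_less E (app s i') (app s i)"
    then show False by (intro no_descending_sequence[of s]) simp_all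
  qed
qed

end
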